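(* For every constant integer $k\geq 4$ and every integer $n\geq k$ with $\sqrt{n}\in\mathbb{N}$, there exists a set of $n$ points in general position in the plane that has at most $O\!\left(n^{\frac{k+1}{2}}(\log n)^{k-3}\right)$ $k$-holes.
   Context: A point set in the plane is in general position if no three of its points are collinear. For such a point set $S$, a $k$-gon of $S$ is a simple polygon whose vertex set consists of exactly $k$ points of $S$ (distinct simple polygons on the same vertex set count separately), and a $k$-hole is a $k$-gon (convex or non-convex) whose interior contains no point of $S$. The constant in the $O$-notation may depend on $k$ but not on $n$. *)

theory Defs
  imports "HOL-Analysis.Analysis"
begin

text \<open>
  The plane is taken to be \<^typ>\<open>complex\<close>, the type for which the library proves the
  Jordan curve theorem.
\<close>

definition general_position :: "complex set \<Rightarrow> bool" where
  "general_position S \<longleftrightarrow> (\<forall>A. A \<subseteq> S \<and> card A = 3 \<longrightarrow> \<not> collinear A)"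

fun polyline :: "complex list \<Rightarrow> real \<Rightarrow> complex" where
  "polyline [] = linepath 0 0"
| "polyline [a] = linepath a a"
| "polyline [a, b] = linepath a b"
| "polyline (a # b # c # xs) = linepath a b +++ polyline (b # c # xs)"

definition closed_polyline :: "complex list \<Rightarrow> real \<Rightarrow> complex" where
  "closed_polyline vs = polyline (vs @ [hd vs])"

text \<open>
  A polygon is represented by its boundary curve as a set of points, so that listings of the
  vertices which differ only by a rotation or a reversal give the same polygon. If \<open>S\<close> is in
  general position, all vertices are proper corners of the boundary; hence different polygons,
  also those on the same vertex set, have different boundaries and are counted separately.
\<close>

definition k_gons :: "nat \<Rightarrow> complex set \<Rightarrow> complex set set" where
  "k_gons k S = {path_image (closed_polyline vs) | vs.
     distinct vs \<and> length vs = k \<and> set vs \<subseteq> S \<and> simple_path (closed_polyline vs)}"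

text \<open>
  For a simple closed curve, the constant \<^const>\<open>inside\<close> gives the bounded component of the
  complement of the curve, so the vertices and the other boundary points are not in it.
\<close>

definition k_holes :: "nat \<Rightarrow> complex set \<Rightarrow> complex set set" where
  "k_holes k S = {P \<in> k_gons k S. inside P \<inter> S = {}}"

lemma finite_k_gons:
  assumes "finite S"
  shows "finite (k_gons k S)"
proof (rule finite_subset)
  show "k_gons k S \<subseteq> (path_image \<circ> closed_polyline) ` {vs. set vs \<subseteq> S \<and> length vs = k}"
    by (auto simp: k_gons_def)
  show "finite ((path_image \<circ> closed_polyline) ` {vs. set vs \<subseteq> S \<and> length vs = k})"
    by (intro finite_imageI finite_lists_length_eq assms)
qed

lemma finite_k_holes: "finite S \<Longrightarrow> finite (k_holes k S)"
  by (simp add: k_holes_def finite_k_gons)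

end

theory Submission
  imports Defs
begin

text \<open>
  Let \<open>n = m\<^sup>2\<close>. The point set consists of \<open>m\<close> unit-spaced columns, each of which carries
  \<open>m\<close> equally spaced points and is shifted vertically by its own random amount. A column that
  crosses a triangle in a segment of relative length \<open>g\<close> misses it with probability about
  \<open>1 - g\<close>, independently of the other columns. So a triangle of area \<open>A\<close> (in units of the area
  per point) is empty with probability \<open>exp (- c A)\<close> at most, up to a constant factor. Summing
  \<open>exp (c' A)\<close> over the empty triangles has expectation \<open>O(n\<^sup>2)\<close>. A choice of shifts that meets
  this bound has \<open>O(n\<^sup>2)\<close> empty triangles, all of area \<open>O(log n)\<close>; hence every edge lies in only
  \<open>O(m log n)\<close> of them, because each column meets a strip of bounded area in \<open>O(log n)\<close> points.
  A perturbation gives general position without creating new empty triangles.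

  A \<open>k\<close>-hole is a simple polygon and has a triangulation into \<open>k - 2\<close> empty triangles. Choosing
  one of them in \<open>O(n\<^sup>2)\<close> ways and attaching the other \<open>k - 3\<close> one after the other along edges,
  each in \<open>O(m log n)\<close> ways, gives the bound. That a polygon has a diagonal is proved at a vertex
  \<open>v\<close> of maximal norm: among the vertices in the triangle of \<open>v\<close> and its two neighbours, the one
  nearest to \<open>v\<close> in the direction transversal to the third side is visible from \<open>v\<close>.
\<close>

section \<open>Closed polygonal lines\<close>

text \<open>The exponent depends on counting the first triangle as a whole. A start from an edge
  would cost \<open>m^4\<close> pairs and one more factor \<open>m * log n\<close> for its apex. The
  empty triangles themselves number only \<open>O(m^4)\<close>, and
  \<open>m^4 * m^(k - 3) = m^(k + 1)\<close>, with \<open>k - 3\<close> logarithms. Probabilities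
  are handled as cardinalities: each shift takes \<open>m\<close> integer values, so there are
  \<open>m^m\<close> choices and an expectation is a sum over them. Discreteness has a price, since
  an interval of length \<open>g\<close> is only sure to meet about \<open>g - 1\<close> residues.
  Over at most \<open>m\<close> columns, each losing \<open>1 / m\<close> in the exponent, this is a
  constant factor. Triangles within two adjacent columns have no column strictly between their
  vertices, so the random shifts do not act on them and their area is not controlled. They are
  counted outright: there are \<open>O(m^4)\<close> of them in all, and \<open>O(m)\<close> on each
  edge.\<close>

lemma polyline_Cons2:
  "path_image (polyline (a # b # xs)) = closed_segment a b \<union> path_image (polyline (b # xs))"
proof (cases xs)
  case (Cons c ys)
  have "pathstart (polyline (b # c # ys)) = b" by (cases ys) auto
  then show ?thesis using Cons by (simp add: path_image_join)
qed (auto simp: insert_absorb)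

lemma pathstart_polyline [simp]: "pathstart (polyline (a # xs)) = a"
  by (cases xs rule: list.exhaust; cases "tl xs") auto

lemma pathfinish_polyline [simp]: "xs \<noteq> [] \<Longrightarrow> pathfinish (polyline xs) = last xs"
  by (induction xs rule: polyline.induct) auto

lemma path_image_polyline_append:
  "path_image (polyline (xs @ p # ys)) =
     path_image (polyline (xs @ [p])) \<union> path_image (polyline (p # ys))"
proof (induction xs)
  case Nil
  have "p \<in> path_image (polyline (p # ys))"
    using pathstart_in_path_image[of "polyline (p # ys)"] by simp
  then show ?case by auto
next
  case (Cons a xs)
  show ?case
  proof (cases xs)
    case Nil
    have "p \<in> path_image (polyline (p # ys))"
      using pathstart_in_path_image[of "polyline (p # ys)"] by simp
    then show ?thesis using Nil by (auto simp: polyline_Cons2)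
  next
    case (Cons b zs)
    show ?thesis using Cons.IH unfolding Cons by (simp add: polyline_Cons2 Un_assoc)
  qed
qed

lemma set_subset_path_image_polyline: "set xs \<subseteq> path_image (polyline xs)"
proof
  fix p assume "p \<in> set xs"
  then obtain ys zs where "xs = ys @ p # zs" by (metis split_list)
  moreover have "p \<in> path_image (polyline (p # zs))"
    using pathstart_in_path_image[of "polyline (p # zs)"] by simp
  ultimately show "p \<in> path_image (polyline xs)"
    using path_image_polyline_append[of ys p zs] by simp
qed

lemma arc_linepath_iff: "arc (linepath a b) \<longleftrightarrow> a \<noteq> b"
  by (metis arc_linepath arc_distinct_ends pathfinish_linepath pathstart_linepath)

text \<open>For a one-element list \<open>polyline\<close> is a constant path and hence no arc. The
  guard \<open>tl xs \<noteq> []\<close> exempts this case, in which the whole line is a single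
  edge.\<close>

lemma arc_polyline_Cons:
  assumes "xs \<noteq> []"
  shows "arc (polyline (a # xs)) \<longleftrightarrow> a \<noteq> hd xs \<and> (tl xs \<noteq> [] \<longrightarrow> arc (polyline xs)) \<and>
     closed_segment a (hd xs) \<inter> path_image (polyline xs) \<subseteq> {hd xs}"
proof -
  obtain b ys where xs: "xs = b # ys" using assms by (cases xs) auto
  note * = arc_linepath_iff[of a b]
  show ?thesis
  proof (cases ys)
    case Nil then show ?thesis using xs * by auto
  next
    case (Cons c zs)
    then have "polyline (a # xs) = linepath a b +++ polyline xs" using xs by simp
    then show ?thesis using xs Cons * by (auto simp: arc_join_eq)
  qed
qed

text \<open>The set-theoretic core of the induction in \<open>arc_polyline_append\<close>:
  \<open>K\<close> is the first edge, ending at \<open>b\<close>, \<open>U\<close> the rest of the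
  first piece up to the cut \<open>p\<close>, and \<open>V\<close> the second piece. Read from the
  left, a point of \<open>K \<inter> V\<close> is \<open>b\<close>, hence lies in
  \<open>U \<inter> V\<close> and is \<open>p\<close>.\<close>

lemma arc_glue_sets:
  assumes "b \<in> K" "b \<in> U" "p \<in> U"
  shows "U \<inter> V \<subseteq> {p} \<and> K \<inter> (U \<union> V) \<subseteq> {b} \<longleftrightarrow>
         K \<inter> U \<subseteq> {b} \<and> (K \<union> U) \<inter> V \<subseteq> {p}"
  unfolding subset_iff Int_iff Un_iff singleton_iff
  apply (intro iffI conjI allI impI)
  using assms by metis+

text \<open>The analogue for a closed line: \<open>V\<close> returns to the start \<open>a\<close>
  of \<open>K\<close>, so \<open>a\<close> is a second permitted meeting point.\<close>

lemma loop_glue_sets: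
  assumes "a \<in> K" "b \<in> K" "b \<in> U" "p \<in> U" "a \<in> V" "p \<noteq> a" "a \<noteq> b"
  shows "U \<inter> V \<subseteq> {p} \<and> K \<inter> (U \<union> V) \<subseteq> {a, b} \<longleftrightarrow>
         K \<inter> U \<subseteq> {b} \<and> (K \<union> U) \<inter> V \<subseteq> {a, p}"
  unfolding subset_iff Int_iff Un_iff insert_iff empty_iff simp_thms
  apply (intro iffI conjI allI impI)
  using assms by metis+
lemma arc_polyline_append:
  assumes "xs \<noteq> []" "ys \<noteq> []"
  shows "arc (polyline (xs @ p # ys)) \<longleftrightarrow> arc (polyline (xs @ [p])) \<and> arc (polyline (p # ys)) \<and>
    path_image (polyline (xs @ [p])) \<inter> path_image (polyline (p # ys)) \<subseteq> {p}"
  using assms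
proof (induction xs)
  case (Cons a xs)
  show ?case
  proof (cases xs)
    case Nil
    then show ?thesis
      using arc_polyline_Cons[of "p # ys" a] Cons.prems by (simp add: arc_linepath_iff)
  next
    case (Cons b zs)
    have IH: "arc (polyline (xs @ p # ys)) \<longleftrightarrow> arc (polyline (xs @ [p])) \<and> arc (polyline (p # ys)) \<and>
      path_image (polyline (xs @ [p])) \<inter> path_image (polyline (p # ys)) \<subseteq> {p}"
      by (rule Cons.IH) (simp_all add: Cons Cons.prems)
    have b: "b \<in> path_image (polyline (xs @ [p]))"
      using set_subset_path_image_polyline[of "xs @ [p]"] Cons by auto
    have A: "path_image (polyline (a # xs @ [p])) = closed_segment a b \<union> path_image (polyline (xs @ [p]))"
      using Cons polyline_Cons2 by simp
    have B: "path_image (polyline (xs @ p # ys)) =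
       path_image (polyline (xs @ [p])) \<union> path_image (polyline (p # ys))"
      by (rule path_image_polyline_append)
    have p: "p \<in> path_image (polyline (xs @ [p]))"
      using set_subset_path_image_polyline[of "xs @ [p]"] by auto
    have 1: "arc (polyline ((a # xs) @ p # ys)) \<longleftrightarrow> a \<noteq> b \<and> arc (polyline (xs @ p # ys)) \<and>
       closed_segment a b \<inter> path_image (polyline (xs @ p # ys)) \<subseteq> {b}"
      using arc_polyline_Cons[of "xs @ p # ys" a] unfolding Cons using Cons.prems by simp
    have 2: "arc (polyline ((a # xs) @ [p])) \<longleftrightarrow> a \<noteq> b \<and> arc (polyline (xs @ [p])) \<and>
       closed_segment a b \<inter> path_image (polyline (xs @ [p])) \<subseteq> {b}"
      using arc_polyline_Cons[of "xs @ [p]" a] unfolding Cons by simp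
    have A': "path_image (polyline ((a # xs) @ [p])) = closed_segment a b \<union> path_image (polyline (xs @ [p]))"
      using A by simp
    show ?thesis
      unfolding 1 2 A' unfolding IH B
      using arc_glue_sets[OF ends_in_segment(2)[of b a] b p, where V = "path_image (polyline (p # ys))"]
      by argo
  qed
qed simp

text \<open>The joining rule for loops detaches only the first edge;
  \<open>arc_polyline_append\<close> then moves the cut to an arbitrary vertex
  \<open>p\<close>.\<close>

lemma simple_path_polyline_loop:
  assumes "xs \<noteq> []" "ys \<noteq> []" "hd xs = last ys"
  shows "simple_path (polyline (xs @ p # ys)) \<longleftrightarrow>
    arc (polyline (xs @ [p])) \<and> arc (polyline (p # ys)) \<and>
    path_image (polyline (xs @ [p])) \<inter> path_image (polyline (p # ys)) \<subseteq> {hd xs, p}"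
proof -
  obtain a zs where xs: "xs = a # zs" using assms by (cases xs) auto
  define b where "b = hd (zs @ [p])"
  obtain r where r: "zs @ [p] = b # r" unfolding b_def by (cases zs) auto
  have r': "zs @ p # ys = b # r @ ys" using r by (metis append.assoc append_Cons append_Nil)
  have rys: "r @ ys \<noteq> []" using assms by simp
  have eq: "polyline (xs @ p # ys) = linepath a b +++ polyline (zs @ p # ys)"
    using xs r' rys by (cases "r @ ys") auto
  note * = arc_linepath_iff[of a b]
  have ps: "pathstart (polyline (zs @ p # ys)) = b" by (simp add: r')
  have pf: "pathfinish (polyline (zs @ p # ys)) = a" using assms xs by simp
  have 1: "simple_path (polyline (xs @ p # ys)) \<longleftrightarrow> a \<noteq> b \<and> arc (polyline (zs @ p # ys)) \<and>
      closed_segment a b \<inter> path_image (polyline (zs @ p # ys)) \<subseteq> {a, b}"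
    unfolding eq using simple_path_join_loop_eq[of "polyline (zs @ p # ys)" "linepath a b"] ps pf *
    by simp
  show ?thesis
  proof (cases zs)
    case Nil
    then show ?thesis unfolding 1 using xs * by (auto simp: b_def)
  next
    case (Cons c qs)
    then have bc: "b = c" "zs \<noteq> []" by (auto simp: b_def)
    have 2: "arc (polyline (xs @ [p])) \<longleftrightarrow> a \<noteq> b \<and> arc (polyline (zs @ [p])) \<and>
       closed_segment a b \<inter> path_image (polyline (zs @ [p])) \<subseteq> {b}"
      using arc_polyline_Cons[of "zs @ [p]" a] unfolding xs Cons bc by simp
    have A: "path_image (polyline (xs @ [p])) = closed_segment a b \<union> path_image (polyline (zs @ [p]))"
      using Cons bc xs polyline_Cons2 by simp
    have B: "path_image (polyline (zs @ p # ys)) =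
       path_image (polyline (zs @ [p])) \<union> path_image (polyline (p # ys))"
      by (rule path_image_polyline_append)
    have b: "b \<in> path_image (polyline (zs @ [p]))" "p \<in> path_image (polyline (zs @ [p]))"
      using set_subset_path_image_polyline[of "zs @ [p]"] Cons bc by auto
    have a: "a \<in> path_image (polyline (p # ys))"
      using set_subset_path_image_polyline[of "p # ys"] assms xs by auto
    have a2: "a \<in> closed_segment a b" by simp
    have hd: "hd xs = a" using xs by simp
    have ap: "arc (polyline (p # ys)) \<Longrightarrow> p \<noteq> a"
      using arc_distinct_ends[of "polyline (p # ys)"] assms(2,3) hd by auto
    show ?thesis
      unfolding 1 2 A B hd arc_polyline_append[OF bc(2) assms(2), of p]
      using loop_glue_sets[OF ends_in_segment b a] ap by argo
  qed
qed

text \<open>The condition is symmetric in \<open>xs\<close> and \<open>ys\<close>, which gives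
  invariance under rotation of the list. It also exhibits the two boundary arcs into which a
  diagonal from \<open>hd xs\<close> to \<open>hd ys\<close> divides the polygon.\<close>

lemma simple_closed_polyline:
  assumes "xs \<noteq> []" "ys \<noteq> []"
  shows "simple_path (closed_polyline (xs @ ys)) \<longleftrightarrow>
    arc (polyline (xs @ [hd ys])) \<and> arc (polyline (ys @ [hd xs])) \<and>
    path_image (polyline (xs @ [hd ys])) \<inter> path_image (polyline (ys @ [hd xs])) \<subseteq> {hd xs, hd ys}"
proof -
  obtain p zs where "ys = p # zs" using assms by (cases ys) auto
  then show ?thesis
    using simple_path_polyline_loop[of xs "zs @ [hd xs]" p] assms
    by (simp add: closed_polyline_def)
qed

lemma path_image_closed_polyline:
  assumes "xs \<noteq> []" "ys \<noteq> []"
  shows "path_image (closed_polyline (xs @ ys)) =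
    path_image (polyline (xs @ [hd ys])) \<union> path_image (polyline (ys @ [hd xs]))"
proof -
  obtain p zs where "ys = p # zs" using assms by (cases ys) auto
  then show ?thesis
    using path_image_polyline_append[of xs p "zs @ [hd xs]"] assms
    by (simp add: closed_polyline_def)
qed

lemma closed_polyline_rotate:
  "path_image (closed_polyline (ys @ xs)) = path_image (closed_polyline (xs @ ys))"
  "simple_path (closed_polyline (ys @ xs)) \<longleftrightarrow> simple_path (closed_polyline (xs @ ys))"
proof -
  show "path_image (closed_polyline (ys @ xs)) = path_image (closed_polyline (xs @ ys))"
    by (cases "xs = []"; cases "ys = []") (auto simp: path_image_closed_polyline)
  show "simple_path (closed_polyline (ys @ xs)) \<longleftrightarrow> simple_path (closed_polyline (xs @ ys))"
    by (cases "xs = []"; cases "ys = []") (auto simp: simple_closed_polyline)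
qed

lemma closed_polyline_closed:
  assumes "vs \<noteq> []"
  shows "pathfinish (closed_polyline vs) = pathstart (closed_polyline vs)"
  using assms by (cases vs) (auto simp: closed_polyline_def)

section \<open>Diagonals and triangulations\<close>

text \<open>Twice the signed area of the triangle; the sign is its orientation.\<close>

definition cross :: "complex \<Rightarrow> complex \<Rightarrow> complex \<Rightarrow> real" where
  "cross a b c = (Re b - Re a) * (Im c - Im a) - (Im b - Im a) * (Re c - Re a)"

lemma collinear_iff_cross: "collinear {a, b, c} \<longleftrightarrow> cross a b c = 0"
proof -
  have *: "collinear {0, x, y} \<longleftrightarrow> Re x * Im y - Im x * Re y = 0" for x y :: complex
  proof (cases "x = 0")
    case False
    show ?thesis
    proof
      assume "collinear {0, x, y}"
      then obtain c where "y = c *\<^sub>R x" using False by (auto simp: collinear_lemma)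
      then show "Re x * Im y - Im x * Re y = 0" by simp
    next
      assume *: "Re x * Im y - Im x * Re y = 0"
      have n: "(Re x)\<^sup>2 + (Im x)\<^sup>2 \<noteq> 0" using False by (simp add: complex_eq_iff sum_power2_eq_zero_iff)
      define c where "c = (Re x * Re y + Im x * Im y) / ((Re x)\<^sup>2 + (Im x)\<^sup>2)"
      have "c * Re x = Re y" unfolding c_def using n * by (simp add: field_simps power2_eq_square)
      moreover have "c * Im x = Im y" unfolding c_def using n * by (simp add: field_simps power2_eq_square)
      ultimately have "y = c *\<^sub>R x" by (simp add: complex_eq_iff)
      then show "collinear {0, x, y}" by (auto simp: collinear_lemma)
    qed
  qed auto
  have "collinear {a, b, c} \<longleftrightarrow> collinear {b, a, c}" by (simp add: insert_commute)
  also have "\<dots> \<longleftrightarrow> collinear {0, b - a, c - a}" using collinear_3[of b a c] by (simp add: NO_MATCH_def)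
  finally show ?thesis using * by (simp add: cross_def)
qed

lemma polyline_edge:
  assumes "z \<in> path_image (polyline vs)" "length vs \<ge> 2"
  obtains xs p q ys where "vs = xs @ p # q # ys" "z \<in> closed_segment p q"
    "closed_segment p q \<subseteq> path_image (polyline vs)"
proof -
  have "\<exists>xs p q ys. vs = xs @ p # q # ys \<and> z \<in> closed_segment p q \<and>
      closed_segment p q \<subseteq> path_image (polyline vs)"
    using assms
  proof (induction vs)
    case (Cons a vs)
    then obtain b ys where vs: "vs = b # ys" by (cases vs) auto
    have eq: "path_image (polyline (a # vs)) = closed_segment a b \<union> path_image (polyline vs)"
      by (simp add: vs polyline_Cons2)
    show ?case
    proof (cases "z \<in> closed_segment a b")
      case True
      then show ?thesis using eq vs by (metis append_Nil sup_ge1)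
    next
      case False
      then have z: "z \<in> path_image (polyline vs)" using Cons.prems eq by blast
      have "ys \<noteq> []" using False z vs by auto
      then have "length vs \<ge> 2" using vs by (cases ys) auto
      from Cons.IH[OF z this] show ?thesis using eq by (metis append_Cons le_supI2)
    qed
  qed simp
  then show ?thesis using that by blast
qed

text \<open>Meant for the chain that leads from \<open>w\<close> round to \<open>u\<close>: no edge
  of it joins its two ends. With general position this later keeps the chain off the open side
  \<open>u w\<close>.\<close>

lemma hd_last_not_consecutive:
  assumes "distinct (w # zs @ [u])" "zs \<noteq> []" "w # zs @ [u] = xs @ p # q # ys"
  shows "{p, q} \<noteq> {u, w}"
proof
  assume "{p, q} = {u, w}"
  then consider "p = w" "q = u" | "p = u" "q = w" by (auto simp: doubleton_eq_iff)
  then show False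
  proof cases
    case 1
    then have "xs = []" using assms(1,3) by (cases xs) auto
    then have "zs @ [u] = u # ys" using assms(3) 1 by simp
    then show False using assms(1,2) by (cases zs) auto
  next
    case 2
    then show False using assms(1,3) by (cases xs) auto
  qed
qed

section \<open>The inside of a polygon near an extreme vertex\<close>

lemma connected_subset_inside:
  assumes "connected C" "C \<inter> P = {}" "C \<inter> inside P \<noteq> {}"
  shows "C \<subseteq> inside P"
proof
  fix y assume "y \<in> C"
  obtain x where "x \<in> C" "x \<in> inside P" using assms by blast
  then have "connected_component (- P) x y"
    unfolding connected_component_def using assms(1,2) \<open>y \<in> C\<close> by blast
  then show "y \<in> inside P" using \<open>x \<in> inside P\<close> inside_same_component by metis
qed

lemma connected_subset_outside:
  assumes "connected C" "C \<inter> P = {}" "C \<inter> outside P \<noteq> {}"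
  shows "C \<subseteq> outside P"
proof
  fix y assume "y \<in> C"
  obtain x where "x \<in> C" "x \<in> outside P" using assms by blast
  then have "connected_component (- P) x y"
    unfolding connected_component_def using assms(1,2) \<open>y \<in> C\<close> by blast
  then show "y \<in> outside P" using \<open>x \<in> outside P\<close> outside_same_component by metis
qed

text \<open>Affine coordinates with origin \<open>v\<close>, in which \<open>u\<close> and \<open>w\<close> are the unit vectors.\<close>
locale corner =
  fixes v u w :: complex
  assumes nondeg: "cross v u w \<noteq> 0"
begin

definition s where "s z = cross v z w / cross v u w"
definition t where "t z = cross v u z / cross v u w"

lemma decomp: "z = v + s z *\<^sub>R (u - v) + t z *\<^sub>R (w - v)"
proof -
  have "cross v u w *\<^sub>R z = cross v u w *\<^sub>R v + cross v z w *\<^sub>R (u - v) + cross v u z *\<^sub>R (w - v)"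
    by (simp add: complex_eq_iff cross_def algebra_simps)
  then have "z = (1 / cross v u w) *\<^sub>R
      (cross v u w *\<^sub>R v + cross v z w *\<^sub>R (u - v) + cross v u z *\<^sub>R (w - v))"
    using nondeg by (metis divide_self inverse_eq_divide scaleR_scaleR scaleR_one mult.commute divide_inverse)
  then show ?thesis using nondeg by (simp add: s_def t_def scaleR_add_right)
qed

lemma decomp_diff: "z - v = s z *\<^sub>R (u - v) + t z *\<^sub>R (w - v)"
  using decomp[of z] by (metis add.assoc add_diff_cancel_left')

lemma coords [simp]: "s v = 0" "t v = 0" "s u = 1" "t u = 0" "s w = 0" "t w = 1"
  using nondeg by (auto simp: s_def t_def cross_def)

lemma s_affine: "s ((1 - a) *\<^sub>R p + a *\<^sub>R q) = (1 - a) * s p + a * s q"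
  and t_affine: "t ((1 - a) *\<^sub>R p + a *\<^sub>R q) = (1 - a) * t p + a * t q"
proof -
  have "cross v ((1 - a) *\<^sub>R p + a *\<^sub>R q) w = (1 - a) * cross v p w + a * cross v q w"
    "cross v u ((1 - a) *\<^sub>R p + a *\<^sub>R q) = (1 - a) * cross v u p + a * cross v u q"
    by (simp_all add: cross_def algebra_simps)
  then show "s ((1 - a) *\<^sub>R p + a *\<^sub>R q) = (1 - a) * s p + a * s q"
    "t ((1 - a) *\<^sub>R p + a *\<^sub>R q) = (1 - a) * t p + a * t q"
    by (simp_all add: s_def t_def add_divide_distrib)
qed

lemma st_at: "s (v + a *\<^sub>R (u - v) + b *\<^sub>R (w - v)) = a" "t (v + a *\<^sub>R (u - v) + b *\<^sub>R (w - v)) = b"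
proof -
  have "cross v (v + a *\<^sub>R (u - v) + b *\<^sub>R (w - v)) w = a * cross v u w"
    "cross v u (v + a *\<^sub>R (u - v) + b *\<^sub>R (w - v)) = b * cross v u w"
    by (simp_all add: cross_def algebra_simps)
  then show "s (v + a *\<^sub>R (u - v) + b *\<^sub>R (w - v)) = a" "t (v + a *\<^sub>R (u - v) + b *\<^sub>R (w - v)) = b"
    using nondeg by (auto simp: s_def t_def)
qed

lemma st_segment:
  assumes "x \<in> closed_segment p q"
  obtains a where "0 \<le> a" "a \<le> 1" "x = (1 - a) *\<^sub>R p + a *\<^sub>R q"
    "s x = (1 - a) * s p + a * s q" "t x = (1 - a) * t p + a * t q"
  using assms s_affine t_affine unfolding closed_segment_def by blast

lemma cont: "continuous_on A s" "continuous_on A t"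
proof -
  have "continuous_on A (\<lambda>z. cross v z w)" "continuous_on A (\<lambda>z. cross v u z)"
    unfolding cross_def by (intro continuous_intros)+
  then show "continuous_on A s" "continuous_on A t"
    unfolding s_def t_def using nondeg by (auto intro!: continuous_intros)
qed

lemma convex_halfplanes:
  "convex {z. s z > c}" "convex {z. t z > c}" "convex {z. s z < c}" "convex {z. t z < c}"
  "convex {z. s z + t z < c}" "convex {z. s z + t z \<le> c}"
proof -
  have combine: "(1 - a) * x + a * y > c" if "0 \<le> a" "a \<le> 1" "x > c" "y > c" for a x y c :: real
    using that convex_bound_lt[of "-x" "-c" "-y" "1 - a" a] by simp
  have combine': "(1 - a) * x + a * y < c" if "0 \<le> a" "a \<le> 1" "x < c" "y < c" for a x y c :: real
    using that convex_bound_lt[of "x" "c" "y" "1 - a" a] by simp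
  have combine'': "(1 - a) * x + a * y \<le> c" if "0 \<le> a" "a \<le> 1" "x \<le> c" "y \<le> c" for a x y c :: real
    using that convex_bound_le[of "x" "c" "y" "1 - a" a] by simp
  have st: "s ((1 - a) *\<^sub>R p + a *\<^sub>R q) + t ((1 - a) *\<^sub>R p + a *\<^sub>R q) = (1 - a) * (s p + t p) + a * (s q + t q)" for a p q
    unfolding s_affine t_affine by (simp add: algebra_simps)
  show "convex {z. s z > c}" "convex {z. t z > c}" "convex {z. s z < c}" "convex {z. t z < c}"
    "convex {z. s z + t z < c}" "convex {z. s z + t z \<le> c}"
    unfolding convex_alt mem_Collect_eq st unfolding s_affine t_affine
    using combine combine' combine'' by blast+
qed

lemma on_side_w:
  assumes "s z = 0" "0 \<le> t z" "t z \<le> 1" shows "z \<in> closed_segment v w"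
proof -
  have "z = (1 - t z) *\<^sub>R v + t z *\<^sub>R w" using decomp[of z] assms(1) by (simp add: algebra_simps)
  then show ?thesis unfolding closed_segment_def using assms by blast
qed

lemma on_side_u:
  assumes "t z = 0" "0 \<le> s z" "s z \<le> 1" shows "z \<in> closed_segment u v"
proof -
  have "z = (1 - s z) *\<^sub>R v + s z *\<^sub>R u" using decomp[of z] assms(1) by (simp add: algebra_simps)
  then have "z \<in> closed_segment v u" unfolding closed_segment_def using assms by blast
  then show ?thesis by (simp add: closed_segment_commute)
qed

text \<open>Near \<open>v\<close> the curve consists of two edges only. The half-discs
  \<open>s < 0\<close> and \<open>t < 0\<close> avoid it and share a point beyond the supporting
  line at \<open>v\<close>, so both lie outside. By the Jordan curve theorem \<open>v\<close> is a
  limit of inside points; near \<open>v\<close> these can only be in the open wedge, which is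
  connected and misses the curve.\<close>

lemma wedge_inside:
  assumes c: "simple_path c" "pathfinish c = pathstart c"
    and P: "path_image c = closed_segment v w \<union> closed_segment u v \<union> R"
    and R: "closed R" "v \<notin> R"
    and ext: "\<And>z. z \<in> path_image c \<Longrightarrow> inner v z \<le> inner v v" "inner v u < inner v v" "inner v w < inner v v"
  obtains r where "r > 0" "{z \<in> ball v r. s z > 0 \<and> t z > 0} \<subseteq> inside (path_image c)"
proof -
  define P where "P = path_image c"
  have uv: "u \<noteq> v" "w \<noteq> v" using ext by auto
  obtain r0 where r0: "r0 > 0" "ball v r0 \<inter> R = {}"
    using R openE[of "- R" v] by (auto simp: open_Compl disjoint_eq_subset_Compl)
  \<comment> \<open>The distances to \<open>u\<close> and \<open>w\<close> enter so that a point of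
    the ball on one of the two rays lies on the edge itself, hence on the curve.\<close>
  define r where "r = min r0 (min (dist v u) (dist v w))"
  have r: "r > 0" "ball v r \<inter> R = {}" "r \<le> dist v u" "r \<le> dist v w"
    using r0 uv by (auto simp: r_def)
  have seg: "s z = 0 \<and> 0 \<le> t z" if "z \<in> closed_segment v w" for z
    using that by (elim st_segment) auto
  have seg': "t z = 0 \<and> 0 \<le> s z" if "z \<in> closed_segment u v" for z
    using that by (elim st_segment) auto
  have out: "x \<in> outside P" if "inner v x > inner v v" for x
  proof -
    have "P \<subseteq> {x. inner v x \<le> inner v v}" using ext(1) unfolding P_def by blast
    from outside_subset_convex[OF convex_halfspace_le this] that show ?thesis by fastforce
  qed
  define N where "N = norm (u - v) + norm (w - v)"
  have N: "N > 0" using uv by (simp add: N_def add_pos_pos)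
  define d where "d = r / (2 * N)"
  have d: "d > 0" using r N by (simp add: d_def)
  \<comment> \<open>A step from \<open>v\<close> against both edge directions raises the inner
    product with \<open>v\<close>, so \<open>z0\<close> is beyond the supporting line; the size of
    \<open>d\<close> keeps it in the ball.\<close>
  define z0 where "z0 = v + (-d) *\<^sub>R (u - v) + (-d) *\<^sub>R (w - v)"
  have "norm (z0 - v) \<le> d * norm (u - v) + d * norm (w - v)"
    unfolding z0_def using d norm_triangle_ineq[of "(-d) *\<^sub>R (u - v)" "(-d) *\<^sub>R (w - v)"] by simp
  also have "\<dots> = d * N" by (simp add: N_def algebra_simps)
  also have "\<dots> < r" using N r by (simp add: d_def)
  finally have "norm (z0 - v) < r" .
  then have z0: "z0 \<in> ball v r" "s z0 < 0" "t z0 < 0"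
    using d st_at[of "-d" "-d"] unfolding z0_def[symmetric] by (auto simp: dist_norm norm_minus_commute)
  have "inner v z0 = inner v v + d * ((inner v v - inner v u) + (inner v v - inner v w))"
    unfolding z0_def inner_add_right inner_scaleR_right inner_diff_right by algebra
  also have "\<dots> > inner v v" using d ext by (simp add: add_pos_pos)
  finally have z0out: "z0 \<in> outside P" by (rule out)
  have Hs: "ball v r \<inter> {z. s z < 0} \<subseteq> outside P"
  proof (rule connected_subset_outside)
    show "connected (ball v r \<inter> {z. s z < 0})"
      by (intro convex_connected convex_Int convex_ball convex_halfplanes)
    show "ball v r \<inter> {z. s z < 0} \<inter> P = {}"
      using seg seg' r(2) unfolding P_def P by force
  qed (use z0 z0out in blast)
  have Ht: "ball v r \<inter> {z. t z < 0} \<subseteq> outside P"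
  proof (rule connected_subset_outside)
    show "connected (ball v r \<inter> {z. t z < 0})"
      by (intro convex_connected convex_Int convex_ball convex_halfplanes)
    show "ball v r \<inter> {z. t z < 0} \<inter> P = {}"
      using seg seg' r(2) unfolding P_def P by force
  qed (use z0 z0out in blast)
  have nonneg: "s z \<ge> 0 \<and> t z \<ge> 0" if "z \<in> ball v r" "z \<in> inside P" for z
  proof -
    have "z \<notin> outside P" using that(2) inside_Int_outside[of P] by blast
    then have "z \<notin> ball v r \<inter> {z. s z < 0}" "z \<notin> ball v r \<inter> {z. t z < 0}" using Hs Ht by blast+
    then show ?thesis using that(1) by simp
  qed
  have "v \<in> frontier (inside P)"
    using Jordan_inside_outside[OF c] P by (auto simp: P_def)
  then have "v \<in> closure (inside P)" by (simp add: frontier_def)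
  then obtain z where z: "z \<in> inside P" "z \<in> ball v r"
    using r(1) by (auto simp: closure_approachable dist_commute)
  have zP: "z \<notin> P" using z inside_no_overlap by blast
  have "s z \<noteq> 0"
  proof
    assume "s z = 0"
    then have eq: "z - v = t z *\<^sub>R (w - v)" using decomp_diff[of z] by simp
    have "norm (z - v) < norm (w - v)"
      using z(2) r(4) by (simp add: dist_norm norm_minus_commute)
    then have "t z \<le> 1" unfolding eq using nonneg[OF z(2,1)] uv by (auto simp: mult_less_cancel_right1)
    then show False using on_side_w \<open>s z = 0\<close> nonneg[OF z(2,1)] zP by (auto simp: P_def P)
  qed
  moreover have "t z \<noteq> 0"
  proof
    assume "t z = 0"
    then have eq: "z - v = s z *\<^sub>R (u - v)" using decomp_diff[of z] by simp
    have "norm (z - v) < norm (u - v)"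
      using z(2) r(3) by (simp add: dist_norm norm_minus_commute)
    then have "s z \<le> 1" unfolding eq using nonneg[OF z(2,1)] uv by (auto simp: mult_less_cancel_right1)
    then show False using on_side_u \<open>t z = 0\<close> nonneg[OF z(2,1)] zP by (auto simp: P_def P)
  qed
  ultimately have zpos: "s z > 0" "t z > 0" using nonneg[OF z(2,1)] by auto
  have "ball v r \<inter> ({z. s z > 0} \<inter> {z. t z > 0}) \<subseteq> inside P"
  proof (rule connected_subset_inside)
    show "connected (ball v r \<inter> ({z. s z > 0} \<inter> {z. t z > 0}))"
      by (intro convex_connected convex_Int convex_ball convex_halfplanes)
    show "ball v r \<inter> ({z. s z > 0} \<inter> {z. t z > 0}) \<inter> P = {}"
      using seg seg' r(2) unfolding P_def P by force
  qed (use z zpos in blast)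
  then have "{z \<in> ball v r. s z > 0 \<and> t z > 0} \<subseteq> inside P" by blast
  then show ?thesis using that[OF r(1)] unfolding P_def by blast
qed

end

text \<open>The list is read as a polygon with the distinguished edge from its last to its first vertex;
  the triangle on that edge is \<open>a c b\<close>.\<close>
inductive triangulated :: "('a \<Rightarrow> 'a \<Rightarrow> 'a \<Rightarrow> bool) \<Rightarrow> 'a list \<Rightarrow> bool" for E where
  edge: "triangulated E [a, b]"
| triangle: "\<lbrakk>triangulated E (a # xs @ [c]); triangulated E (c # ys @ [b]); E a c b\<rbrakk>
    \<Longrightarrow> triangulated E (a # xs @ c # ys @ [b])"

text \<open>This reassembles a polygon that was cut along the diagonal \<open>p q\<close>. Being
  consecutive, \<open>p\<close> and \<open>q\<close> belong to the same part beside the root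
  triangle, its apex \<open>c\<close> included. So the edge is followed down the recursion until the
  list is \<open>[p, q]\<close>, where the second triangulation takes its place.\<close>

lemma triangulated_glue:
  assumes "triangulated E (xs @ p # q # ys)" "triangulated E (p # zs @ [q])"
  shows "triangulated E (xs @ p # zs @ q # ys)"
proof -
  have "triangulated E (xs @ p # zs @ q # ys)" if "triangulated E vs" "vs = xs @ p # q # ys" for vs xs ys
    using that
  proof (induction arbitrary: xs ys)
    case (edge a b)
    then have "xs = []" "ys = []" "p = a" "q = b" by (auto simp: Cons_eq_append_conv)
    then show ?case using assms(2) by simp
  next
    case (triangle a us c ws b)
    have "(a # us @ [c]) @ ws @ [b] = xs @ p # q # ys" using triangle.prems by simp
    then consider l where "a # us @ [c] = xs @ l" "l @ ws @ [b] = p # q # ys"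
      | l where "(a # us @ [c]) @ l = xs" "ws @ [b] = l @ p # q # ys"
      unfolding append_eq_append_conv2 by blast
    then show ?case
    proof cases
      case 1
      \<comment> \<open>In the first case \<open>xs\<close> ends at \<open>c\<close>, in the second
        \<open>p\<close> is \<open>c\<close>; both put the edge \<open>p q\<close> into the right
        part. In the third case it lies in the left part.\<close>
      consider "l = []" | "l = [p]" | l' where "l = p # q # l'"
        using 1(2) by (cases l; cases "tl l") auto
      then show ?thesis
      proof cases
        case 1
        then have xs: "xs = a # us @ [c]" using \<open>a # us @ [c] = xs @ l\<close> by simp
        then have "c # ws @ [b] = [c] @ p # q # ys" using \<open>l @ ws @ [b] = p # q # ys\<close> 1 by simp
        from triangle.IH(2)[OF this] have *: "triangulated E ([c] @ p # zs @ q # ys)" .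
        obtain ys' where "p # zs @ q # ys = ys' @ [b]"
        proof -
          have "last (p # q # ys) = b" using \<open>l @ ws @ [b] = p # q # ys\<close> 1 by (metis append_Nil last_snoc)
          then have "last (p # zs @ q # ys) = b" by (auto split: if_splits)
          then show ?thesis using that by (metis append_butlast_last_id list.distinct(1))
        qed
        then show ?thesis
          using triangulated.triangle[OF triangle.hyps(1) _ triangle.hyps(3), of ys'] * xs by simp
      next
        case 2
        then have "xs = a # us" "c = p" using \<open>a # us @ [c] = xs @ l\<close>
          by (metis append_Cons append_same_eq butlast_snoc, metis "2" \<open>a # us @ [c] = xs @ l\<close> append_Cons last_snoc)
        moreover have "c # ws @ [b] = [] @ p # q # ys"
          using \<open>c = p\<close> \<open>l @ ws @ [b] = p # q # ys\<close> 2 by simp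
        from triangle.IH(2)[OF this] have *: "triangulated E (p # zs @ q # ys)" by simp
        obtain ys' where ys': "zs @ q # ys = ys' @ [b]"
        proof -
          have "last (p # q # ys) = b" using \<open>l @ ws @ [b] = p # q # ys\<close> by (metis append.assoc last_snoc)
          then have "last (zs @ q # ys) = b" by (auto split: if_splits)
          then show ?thesis using that by (metis append_butlast_last_id append_is_Nil_conv list.distinct(1))
        qed
        ultimately show ?thesis
          using triangulated.triangle[OF triangle.hyps(1) _ triangle.hyps(3), of ys'] * by simp
      next
        case 3
        then have ys: "ys = l' @ ws @ [b]" using \<open>l @ ws @ [b] = p # q # ys\<close> by simp
        have "a # us @ [c] = xs @ p # q # l'" using 3 \<open>a # us @ [c] = xs @ l\<close> by simp
        from triangle.IH(1)[OF this] have *: "triangulated E (xs @ p # zs @ q # l')" .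
        have h: "hd (xs @ p # zs @ q # l') = a" using \<open>a # us @ [c] = xs @ p # q # l'\<close> by (cases xs) auto
        have la: "last (q # l') = c" using \<open>a # us @ [c] = xs @ p # q # l'\<close>
          by (metis append_Cons last_ConsR last_appendR last_snoc list.distinct(1))
        have "\<exists>us'. xs @ p # zs @ q # l' = a # us' @ [c]"
        proof (cases xs)
          case Nil
          then show ?thesis using h la
            by (metis append_Cons append_Nil append_butlast_last_id append_assoc list.sel(1) list.distinct(1))
        next
          case (Cons x xs')
          then show ?thesis using h la
            by (metis append_Cons append_butlast_last_id append_assoc list.sel(1) list.distinct(1))
        qed
        then obtain us' where us': "xs @ p # zs @ q # l' = a # us' @ [c]" by blast
        have "xs @ p # zs @ q # ys = (xs @ p # zs @ q # l') @ ws @ [b]" using ys by simp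
        then have "xs @ p # zs @ q # ys = a # us' @ c # ws @ [b]" unfolding us' by simp
        then show ?thesis
          using triangulated.triangle[OF _ triangle.hyps(2,3), of us'] * us' by simp
      qed
    next
      case 2
      then have "c # ws @ [b] = (c # l) @ p # q # ys" by simp
      from triangle.IH(2)[OF this] have *: "triangulated E (c # l @ p # zs @ q # ys)" by simp
      obtain ys' where ys': "l @ p # zs @ q # ys = ys' @ [b]"
      proof -
        have "last (p # q # ys) = b" using 2(2) by (metis last_appendR last_snoc list.distinct(1))
        then have "last (l @ p # zs @ q # ys) = b" by (auto split: if_splits)
        then show ?thesis using that by (metis append_butlast_last_id append_is_Nil_conv list.distinct(1))
      qed
      have "xs = a # us @ c # l" using 2 by simp
      then show ?thesis
        using triangulated.triangle[OF triangle.hyps(1) _ triangle.hyps(3), of ys'] * ys' by simp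
    qed
  qed
  then show ?thesis using assms(1) by blast
qed

section \<open>Existence of a diagonal\<close>

lemma both_positive_nearby:
  fixes a b a' b' :: real
  assumes "a > 0" "a' > 0"
  obtains e where "0 < e" "e \<le> 1" "(1 - e) * a + e * b > 0" "(1 - e) * a' + e * b' > 0"
proof -
  define m where "m = min a a'"
  define B where "B = \<bar>b\<bar> + \<bar>b'\<bar>"
  define e where "e = m / (m + B + 1)"
  have m: "m > 0" "m \<le> a" "m \<le> a'" using assms by (auto simp: m_def)
  have B: "B \<ge> 0" "b \<ge> -B" "b' \<ge> -B" by (auto simp: B_def)
  have e: "0 < e" "e \<le> 1" using m(1) B(1) by (auto simp: e_def)
  have "e * (m + B + 1) = m" using m(1) B(1) by (simp add: e_def)
  then have em: "e * m + e * B < m" using e by (simp add: algebra_simps)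
  have *: "(1 - e) * x + e * y > 0" if "m \<le> x" "y \<ge> -B" for x y
  proof -
    have "(1 - e) * m \<le> (1 - e) * x" "e * (-B) \<le> e * y"
      using that e mult_left_mono[of "-B" y e] by (auto intro!: mult_left_mono)
    then show ?thesis using em by (simp add: algebra_simps)
  qed
  show ?thesis using that[OF e *[OF m(2) B(2)] *[OF m(3) B(3)]] .
qed

lemma subsegments:
  assumes "z \<in> closed_segment p q" "closed_segment p q \<subseteq> R"
  shows "closed_segment z p \<subseteq> R" "closed_segment z q \<subseteq> R"
  using closed_segment_subset[OF assms(1) ends_in_segment(1) convex_closed_segment]
    closed_segment_subset[OF assms(1) ends_in_segment(2) convex_closed_segment] assms(2) by blast+

lemma (in corner) segment_sum:
  assumes "x \<in> closed_segment p q"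
  shows "min (s p + t p) (s q + t q) \<le> s x + t x"
proof -
  obtain a where a: "0 \<le> a" "a \<le> 1" "s x = (1 - a) * s p + a * s q" "t x = (1 - a) * t p + a * t q"
    using assms st_segment by metis
  define m where "m = min (s p + t p) (s q + t q)"
  have "(1 - a) * m \<le> (1 - a) * (s p + t p)" "a * m \<le> a * (s q + t q)"
    using a by (auto simp: m_def intro!: mult_left_mono)
  then have "m \<le> s x + t x" using a by (simp add: algebra_simps)
  then show ?thesis by (simp add: m_def)
qed

text \<open>The level \<open>s + t = 1\<close> is the line through \<open>u\<close> and
  \<open>w\<close>, so general position keeps all other vertices off this level.\<close>

lemma (in corner) cross_uw: "cross u w z = (1 - (s z + t z)) * cross v u w"
proof -
  have "(s z + t z) * cross v u w = cross v z w + cross v u z"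
    using nondeg by (simp add: s_def t_def field_simps)
  then show ?thesis by (simp add: cross_def algebra_simps)
qed

lemma (in corner) corner_diagonal:
  assumes c: "simple_path c" "pathfinish c = pathstart c"
    and P: "path_image c = closed_segment v w \<union> closed_segment u v \<union> path_image (polyline (w # zs @ [u]))"
    and dist: "distinct (v # w # zs @ [u])" and zs: "zs \<noteq> []"
    and disj: "path_image (polyline (w # zs @ [u])) \<inter> closed_segment v w \<subseteq> {w}"
      "path_image (polyline (w # zs @ [u])) \<inter> closed_segment u v \<subseteq> {u}"
    and gp: "\<And>z. z \<in> set zs \<Longrightarrow> cross u w z \<noteq> 0"
    and ext: "\<And>z. z \<in> path_image c \<Longrightarrow> inner v z \<le> inner v v" "inner v u < inner v v" "inner v w < inner v v"
  shows "open_segment u w \<subseteq> inside (path_image c) \<or>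
    (\<exists>x\<in>set zs. open_segment v x \<subseteq> inside (path_image c))"
proof -
  define R where "R = path_image (polyline (w # zs @ [u]))"
  define P where "P = path_image c"
  have PR: "P = closed_segment v w \<union> closed_segment u v \<union> R" using P by (simp add: P_def R_def)
  have vR: "v \<notin> R" using disj dist by (auto simp: R_def)
  have RC: "closed R" unfolding R_def
  proof (rule closed_path_image)
    have "path (polyline xs)" if "length xs \<ge> 2" for xs
      using that by (induction xs rule: polyline.induct) auto
    then show "path (polyline (w # zs @ [u]))" by simp
  qed
  obtain r where r: "r > 0" "{z \<in> ball v r. s z > 0 \<and> t z > 0} \<subseteq> inside P"
    using wedge_inside[OF c P _ _ ext] RC vR unfolding R_def P_def by metis
  define X where "X = {x \<in> set zs. s x > 0 \<and> t x > 0 \<and> s x + t x \<le> 1}"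
  \<comment> \<open>The distance from \<open>v\<close> is measured by the level
    \<open>s + t\<close>. If no vertex lies in the triangle, the default 1 is the level of the side
    \<open>u w\<close>.\<close>
  define h where "h = (if X = {} then 1 else Min ((\<lambda>x. s x + t x) ` X))"
  have finX: "finite X" by (simp add: X_def)
  have hX: "h \<le> s x + t x" if "x \<in> X" for x
    using that finX by (auto simp: h_def)
  have hattained: "\<exists>x\<in>X. s x + t x = h" if "X \<noteq> {}"
  proof -
    have "h \<in> (\<lambda>x. s x + t x) ` X"
      using Min_in[of "(\<lambda>x. s x + t x) ` X"] finX that by (simp add: h_def)
    then show ?thesis by auto
  qed
  have "h \<le> 1 \<and> h > 0"
  proof (cases "X = {}")
    case False
    then obtain x where "x \<in> X" "s x + t x = h" using hattained by blast
    then show ?thesis by (auto simp: X_def)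
  qed (simp add: h_def)
  then have h1: "h \<le> 1" and h0: "h > 0" by auto
  have seg: "s z = 0" if "z \<in> closed_segment v w" for z
    using that by (elim st_segment) auto
  have seg': "t z = 0" if "z \<in> closed_segment u v" for z
    using that by (elim st_segment) auto
  \<comment> \<open>A segment of the chain that starts in the wedge and leaves it must cross one of
    the two rays. The chain meets the edges \<open>v w\<close> and \<open>u v\<close> only at
    \<open>w\<close> and \<open>u\<close>, so the crossing has level at least 1.\<close>
  have exit: "\<exists>y \<in> closed_segment z p. s y + t y \<ge> h"
    if "s z > 0" "t z > 0" "p \<in> set (w # zs @ [u])" "closed_segment z p \<subseteq> R" for z p
  proof (cases "s p + t p \<ge> h")
    case False
    then have "p \<noteq> u" "p \<noteq> w" using h1 by auto
    then have "p \<in> set zs" using that by auto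
    then have np: "\<not> (s p > 0 \<and> t p > 0)" using False h1 hX[of p] by (auto simp: X_def)
    define Q where "Q = {z. s z > 0} \<inter> {z. t z > 0}"
    have oQ: "open Q" unfolding Q_def
      using cont[of UNIV] by (auto intro!: open_Int open_Collect_less continuous_intros)
    have "closed ({z. s z \<ge> 0} \<inter> {z. t z \<ge> 0})"
      using cont[of UNIV] by (auto intro!: closed_Int closed_Collect_le continuous_intros)
    then have cQ: "closure Q \<subseteq> {z. s z \<ge> 0} \<inter> {z. t z \<ge> 0}"
      by (intro closure_minimal) (auto simp: Q_def)
    have "closed_segment z p \<inter> frontier Q \<noteq> {}"
      by (rule connected_Int_frontier) (use that np in \<open>auto simp: Q_def\<close>)
    then obtain y where y: "y \<in> closed_segment z p" "y \<in> frontier Q" by blast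
    have y0: "s y \<ge> 0" "t y \<ge> 0" "\<not> (s y > 0 \<and> t y > 0)"
      using y(2) cQ interior_open[OF oQ] by (auto simp: frontier_def Q_def)
    have yR: "y \<in> R" using y that by blast
    have "s y + t y \<ge> 1"
    proof (cases "s y = 0")
      case True
      show ?thesis
      proof (rule ccontr)
        assume less: "\<not> ?thesis"
        then have "y \<in> closed_segment v w" using on_side_w True y0 by auto
        then have "y = w" using disj(1) yR by (auto simp: R_def)
        then show False using less by simp
      qed
    next
      case False
      then have t0: "t y = 0" using y0 by auto
      show ?thesis
      proof (rule ccontr)
        assume less: "\<not> ?thesis"
        then have "y \<in> closed_segment u v" using on_side_u t0 y0 by auto
        then have "y = u" using disj(2) yR by (auto simp: R_def)
        then show False using less by simp
      qed
    qed
    then show ?thesis using y h1 by force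
  qed auto
  have edge: "\<exists>p q. p \<in> set (w # zs @ [u]) \<and> q \<in> set (w # zs @ [u]) \<and> p \<noteq> q \<and> {p, q} \<noteq> {u, w} \<and>
      z \<in> closed_segment p q \<and> closed_segment p q \<subseteq> R" if "z \<in> R" for z
  proof -
    obtain xs p q ys where *: "w # zs @ [u] = xs @ p # q # ys" "z \<in> closed_segment p q"
      "closed_segment p q \<subseteq> R"
    proof (rule polyline_edge)
      show "z \<in> path_image (polyline (w # zs @ [u]))" using \<open>z \<in> R\<close> by (simp add: R_def)
    qed (auto simp: R_def)
    have "{p, q} \<noteq> {u, w}" using hd_last_not_consecutive[OF _ zs *(1)] dist by auto
    moreover have "p \<noteq> q"
    proof -
      have "distinct (xs @ p # q # ys)" using dist unfolding *(1)[symmetric] by simp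
      then show ?thesis by simp
    qed
    moreover have "p \<in> set (w # zs @ [u])" "q \<in> set (w # zs @ [u])" unfolding *(1) by auto
    ultimately show ?thesis using * by blast
  qed
  \<comment> \<open>By \<open>exit\<close>, an edge through a wedge point below level
    \<open>h\<close> would have both ends strictly higher than that point, but the level is affine
    along the edge.\<close>
  have A: "s z + t z \<ge> h" if "z \<in> R" "s z > 0" "t z > 0" for z
  proof (rule ccontr)
    assume neg: "\<not> ?thesis"
    obtain p q where pq: "p \<in> set (w # zs @ [u])" "q \<in> set (w # zs @ [u])"
      "z \<in> closed_segment p q" "closed_segment p q \<subseteq> R"
      using edge[OF \<open>z \<in> R\<close>] by blast
    have bigger: "s p + t p > s z + t z" if p: "p \<in> set (w # zs @ [u])" "closed_segment z p \<subseteq> R" for p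
    proof (rule ccontr)
      assume le: "\<not> ?thesis"
      obtain y where y: "y \<in> closed_segment z p" "s y + t y \<ge> h"
        using exit[OF \<open>s z > 0\<close> \<open>t z > 0\<close> p] by blast
      obtain a where a: "0 \<le> a" "a \<le> 1" "s y = (1 - a) * s z + a * s p" "t y = (1 - a) * t z + a * t p"
        using st_segment[OF y(1)] by metis
      have "s y + t y = (s z + t z) + a * ((s p + t p) - (s z + t z))" using a by (simp add: algebra_simps)
      moreover have "a * ((s p + t p) - (s z + t z)) \<le> 0" using le a by (intro mult_nonneg_nonpos) auto
      ultimately show False using y neg by simp
    qed
    have zp: "closed_segment z p \<subseteq> R" "closed_segment z q \<subseteq> R"
      using subsegments pq(3,4) by blast+
    show False
      using bigger[OF pq(1) zp(1)] bigger[OF pq(2) zp(2)] segment_sum[OF pq(3)] by linarith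
  qed
  define N where "N = norm (u - v) + norm (w - v) + 1"
  define d where "d = min (h / 4) (r / (2 * N))"
  define z0 where "z0 = v + d *\<^sub>R (u - v) + d *\<^sub>R (w - v)"
  have N: "N > 0" by (simp add: N_def add_nonneg_pos)
  have d: "d > 0" "2 * d < h" using h0 r N by (auto simp: d_def min_less_iff_disj)
  have "norm (z0 - v) \<le> d * norm (u - v) + d * norm (w - v)"
    unfolding z0_def using d norm_triangle_ineq[of "d *\<^sub>R (u - v)" "d *\<^sub>R (w - v)"] by simp
  also have "\<dots> < d * N" using d by (simp add: N_def algebra_simps)
  also have "\<dots> \<le> r / (2 * N) * N"
    using N by (intro mult_right_mono) (auto simp: d_def)
  also have "\<dots> \<le> r" using N r by simp
  finally have "z0 \<in> ball v r" by (simp add: dist_norm norm_minus_commute)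
  moreover have z0st: "s z0 = d" "t z0 = d" using st_at by (auto simp: z0_def)
  ultimately have z0: "z0 \<in> inside P" using r d by auto
  have B: "{z. s z > 0} \<inter> {z. t z > 0} \<inter> {z. s z + t z < h} \<subseteq> inside P"
  proof (rule connected_subset_inside)
    show "connected ({z. s z > 0} \<inter> {z. t z > 0} \<inter> {z. s z + t z < h})"
      by (intro convex_connected convex_Int convex_halfplanes)
    show "{z. s z > 0} \<inter> {z. t z > 0} \<inter> {z. s z + t z < h} \<inter> P = {}"
      unfolding PR using seg seg' A by force
    show "{z. s z > 0} \<inter> {z. t z > 0} \<inter> {z. s z + t z < h} \<inter> inside P \<noteq> {}"
      using z0 z0st d by auto
  qed
  show ?thesis
  proof (cases "X = {}")
    case False
    then obtain x where x: "x \<in> X" "s x + t x = h" using hattained by blast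
    have "open_segment v x \<subseteq> inside P"
    proof
      fix z assume "z \<in> open_segment v x"
      then obtain a where a: "0 < a" "a < 1" "z = (1 - a) *\<^sub>R v + a *\<^sub>R x"
        by (auto simp: in_segment)
      have sz: "s z = a * s x" "t z = a * t x" unfolding a(3) s_affine t_affine by auto
      have xpos: "s x > 0" "t x > 0" using x by (auto simp: X_def)
      have "s z + t z = a * h" unfolding sz x(2)[symmetric] by (simp add: algebra_simps)
      then have "s z > 0" "t z > 0" "s z + t z < h" using sz xpos a(1,2) h0 by simp_all
      then have "z \<in> {z. s z > 0} \<inter> {z. t z > 0} \<inter> {z. s z + t z < h}" by simp
      then show "z \<in> inside P" using B by blast
    qed
    then show ?thesis using x by (auto simp: X_def P_def)
  next
    case True
    then have h: "h = 1" by (simp add: h_def)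
    \<comment> \<open>The side \<open>u w\<close> has level exactly 1, which \<open>A\<close> does
      not exclude. An edge that meets it between \<open>u\<close> and \<open>w\<close> has both ends
      at level at least 1, hence exactly 1, hence on the line through \<open>u\<close> and
      \<open>w\<close>. By general position the ends are \<open>u\<close> and \<open>w\<close>,
      which no edge of the chain joins.\<close>
    have noR: "z \<notin> R" if z: "s z > 0" "t z > 0" "s z + t z = 1" for z
    proof
      assume "z \<in> R"
      then obtain p q where pq: "p \<in> set (w # zs @ [u])" "q \<in> set (w # zs @ [u])" "p \<noteq> q" "{p, q} \<noteq> {u, w}"
        "z \<in> closed_segment p q" "closed_segment p q \<subseteq> R"
        using edge by blast
      have zp: "closed_segment z p \<subseteq> R" "closed_segment z q \<subseteq> R"
        using subsegments pq(5,6) by blast+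
      have ge: "s p + t p \<ge> 1" if "closed_segment z p \<subseteq> R" for p
      proof (rule ccontr)
        assume neg: "\<not> ?thesis"
        obtain e where e: "0 < e" "e \<le> 1" "(1 - e) * s z + e * s p > 0" "(1 - e) * t z + e * t p > 0"
          using both_positive_nearby z by metis
        define y where "y = (1 - e) *\<^sub>R z + e *\<^sub>R p"
        have "y \<in> closed_segment z p" using e unfolding y_def closed_segment_def by auto
        then have "y \<in> R" using that by blast
        moreover have "s y = (1 - e) * s z + e * s p" "t y = (1 - e) * t z + e * t p"
          by (simp_all add: y_def s_affine t_affine)
        ultimately have "s y + t y \<ge> 1" "s y + t y = (s z + t z) - e * ((s z + t z) - (s p + t p))"
          using A[of y] e(3,4) h by (auto simp: algebra_simps)
        moreover have "e * ((s z + t z) - (s p + t p)) > 0" using e neg z by simp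
        ultimately show False using z by simp
      qed
      have notvertex: "z \<notin> set (w # zs @ [u])"
      proof
        assume "z \<in> set (w # zs @ [u])"
        then consider "z = w" | "z = u" | "z \<in> X" using z by (auto simp: X_def)
        then show False using z True by cases auto
      qed
      obtain a where a: "0 \<le> a" "a \<le> 1" "z = (1 - a) *\<^sub>R p + a *\<^sub>R q"
          "s z = (1 - a) * s p + a * s q" "t z = (1 - a) * t p + a * t q"
        using st_segment[OF pq(5)] by metis
      have a01: "a \<noteq> 0" "a \<noteq> 1" using notvertex pq(1,2) a(3) by auto
      have "(1 - a) * ((s p + t p) - 1) + a * ((s q + t q) - 1) = 0"
        using a(4,5) z(3) by (simp add: algebra_simps)
      moreover have "(1 - a) * ((s p + t p) - 1) \<ge> 0" "a * ((s q + t q) - 1) \<ge> 0"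
        using ge[OF zp(1)] ge[OF zp(2)] a by auto
      ultimately have "(1 - a) * ((s p + t p) - 1) = 0" "a * ((s q + t q) - 1) = 0" by linarith+
      then have "s p + t p = 1" "s q + t q = 1" using a01 by auto
      then have "cross u w p = 0" "cross u w q = 0" by (simp_all add: cross_uw)
      then have "p \<in> {u, w}" "q \<in> {u, w}" using gp pq(1,2) by auto
      then show False using pq(3,4) by auto
    qed
    have "{z. s z > 0} \<inter> {z. t z > 0} \<inter> {z. s z + t z \<le> 1} \<subseteq> inside P"
    proof (rule connected_subset_inside)
      show "connected ({z. s z > 0} \<inter> {z. t z > 0} \<inter> {z. s z + t z \<le> 1})"
        by (intro convex_connected convex_Int convex_halfplanes)
      have "z \<notin> P" if "s z > 0" "t z > 0" "s z + t z \<le> 1" for z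
        unfolding PR using seg[of z] seg'[of z] A[of z] noR[of z] h that by auto
      then show "{z. s z > 0} \<inter> {z. t z > 0} \<inter> {z. s z + t z \<le> 1} \<inter> P = {}" by blast
      show "{z. s z > 0} \<inter> {z. t z > 0} \<inter> {z. s z + t z \<le> 1} \<inter> inside P \<noteq> {}"
        using z0 z0st d h by auto
    qed
    moreover have "z \<in> {z. s z > 0} \<inter> {z. t z > 0} \<inter> {z. s z + t z \<le> 1}" if "z \<in> open_segment u w" for z
    proof -
      obtain a where a: "0 < a" "a < 1" "z = (1 - a) *\<^sub>R u + a *\<^sub>R w"
        using \<open>z \<in> open_segment u w\<close> by (auto simp: in_segment)
      have "s z = 1 - a" "t z = a" unfolding a(3) s_affine t_affine by auto
      then show ?thesis using a by auto
    qed
    ultimately show ?thesis by (auto simp: P_def)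
  qed
qed

lemma general_position_cross:
  assumes "general_position S" "{a, b, c} \<subseteq> S" "a \<noteq> b" "b \<noteq> c" "a \<noteq> c"
  shows "cross a b c \<noteq> 0"
proof -
  have "card {a, b, c} = 3" using assms by simp
  then have "\<not> collinear {a, b, c}" using assms unfolding general_position_def by blast
  then show ?thesis by (simp add: collinear_iff_cross)
qed

lemma polygon_diagonal:
  assumes dist: "distinct vs" and len: "length vs \<ge> 4" and sp: "simple_path (closed_polyline vs)"
    and gp: "general_position (set vs)"
  obtains p q where "p \<in> set vs" "q \<in> set vs" "p \<noteq> q"
    "open_segment p q \<subseteq> inside (path_image (closed_polyline vs))"
proof -
  have "vs \<noteq> []" using len by auto
  then have "Max (norm ` set vs) \<in> norm ` set vs" by (intro Max_in) auto
  then obtain v where v: "v \<in> set vs" "norm v = Max (norm ` set vs)" by auto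
  have vmax: "norm w \<le> norm v" if "w \<in> set vs" for w using v that by simp
  \<comment> \<open>Expanding the positive square of \<open>norm (v - w)\<close> and using
    \<open>norm w \<le> norm v\<close> shows that a vertex of maximal norm is strictly extreme, with
    supporting line orthogonal to \<open>v\<close>.\<close>
  have ext: "inner v w < inner v v" if "w \<in> set vs" "w \<noteq> v" for w
  proof -
    have "inner (v - w) (v - w) > 0" using that by simp
    then have "inner v v - 2 * inner v w + inner w w > 0"
      by (simp add: inner_diff_left inner_diff_right inner_commute)
    moreover have "inner w w \<le> inner v v"
      using vmax[OF that(1)] by (metis power2_norm_eq_inner norm_ge_zero power_mono)
    ultimately show ?thesis by simp
  qed
  obtain ys xs where vs: "vs = ys @ v # xs" using v(1) by (metis split_list)
  obtain w rest where w: "xs @ ys = w # rest" using len vs by (cases "xs @ ys") auto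
  obtain zs u where u: "rest = zs @ [u]"
    using len vs w by (cases rest rule: rev_cases) (auto dest: arg_cong[of _ _ length])
  have zs: "zs \<noteq> []" using arg_cong[OF w, of length] len vs u by auto
  have eq: "(v # xs) @ ys = v # w # zs @ [u]" using w u by simp
  define c where "c = closed_polyline (v # w # zs @ [u])"
  have c: "simple_path c" "path_image c = path_image (closed_polyline vs)"
    using closed_polyline_rotate[where ys = ys and xs = "v # xs"] sp unfolding c_def eq[symmetric] vs by auto
  have set: "set vs = set (v # w # zs @ [u])"
    unfolding eq[symmetric] vs by auto
  have dist': "distinct (v # w # zs @ [u])" unfolding eq[symmetric] using dist vs by auto
  define R where "R = path_image (polyline (w # zs @ [u]))"
  have split: "arc (polyline (w # zs @ [u, v]))" "closed_segment v w \<inter> path_image (polyline (w # zs @ [u, v])) \<subseteq> {v, w}"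
    "path_image c = closed_segment v w \<union> path_image (polyline (w # zs @ [u, v]))"
    using c(1) simple_closed_polyline[of "[v]" "w # zs @ [u]"] path_image_closed_polyline[of "[v]" "w # zs @ [u]"]
    unfolding c_def by auto
  have pi: "path_image (polyline (w # zs @ [u, v])) = R \<union> closed_segment u v"
    using path_image_polyline_append[of "w # zs" u "[v]"] unfolding R_def by simp
  have Ruv: "R \<inter> closed_segment u v \<subseteq> {u}"
    using split(1) arc_polyline_append[of "w # zs" "[v]" u] unfolding R_def by simp
  then have "v \<notin> R" using dist' by auto
  then have Rvw: "R \<inter> closed_segment v w \<subseteq> {w}" using split(2) pi by blast
  have nondeg: "cross v u w \<noteq> 0"
    using general_position_cross[OF gp, of v u w] dist' set by auto
  interpret corner v u w by standard (rule nondeg)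
  have P: "path_image c = closed_segment v w \<union> closed_segment u v \<union> path_image (polyline (w # zs @ [u]))"
    using split(3) pi unfolding R_def by blast
  have half: "inner v z \<le> inner v v" if "z \<in> path_image c" for z
  proof -
    have "z \<in> path_image (polyline (v # w # zs @ [u, v]))"
      using that unfolding c_def closed_polyline_def by simp
    moreover have "length (v # w # zs @ [u, v]) \<ge> 2" by simp
    ultimately obtain as p q bs
      where *: "v # w # zs @ [u, v] = as @ p # q # bs" "z \<in> closed_segment p q"
      by (rule polyline_edge)
    have "set (v # w # zs @ [u, v]) = set vs" unfolding set by auto
    then have "p \<in> set vs" "q \<in> set vs" unfolding *(1) by auto
    then have "p \<in> {x. inner v x \<le> inner v v}" "q \<in> {x. inner v x \<le> inner v v}"
      using ext by force+
    then have "closed_segment p q \<subseteq> {x. inner v x \<le> inner v v}"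
      by (intro closed_segment_subset convex_halfspace_le)
    then show ?thesis using * by blast
  qed
  have closed: "pathfinish c = pathstart c" unfolding c_def by (rule closed_polyline_closed) simp
  have gp': "cross u w z \<noteq> 0" if "z \<in> set zs" for z
    by (rule general_position_cross[OF gp]) (use that dist' set in auto)
  have "open_segment u w \<subseteq> inside (path_image c) \<or>
    (\<exists>x\<in>set zs. open_segment v x \<subseteq> inside (path_image c))"
    by (rule corner_diagonal[OF c(1) closed P dist' zs])
      (use Ruv Rvw gp' half ext dist' set in \<open>auto simp: R_def\<close>)
  then show ?thesis
  proof (elim disjE bexE)
    assume "open_segment u w \<subseteq> inside (path_image c)"
    then show ?thesis using that[of u w] dist' set c(2) by auto
  next
    fix x assume "x \<in> set zs" "open_segment v x \<subseteq> inside (path_image c)"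
    then show ?thesis using that[of v x] dist' set c(2) by auto
  qed
qed

text \<open>The diagonal and the two boundary arcs form a theta curve, and the inside is the union
  of the insides of the two smaller cycles and the open diagonal. The lists \<open>zs\<close> and
  \<open>xs @ ys\<close> are nonempty because otherwise \<open>p q\<close> would be a boundary edge,
  which contains no inside points.\<close>

lemma split_polygon:
  assumes dist: "distinct (xs @ p # zs @ q # ys)"
    and sp: "simple_path (closed_polyline (xs @ p # zs @ q # ys))"
    and diag: "open_segment p q \<subseteq> inside (path_image (closed_polyline (xs @ p # zs @ q # ys)))"
  shows "zs \<noteq> []" "xs @ ys \<noteq> []"
    "simple_path (closed_polyline (p # zs @ [q]))"
    "simple_path (closed_polyline (xs @ p # q # ys))"
    "inside (path_image (closed_polyline (p # zs @ [q]))) \<subseteq>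
       inside (path_image (closed_polyline (xs @ p # zs @ q # ys)))"
    "inside (path_image (closed_polyline (xs @ p # q # ys))) \<subseteq>
       inside (path_image (closed_polyline (xs @ p # zs @ q # ys)))"
proof -
  define C1 where "C1 = path_image (polyline (p # zs @ [q]))"
  define C2 where "C2 = path_image (polyline (q # ys @ xs @ [p]))"
  define P where "P = path_image (closed_polyline (xs @ p # zs @ q # ys))"
  have pq: "p \<noteq> q" using dist by auto
  note rot = closed_polyline_rotate[where ys = xs and xs = "p # zs @ q # ys"]
  have sp': "simple_path (closed_polyline ((p # zs) @ (q # ys @ xs)))" using sp rot(2) by simp
  have arcs: "arc (polyline (p # zs @ [q]))" "arc (polyline (q # ys @ xs @ [p]))" "C1 \<inter> C2 \<subseteq> {p, q}"
    using sp' simple_closed_polyline[of "p # zs" "q # ys @ xs"] unfolding C1_def C2_def by auto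
  have P: "P = C1 \<union> C2"
    using rot(1) path_image_closed_polyline[of "p # zs" "q # ys @ xs"]
    unfolding P_def C1_def C2_def by simp
  have ends: "p \<in> C1" "q \<in> C1" "p \<in> C2" "q \<in> C2"
    using set_subset_path_image_polyline[of "p # zs @ [q]"]
      set_subset_path_image_polyline[of "q # ys @ xs @ [p]"] unfolding C1_def C2_def by auto
  have inP: "inside P \<inter> P = {}" by (rule inside_no_overlap)
  have odisj: "open_segment p q \<inter> C1 = {}" "open_segment p q \<inter> C2 = {}"
    using diag inP P unfolding P_def[symmetric] by blast+
  have seg: "closed_segment p q = open_segment p q \<union> {p, q}" by (rule closed_segment_eq_open)
  have one: "open_segment p q \<noteq> {}" using pq by simp
  show "zs \<noteq> []"
  proof
    assume "zs = []"
    then have "C1 = closed_segment p q" by (simp add: C1_def)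
    then show False using odisj one seg by auto
  qed
  show "xs @ ys \<noteq> []"
  proof
    assume "xs @ ys = []"
    then have "C2 = closed_segment p q" by (simp add: C2_def closed_segment_commute)
    then show False using odisj one seg by auto
  qed
  have simple: "simple_path (polyline (p # zs @ [q]))"
    "simple_path (reversepath (polyline (q # ys @ xs @ [p])))" "simple_path (linepath p q)"
    using arcs pq by (simp_all add: arc_imp_simple_path simple_path_reversepath)
  have inter: "path_image (polyline (p # zs @ [q])) \<inter> path_image (reversepath (polyline (q # ys @ xs @ [p]))) = {p, q}"
    "path_image (polyline (p # zs @ [q])) \<inter> path_image (linepath p q) = {p, q}"
    "path_image (reversepath (polyline (q # ys @ xs @ [p]))) \<inter> path_image (linepath p q) = {p, q}"
    using arcs(3) odisj ends seg unfolding path_image_reversepath path_image_linepath C1_def[symmetric] C2_def[symmetric]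
    by blast+
  have meets: "path_image (linepath p q) \<inter> inside (path_image (polyline (p # zs @ [q])) \<union>
        path_image (reversepath (polyline (q # ys @ xs @ [p])))) \<noteq> {}"
    using diag one seg unfolding P_def[symmetric] P path_image_reversepath path_image_linepath
      C1_def[symmetric] C2_def[symmetric] by blast
  have ends': "pathstart (polyline (p # zs @ [q])) = p" "pathfinish (polyline (p # zs @ [q])) = q"
    "pathstart (reversepath (polyline (q # ys @ xs @ [p]))) = p"
    "pathfinish (reversepath (polyline (q # ys @ xs @ [p]))) = q"
    "pathstart (linepath p q) = p" "pathfinish (linepath p q) = q"
    by simp_all
  have "inside (C1 \<union> closed_segment p q) \<union> inside (C2 \<union> closed_segment p q) \<union>
      (closed_segment p q - {p, q}) = inside P"
    using split_inside_simple_closed_curve[OF simple(1) ends'(1,2) simple(2) ends'(3,4) simple(3) ends'(5,6)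
      pq inter meets]
    unfolding path_image_reversepath path_image_linepath C1_def[symmetric] C2_def[symmetric] P by metis
  then have sub: "inside (C1 \<union> closed_segment p q) \<subseteq> inside P" "inside (C2 \<union> closed_segment p q) \<subseteq> inside P"
    by blast+
  have sq: "closed_segment q p = closed_segment p q" by (rule closed_segment_commute)
  have 1: "simple_path (closed_polyline (p # zs @ [q]))" "path_image (closed_polyline (p # zs @ [q])) = C1 \<union> closed_segment p q"
    using simple_closed_polyline[of "p # zs" "[q]"] path_image_closed_polyline[of "p # zs" "[q]"] arcs pq odisj seg sq
    by (auto simp: C1_def[symmetric] arc_linepath_iff)
  have 2: "simple_path (closed_polyline (q # ys @ xs @ [p]))"
    "path_image (closed_polyline (q # ys @ xs @ [p])) = C2 \<union> closed_segment p q"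
    using simple_closed_polyline[of "q # ys @ xs" "[p]"] path_image_closed_polyline[of "q # ys @ xs" "[p]"] arcs pq odisj seg
    by (auto simp: C2_def[symmetric] arc_linepath_iff)
  note rot2 = closed_polyline_rotate[where ys = "xs @ [p]" and xs = "q # ys"]
  show "simple_path (closed_polyline (p # zs @ [q]))" by (rule 1)
  show "simple_path (closed_polyline (xs @ p # q # ys))" using rot2 2 by simp
  show "inside (path_image (closed_polyline (p # zs @ [q]))) \<subseteq>
       inside (path_image (closed_polyline (xs @ p # zs @ q # ys)))"
    using sub(1) 1 by (simp add: P_def)
  show "inside (path_image (closed_polyline (xs @ p # q # ys))) \<subseteq>
       inside (path_image (closed_polyline (xs @ p # zs @ q # ys)))"
    using sub(2) rot2 2 by (simp add: P_def)
qed

definition empty_triangle :: "complex set \<Rightarrow> complex \<Rightarrow> complex \<Rightarrow> complex \<Rightarrow> bool" where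
  "empty_triangle S a b c \<longleftrightarrow> {a, b, c} \<subseteq> S \<and> distinct [a, b, c] \<and>
     interior (convex hull {a, b, c}) \<inter> S = {}"

text \<open>Induction on the number of vertices. The inside of each part lies in the inside of the
  whole, so emptiness is inherited; for three vertices the inside is the open triangle.\<close>

lemma empty_polygon_triangulated:
  assumes "distinct vs" "length vs \<ge> 3" "simple_path (closed_polyline vs)"
    "set vs \<subseteq> S" "general_position S" "inside (path_image (closed_polyline vs)) \<inter> S = {}"
  shows "triangulated (empty_triangle S) vs"
  using assms
proof (induction "length vs" arbitrary: vs rule: less_induct)
  case less
  show ?case
  proof (cases "length vs = 3")
    case True
    then obtain a c b where vs: "vs = [a, c, b]"
      by (auto simp: numeral_3_eq_3 length_Suc_conv)
    have "path_image (closed_polyline vs) = closed_segment a c \<union> closed_segment c b \<union> closed_segment b a"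
      by (simp add: vs closed_polyline_def path_image_join Un_assoc)
    then have "inside (path_image (closed_polyline vs)) = interior (convex hull {a, c, b})"
      by (simp add: inside_of_triangle)
    then have "empty_triangle S a c b"
      using less.prems vs by (auto simp: empty_triangle_def)
    then show ?thesis
      using triangulated.triangle[of "empty_triangle S" a "[]" c "[]" b] vs
      by (simp add: triangulated.edge)
  next
    case False
    then have len: "length vs \<ge> 4" using less.prems by simp
    have gp: "general_position (set vs)"
      using less.prems(4,5) unfolding general_position_def by blast
    obtain p0 q0 where pq0: "p0 \<in> set vs" "q0 \<in> set vs" "p0 \<noteq> q0"
      "open_segment p0 q0 \<subseteq> inside (path_image (closed_polyline vs))"
      using polygon_diagonal[OF less.prems(1) len less.prems(3) gp] by blast
    have "\<exists>p q xs zs ys. vs = xs @ p # zs @ q # ys \<and>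
        open_segment p q \<subseteq> inside (path_image (closed_polyline vs))"
    proof -
      obtain as bs where as: "vs = as @ p0 # bs" using pq0(1) by (metis split_list)
      then consider "q0 \<in> set as" | "q0 \<in> set bs" using pq0 by auto
      then show ?thesis
      proof cases
        case 1
        then obtain cs ds where "as = cs @ q0 # ds" by (metis split_list)
        then have "vs = cs @ q0 # ds @ p0 # bs" using as by simp
        then show ?thesis using pq0(4) by (metis open_segment_commute)
      next
        case 2
        then obtain cs ds where "bs = cs @ q0 # ds" by (metis split_list)
        then show ?thesis using pq0(4) as by blast
      qed
    qed
    then obtain p q xs zs ys where vs: "vs = xs @ p # zs @ q # ys"
      "open_segment p q \<subseteq> inside (path_image (closed_polyline vs))" by blast
    note split = split_polygon[of xs p zs q ys, folded vs(1), OF less.prems(1,3) vs(2)]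
    have lengths: "length zs \<ge> 1" "length xs + length ys \<ge> 1"
      using split(1,2) by (auto simp: Suc_le_eq)
    have 1: "triangulated (empty_triangle S) (xs @ p # q # ys)"
      by (rule less.hyps) (use split(4,6) lengths less.prems vs(1) in auto)
    have 2: "triangulated (empty_triangle S) (p # zs @ [q])"
      by (rule less.hyps) (use split(3,5) lengths less.prems vs(1) in auto)
    show ?thesis using triangulated_glue[OF 1 2] vs by simp
  qed
qed

section \<open>Counting triangulated polygons\<close>

lemma triangulated_inner:
  assumes "triangulated E (a # zs @ [b])" "zs \<noteq> []"
  obtains c xs ys where "zs = xs @ c # ys" "E a c b" "triangulated E (a # xs @ [c])"
    "triangulated E (c # ys @ [b])"
  using assms by (cases rule: triangulated.cases) auto

text \<open>The triangulated polygons on a fixed root edge, listed without its two ends. Then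
  \<open>j\<close> is also the number of triangles.\<close>

definition inner_lists :: "('a \<Rightarrow> 'a \<Rightarrow> 'a \<Rightarrow> bool) \<Rightarrow> 'a \<Rightarrow> 'a \<Rightarrow> nat \<Rightarrow> 'a list set" where
  "inner_lists E a b j = {zs. length zs = j \<and> triangulated E (a # zs @ [b])}"

lemma fact_mult_fact_le: "i \<le> j \<Longrightarrow> fact i * fact (j - i) \<le> (fact j :: nat)"
  using fact_fact_dvd_fact[of i "j - i"] by (auto intro: dvd_imp_le)

lemma inner_lists_Suc:
  "inner_lists E a b (Suc j) \<subseteq>
    (\<Union>i\<le>j. \<Union>c\<in>{c. E a c b}. (\<lambda>(xs, ys). xs @ c # ys) ` (inner_lists E a c i \<times> inner_lists E c b (j - i)))"
proof
  fix zs assume "zs \<in> inner_lists E a b (Suc j)"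
  then have zs: "length zs = Suc j" "triangulated E (a # zs @ [b])" by (auto simp: inner_lists_def)
  then have "zs \<noteq> []" by auto
  with zs(2) obtain c xs ys where *: "zs = xs @ c # ys" "E a c b" "triangulated E (a # xs @ [c])"
    "triangulated E (c # ys @ [b])" by (rule triangulated_inner)
  have "length xs \<le> j" "length ys = j - length xs" using zs(1) *(1) by auto
  then show "zs \<in> (\<Union>i\<le>j. \<Union>c\<in>{c. E a c b}.
      (\<lambda>(xs, ys). xs @ c # ys) ` (inner_lists E a c i \<times> inner_lists E c b (j - i)))"
    using * by (force simp: inner_lists_def)
qed

text \<open>Choosing the apex costs \<open>D\<close>, and the remaining \<open>j - 1\<close>
  vertices are divided between its two edges in \<open>j\<close> ways. This is the Catalan
  recursion. The cruder factorial is closed under it: \<open>j\<close> terms of at most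
  \<open>fact (j - 1)\<close> each, by \<open>fact_mult_fact_le\<close>.\<close>

lemma card_inner_lists:
  assumes E: "\<And>a c b. E a c b \<Longrightarrow> a \<noteq> c \<and> c \<noteq> b"
    and D: "\<And>a b. a \<noteq> b \<Longrightarrow> finite {c. E a c b} \<and> card {c. E a c b} \<le> D"
    and "a \<noteq> b"
  shows "finite (inner_lists E a b j) \<and> card (inner_lists E a b j) \<le> fact j * D ^ j"
  using \<open>a \<noteq> b\<close>
proof (induction j arbitrary: a b rule: less_induct)
  case (less j)
  show ?case
  proof (cases j)
    case 0
    then have sub: "inner_lists E a b j \<subseteq> {[]}" by (auto simp: inner_lists_def)
    show ?thesis using 0 finite_subset[OF sub] card_mono[OF _ sub] by simp
  next
    case (Suc l)
    have IH: "finite (inner_lists E a c i \<times> inner_lists E c b (l - i))"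
      "card (inner_lists E a c i \<times> inner_lists E c b (l - i)) \<le> fact l * D ^ l"
      if "i \<le> l" "E a c b" for i c
    proof -
      have 1: "finite (inner_lists E a c i) \<and> card (inner_lists E a c i) \<le> fact i * D ^ i"
        using less.IH[of i a c] E[OF that(2)] that Suc by auto
      have 2: "finite (inner_lists E c b (l - i)) \<and> card (inner_lists E c b (l - i)) \<le> fact (l - i) * D ^ (l - i)"
        using less.IH[of "l - i" c b] E[OF that(2)] that Suc by auto
      show "finite (inner_lists E a c i \<times> inner_lists E c b (l - i))" using 1 2 by simp
      have "card (inner_lists E a c i \<times> inner_lists E c b (l - i))
          \<le> (fact i * D ^ i) * (fact (l - i) * D ^ (l - i))"
        using 1 2 by (simp add: card_cartesian_product mult_mono)
      also have "\<dots> = (fact i * fact (l - i)) * D ^ l" using that by (simp add: power_add[symmetric])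
      also have "\<dots> \<le> fact l * D ^ l" using that by (intro mult_right_mono fact_mult_fact_le) auto
      finally show "card (inner_lists E a c i \<times> inner_lists E c b (l - i)) \<le> fact l * D ^ l" .
    qed
    define U where "U = (\<Union>i\<le>l. \<Union>c\<in>{c. E a c b}.
        (\<lambda>(xs, ys). xs @ c # ys) ` (inner_lists E a c i \<times> inner_lists E c b (l - i)))"
    have sub: "inner_lists E a b j \<subseteq> U" unfolding U_def Suc by (rule inner_lists_Suc)
    have fin: "finite {c. E a c b}" "card {c. E a c b} \<le> D" using D[OF less.prems] by auto
    have finU: "finite U" unfolding U_def using fin IH by (intro finite_UN_I finite_imageI) auto
    have "card U \<le> (\<Sum>i\<le>l. card (\<Union>c\<in>{c. E a c b}.
        (\<lambda>(xs, ys). xs @ c # ys) ` (inner_lists E a c i \<times> inner_lists E c b (l - i))))"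
      unfolding U_def by (rule card_UN_le) simp
    also have "\<dots> \<le> (\<Sum>i\<le>l. D * (fact l * D ^ l))"
    proof (rule sum_mono)
      fix i assume i: "i \<in> {..l}"
      have "card (\<Union>c\<in>{c. E a c b}. (\<lambda>(xs, ys). xs @ c # ys) ` (inner_lists E a c i \<times> inner_lists E c b (l - i)))
        \<le> (\<Sum>c\<in>{c. E a c b}. card ((\<lambda>(xs, ys). xs @ c # ys) ` (inner_lists E a c i \<times> inner_lists E c b (l - i))))"
        by (rule card_UN_le) (rule fin)
      also have "\<dots> \<le> (\<Sum>c\<in>{c. E a c b}. fact l * D ^ l)"
        using i IH by (intro sum_mono order_trans[OF card_image_le]) auto
      also have "\<dots> \<le> D * (fact l * D ^ l)" using fin(2) by simp
      finally show "card (\<Union>c\<in>{c. E a c b}. (\<lambda>(xs, ys). xs @ c # ys) ` (inner_lists E a c i \<times> inner_lists E c b (l - i)))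
        \<le> D * (fact l * D ^ l)" .
    qed
    also have "\<dots> = fact j * D ^ j" by (simp add: Suc algebra_simps)
    finally show ?thesis using card_mono[OF finU sub] finite_subset[OF sub finU] by linarith
  qed
qed

text \<open>There are \<open>j + 1\<close> triangles. The root triangle is counted by
  \<open>T\<close>, not as an edge with an apex, so only \<open>j\<close> factors \<open>D\<close>
  remain.\<close>

lemma card_triangulated:
  assumes E: "\<And>a c b. E a c b \<Longrightarrow> a \<noteq> c \<and> c \<noteq> b"
    and D: "\<And>a b. a \<noteq> b \<Longrightarrow> finite {c. E a c b} \<and> card {c. E a c b} \<le> D"
    and T: "finite {(a, c, b). E a c b}" "card {(a, c, b). E a c b} \<le> T"
  shows "finite {vs. length vs = j + 3 \<and> triangulated E vs}"
    "card {vs. length vs = j + 3 \<and> triangulated E vs} \<le> fact (Suc j) * T * D ^ j"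
proof -
  define R where "R = {(a, c, b). E a c b}"
  define Z where "Z i t = (case t of (a, c, b) \<Rightarrow> inner_lists E a c i \<times> inner_lists E c b (j - i))" for i t
  define f where "f t = (case t of (a, c, b) \<Rightarrow> (\<lambda>(xs, ys). a # xs @ c # ys @ [b]))" for t :: "'a \<times> 'a \<times> 'a"
  define U where "U = (\<Union>i\<le>j. \<Union>t\<in>R. f t ` Z i t)"
  have sub: "{vs. length vs = j + 3 \<and> triangulated E vs} \<subseteq> U"
  proof clarify
    fix vs assume vs: "length vs = j + 3" "triangulated E vs"
    obtain a ws where a: "vs = a # ws" using vs(1) by (cases vs) auto
    obtain zs b where b: "ws = zs @ [b]" using vs(1) a by (cases ws rule: rev_cases) auto
    have len: "length zs = Suc j" using vs(1) a b by simp
    then have "zs \<noteq> []" by auto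
    moreover have "triangulated E (a # zs @ [b])" using vs(2) a b by simp
    ultimately obtain c xs ys where *: "zs = xs @ c # ys" "E a c b" "triangulated E (a # xs @ [c])"
      "triangulated E (c # ys @ [b])" using triangulated_inner by metis
    have "length xs \<le> j" "length ys = j - length xs" using len *(1) by auto
    then have "(xs, ys) \<in> Z (length xs) (a, c, b)" using * by (simp add: Z_def inner_lists_def)
    moreover have "vs = f (a, c, b) (xs, ys)" using a b * by (simp add: f_def)
    moreover have "(a, c, b) \<in> R" using * by (simp add: R_def)
    ultimately show "vs \<in> U" using \<open>length xs \<le> j\<close> unfolding U_def by blast
  qed
  have Z: "finite (Z i t) \<and> card (Z i t) \<le> fact j * D ^ j" if "i \<le> j" "t \<in> R" for i t
  proof -
    obtain a c b where t: "t = (a, c, b)" "E a c b" using \<open>t \<in> R\<close> by (auto simp: R_def)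
    have 1: "finite (inner_lists E a c i) \<and> card (inner_lists E a c i) \<le> fact i * D ^ i"
      by (rule card_inner_lists[of E D]) (use E D E[OF t(2)] in auto)
    have 2: "finite (inner_lists E c b (j - i)) \<and> card (inner_lists E c b (j - i)) \<le> fact (j - i) * D ^ (j - i)"
      by (rule card_inner_lists[of E D]) (use E D E[OF t(2)] in auto)
    have "card (Z i t) \<le> (fact i * D ^ i) * (fact (j - i) * D ^ (j - i))"
      using 1 2 by (simp add: Z_def t card_cartesian_product mult_mono)
    also have "\<dots> = (fact i * fact (j - i)) * D ^ j" using that by (simp add: power_add[symmetric])
    also have "\<dots> \<le> fact j * D ^ j" using that by (intro mult_right_mono fact_mult_fact_le) auto
    finally show ?thesis using 1 2 by (simp add: Z_def t)
  qed
  have finR: "finite R" "card R \<le> T" using T by (auto simp: R_def)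
  have finU: "finite U" unfolding U_def using finR Z by (intro finite_UN_I finite_imageI) auto
  have "card U \<le> (\<Sum>i\<le>j. card (\<Union>t\<in>R. f t ` Z i t))"
    unfolding U_def by (rule card_UN_le) simp
  also have "\<dots> \<le> (\<Sum>i\<le>j. T * (fact j * D ^ j))"
  proof (rule sum_mono)
    fix i assume i: "i \<in> {..j}"
    have "card (\<Union>t\<in>R. f t ` Z i t) \<le> (\<Sum>t\<in>R. card (f t ` Z i t))"
      by (rule card_UN_le) (rule finR)
    also have "\<dots> \<le> (\<Sum>t\<in>R. fact j * D ^ j)"
      using i Z by (intro sum_mono order_trans[OF card_image_le]) auto
    also have "\<dots> \<le> T * (fact j * D ^ j)" using finR(2) by simp
    finally show "card (\<Union>t\<in>R. f t ` Z i t) \<le> T * (fact j * D ^ j)" .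
  qed
  also have "\<dots> = fact (Suc j) * T * D ^ j" by (simp add: algebra_simps)
  finally show "card {vs. length vs = j + 3 \<and> triangulated E vs} \<le> fact (Suc j) * T * D ^ j"
    using card_mono[OF finU sub] by linarith
  show "finite {vs. length vs = j + 3 \<and> triangulated E vs}" by (rule finite_subset[OF sub finU])
qed

section \<open>Emptiness in terms of orientations, and perturbation into general position\<close>

text \<open>\<open>in_triangle a b c d\<close>: the point \<open>d\<close> has positive barycentric coordinates in the
  nondegenerate triangle \<open>a b c\<close>.\<close>
definition in_triangle :: "complex \<Rightarrow> complex \<Rightarrow> complex \<Rightarrow> complex \<Rightarrow> bool" where
  "in_triangle a b c d \<longleftrightarrow> cross a b c * cross d b c > 0 \<and> cross a b c * cross a d c > 0 \<and>
     cross a b c * cross a b d > 0"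

lemma in_triangle_interior:
  assumes "in_triangle a b c d"
  shows "d \<in> interior (convex hull {a, b, c})"
proof -
  define t where "t = cross a b c"
  have t: "t \<noteq> 0" "t * cross d b c > 0" "t * cross a d c > 0" "t * cross a b d > 0"
    using assms by (auto simp: in_triangle_def t_def)
  then have pos: "cross d b c / t > 0" "cross a d c / t > 0" "cross a b d / t > 0"
    by (auto simp: zero_less_mult_iff zero_less_divide_iff)
  have sum: "cross d b c + cross a d c + cross a b d = t"
    by (simp add: cross_def t_def algebra_simps)
  have "t *\<^sub>R d = cross d b c *\<^sub>R a + cross a d c *\<^sub>R b + cross a b d *\<^sub>R c"
    by (simp add: cross_def t_def complex_eq_iff algebra_simps)
  then have "(1 / t) *\<^sub>R (t *\<^sub>R d) = (1 / t) *\<^sub>R (cross d b c *\<^sub>R a + cross a d c *\<^sub>R b + cross a b d *\<^sub>R c)"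
    by simp
  then have d: "(cross d b c / t) *\<^sub>R a + (cross a d c / t) *\<^sub>R b + (cross a b d / t) *\<^sub>R c = d"
    using t(1) by (simp add: scaleR_add_right)
  have "cross d b c / t + cross a d c / t + cross a b d / t = 1"
    using sum t(1) by (simp add: add_divide_distrib[symmetric])
  moreover have "\<not> collinear {a, b, c}" using t by (simp add: collinear_iff_cross t_def)
  ultimately show ?thesis
    using interior_convex_hull_3_minimal[of a b c] pos d by auto
qed

text \<open>The points are moved along the vectors \<open>(x, x\<^sup>2)\<close> with distinct \<open>x\<close>: the orientation of a triple
  is then a polynomial in the step \<open>e\<close> whose leading coefficient is a Vandermonde determinant.\<close>
lemma perturbation:
  assumes fin: "finite (Q :: complex set)"
  obtains p where "inj_on p Q" "general_position (p ` Q)"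
    "\<And>a b c d. {a, b, c, d} \<subseteq> Q \<Longrightarrow> in_triangle a b c d \<Longrightarrow> in_triangle (p a) (p b) (p c) (p d)"
proof -
  obtain idx :: "complex \<Rightarrow> nat" where idx: "inj_on idx Q"
    using finite_imp_inj_to_nat_seg[OF fin] by blast
  define x where "x z = real (idx z)" for z
  have xneq: "x a \<noteq> x b" if "a \<in> Q" "b \<in> Q" "a \<noteq> b" for a b
    using that idx by (auto simp: x_def inj_on_def)
  define p where "p e z = z + e *\<^sub>R Complex (x z) ((x z)\<^sup>2)" for e :: real and z
  have lim: "((\<lambda>e. cross (p e a) (p e b) (p e c)) \<longlongrightarrow> cross a b c) (at_right 0)" for a b c
  proof -
    have "((\<lambda>e. cross (p e a) (p e b) (p e c)) \<longlongrightarrow> cross (p 0 a) (p 0 b) (p 0 c)) (at_right 0)"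
      unfolding cross_def p_def by (intro tendsto_intros)
    then show ?thesis by (simp add: p_def)
  qed
  have 1: "eventually (\<lambda>e. p e a \<noteq> p e b) (at_right 0)" if "a \<in> Q" "b \<in> Q" "a \<noteq> b" for a b
  proof -
    have "eventually (\<lambda>e. e \<noteq> (Re b - Re a) / (x a - x b)) (at_right 0)"
      by (rule eventually_neq_at_within)
    then show ?thesis
    proof eventually_elim
      case (elim e)
      show ?case
      proof
        assume "p e a = p e b"
        then have "Re (p e a) = Re (p e b)" by simp
        then have "e * (x a - x b) = Re b - Re a" by (simp add: p_def algebra_simps)
        then show False using elim xneq[OF that] by (simp add: field_simps)
      qed
    qed
  qed
  have 2: "eventually (\<lambda>e. cross (p e a) (p e b) (p e c) \<noteq> 0) (at_right 0)"
    if "{a, b, c} \<subseteq> Q" "a \<noteq> b" "b \<noteq> c" "a \<noteq> c" for a b c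
  proof -
    define k2 where "k2 = (x b - x a) * ((x c)\<^sup>2 - (x a)\<^sup>2) - ((x b)\<^sup>2 - (x a)\<^sup>2) * (x c - x a)"
    define k1 where "k1 = (Re b - Re a) * ((x c)\<^sup>2 - (x a)\<^sup>2) + (x b - x a) * (Im c - Im a)
      - (Im b - Im a) * (x c - x a) - ((x b)\<^sup>2 - (x a)\<^sup>2) * (Re c - Re a)"
    have "k2 = (x b - x a) * (x c - x a) * (x c - x b)"
      by (simp add: k2_def power2_eq_square algebra_simps)
    then have k2: "k2 \<noteq> 0" using xneq that by auto
    have cr: "cross (p e a) (p e b) (p e c) = poly [:cross a b c, k1, k2:] e" for e
      by (simp add: cross_def p_def k1_def k2_def algebra_simps)
    have "finite {e. poly [:cross a b c, k1, k2:] e = 0}"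
      using k2 by (intro poly_roots_finite) auto
    then have "eventually (\<lambda>e. \<forall>r\<in>{e. poly [:cross a b c, k1, k2:] e = 0}. e \<noteq> r) (at_right 0)"
      by (intro eventually_ball_finite ballI eventually_neq_at_within)
    then show ?thesis by eventually_elim (auto simp: cr)
  qed
  \<comment> \<open>Strict inequalities between functions continuous in \<open>e\<close> persist
    near 0. Degenerate triples are not protected: the move may turn them into empty triangles, so
    they have to be counted beforehand.\<close>
  have 3: "eventually (\<lambda>e. in_triangle (p e a) (p e b) (p e c) (p e d)) (at_right 0)"
    if "in_triangle a b c d" for a b c d
    using that unfolding in_triangle_def
    by (intro eventually_conj order_tendstoD(1)[OF tendsto_mult[OF lim lim]]) auto
  have "eventually (\<lambda>e. \<forall>a\<in>Q. \<forall>b\<in>Q. a \<noteq> b \<longrightarrow> p e a \<noteq> p e b) (at_right 0)"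
  proof -
    have "eventually (\<lambda>e. a \<noteq> b \<longrightarrow> p e a \<noteq> p e b) (at_right 0)" if "a \<in> Q" "b \<in> Q" for a b
      using 1[OF that] by (cases "a = b") auto
    then show ?thesis using fin by (intro eventually_ball_finite ballI)
  qed
  moreover have "eventually (\<lambda>e. \<forall>a\<in>Q. \<forall>b\<in>Q. \<forall>c\<in>Q. a \<noteq> b \<and> b \<noteq> c \<and> a \<noteq> c \<longrightarrow>
      cross (p e a) (p e b) (p e c) \<noteq> 0) (at_right 0)"
  proof -
    have "eventually (\<lambda>e. a \<noteq> b \<and> b \<noteq> c \<and> a \<noteq> c \<longrightarrow> cross (p e a) (p e b) (p e c) \<noteq> 0) (at_right 0)"
      if "a \<in> Q" "b \<in> Q" "c \<in> Q" for a b c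
      using 2[of a b c] that by (cases "a \<noteq> b \<and> b \<noteq> c \<and> a \<noteq> c") auto
    then show ?thesis using fin by (intro eventually_ball_finite ballI)
  qed
  moreover have "eventually (\<lambda>e. \<forall>a\<in>Q. \<forall>b\<in>Q. \<forall>c\<in>Q. \<forall>d\<in>Q. in_triangle a b c d \<longrightarrow>
      in_triangle (p e a) (p e b) (p e c) (p e d)) (at_right 0)"
  proof -
    have "eventually (\<lambda>e. in_triangle a b c d \<longrightarrow> in_triangle (p e a) (p e b) (p e c) (p e d)) (at_right 0)"
      for a b c d
      using 3[of a b c d] by (cases "in_triangle a b c d") auto
    then show ?thesis using fin by (intro eventually_ball_finite ballI)
  qed
  ultimately have "eventually (\<lambda>e. (\<forall>a\<in>Q. \<forall>b\<in>Q. a \<noteq> b \<longrightarrow> p e a \<noteq> p e b) \<and>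
      (\<forall>a\<in>Q. \<forall>b\<in>Q. \<forall>c\<in>Q. a \<noteq> b \<and> b \<noteq> c \<and> a \<noteq> c \<longrightarrow> cross (p e a) (p e b) (p e c) \<noteq> 0) \<and>
      (\<forall>a\<in>Q. \<forall>b\<in>Q. \<forall>c\<in>Q. \<forall>d\<in>Q. in_triangle a b c d \<longrightarrow>
        in_triangle (p e a) (p e b) (p e c) (p e d))) (at_right (0::real))"
    by (intro eventually_conj)
  from eventually_happens'[OF trivial_limit_at_right_real this]
  obtain e where "(\<forall>a\<in>Q. \<forall>b\<in>Q. a \<noteq> b \<longrightarrow> p e a \<noteq> p e b) \<and>
      (\<forall>a\<in>Q. \<forall>b\<in>Q. \<forall>c\<in>Q. a \<noteq> b \<and> b \<noteq> c \<and> a \<noteq> c \<longrightarrow> cross (p e a) (p e b) (p e c) \<noteq> 0) \<and>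
      (\<forall>a\<in>Q. \<forall>b\<in>Q. \<forall>c\<in>Q. \<forall>d\<in>Q. in_triangle a b c d \<longrightarrow>
        in_triangle (p e a) (p e b) (p e c) (p e d))" ..
  then have e: "\<And>a b. a \<in> Q \<Longrightarrow> b \<in> Q \<Longrightarrow> a \<noteq> b \<Longrightarrow> p e a \<noteq> p e b"
    "\<And>a b c. a \<in> Q \<Longrightarrow> b \<in> Q \<Longrightarrow> c \<in> Q \<Longrightarrow> a \<noteq> b \<and> b \<noteq> c \<and> a \<noteq> c \<Longrightarrow> cross (p e a) (p e b) (p e c) \<noteq> 0"
    "\<And>a b c d. a \<in> Q \<Longrightarrow> b \<in> Q \<Longrightarrow> c \<in> Q \<Longrightarrow> d \<in> Q \<Longrightarrow> in_triangle a b c d \<Longrightarrow>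
      in_triangle (p e a) (p e b) (p e c) (p e d)"
    by simp_all
  show ?thesis
  proof (rule that[of "p e"])
    show "inj_on (p e) Q" using e(1) by (auto simp: inj_on_def)
    show "general_position (p e ` Q)"
      unfolding general_position_def
    proof clarify
      fix A assume A: "A \<subseteq> p e ` Q" "card A = 3" "collinear A"
      then obtain u v w where uvw: "A = {u, v, w}" "u \<noteq> v" "v \<noteq> w" "u \<noteq> w"
        by (auto simp: card_3_iff)
      then obtain a b c where "a \<in> Q" "b \<in> Q" "c \<in> Q" "u = p e a" "v = p e b" "w = p e c"
        using A(1) by auto
      then show False using e(2)[of a b c] A(3) uvw by (auto simp: collinear_iff_cross)
    qed
  qed (use e(3) in auto)
qed

section \<open>Randomly shifted columns\<close>

lemma barycentric_in_triangle:
  assumes "A > 0" "B > 0" "A + B < 1" "cross a b r \<noteq> 0"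
  shows "in_triangle a b r (r + A *\<^sub>R (a - r) + B *\<^sub>R (b - r))"
proof -
  define d where "d = r + A *\<^sub>R (a - r) + B *\<^sub>R (b - r)"
  have "cross d b r = A * cross a b r" "cross a d r = B * cross a b r"
    "cross a b d = (1 - A - B) * cross a b r"
    by (simp_all add: cross_def d_def algebra_simps)
  moreover have "cross a b r * (t * cross a b r) > 0" if "t > 0" for t
  proof -
    have "cross a b r * (t * cross a b r) = t * (cross a b r * cross a b r)" by simp
    also have "\<dots> > 0" using that assms(4) by (simp add: zero_less_mult_iff) linarith
    finally show ?thesis .
  qed
  ultimately show ?thesis using assms unfolding in_triangle_def d_def[symmetric] by simp
qed

lemma strictly_between_convex:
  fixes y p q :: real
  assumes "min p q < y" "y < max p q"
  obtains s where "0 < s" "s < 1" "y = (1 - s) * p + s * q"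
proof -
  define s where "s = (y - p) / (q - p)"
  have "p \<noteq> q" using assms by auto
  then have "s * (q - p) = y - p" by (simp add: s_def)
  then have "y = (1 - s) * p + s * q" by (simp add: algebra_simps)
  moreover have "0 < s" "s < 1"
    using assms by (auto simp: s_def field_simps min_def max_def split: if_splits)
  ultimately show ?thesis using that by blast
qed

lemma min_add_abs_diff: "min x y + \<bar>x - y\<bar> = max x (y :: real)"
  by auto

definition pt :: "int \<times> int \<Rightarrow> complex" where
  "pt P = Complex (of_int (fst P)) (of_int (snd P))"

text \<open>Twice the area. Once heights are scaled by \<open>m\<close>, one point occupies area
  \<open>m\<close>, which is why later area bounds have the form \<open>m * K\<close>.\<close>

definition area2 :: "int \<times> int \<Rightarrow> int \<times> int \<Rightarrow> int \<times> int \<Rightarrow> real" where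
  "area2 a b c = \<bar>cross (pt a) (pt b) (pt c)\<bar>"

definition ratio :: "int \<times> int \<Rightarrow> int \<times> int \<Rightarrow> int \<Rightarrow> real" where
  "ratio r a i = of_int (i - fst r) / of_int (fst a - fst r)"

definition line_at :: "int \<times> int \<Rightarrow> int \<times> int \<Rightarrow> int \<Rightarrow> real" where
  "line_at r a i = of_int (snd r) + ratio r a i * of_int (snd a - snd r)"

text \<open>The length of the vertical section at \<open>b\<close> of the triangle, if \<open>b\<close> lies between \<open>a\<close> and \<open>r\<close>
  horizontally.\<close>
definition gap_height :: "int \<times> int \<Rightarrow> int \<times> int \<Rightarrow> int \<times> int \<Rightarrow> real" where
  "gap_height a b r = area2 a b r / \<bar>of_int (fst a - fst r)\<bar>"

text \<open>The two sides through \<open>r\<close> diverge linearly: the section at column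
  \<open>i\<close> is the section at \<open>b\<close>, scaled by the relative distance from
  \<open>r\<close>.\<close>

lemma line_at_diff:
  assumes "fst a \<noteq> fst r" "fst b \<noteq> fst r" "ratio r b i > 0"
  shows "\<bar>line_at r b i - line_at r a i\<bar> = ratio r b i * gap_height a b r"
proof -
  define A where "A = real_of_int (fst a - fst r)"
  define B where "B = real_of_int (fst b - fst r)"
  define ya where "ya = real_of_int (snd a - snd r)"
  define yb where "yb = real_of_int (snd b - snd r)"
  define l where "l = ratio r b i"
  have nz: "A \<noteq> 0" "B \<noteq> 0" using assms by (auto simp: A_def B_def)
  have i: "real_of_int (i - fst r) = l * B" using nz by (simp add: l_def ratio_def B_def)
  then have ra: "ratio r a i = l * B / A" unfolding ratio_def A_def by simp
  have cr: "cross (pt a) (pt b) (pt r) = - (B * ya - A * yb)"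
    by (simp add: cross_def pt_def A_def B_def ya_def yb_def algebra_simps)
  have "line_at r b i - line_at r a i = l * yb - l * B / A * ya"
    unfolding line_at_def ra l_def[symmetric] by (simp add: ya_def yb_def)
  also have "\<dots> = l * (A * yb - B * ya) / A" using nz by (simp add: field_simps)
  also have "\<bar>\<dots>\<bar> = l * (\<bar>A * yb - B * ya\<bar> / \<bar>A\<bar>)" using assms(3) by (simp add: l_def abs_mult)
  also have "\<dots> = l * gap_height a b r"
    unfolding gap_height_def area2_def cr unfolding A_def[symmetric] by simp
  finally show ?thesis by (simp add: l_def)
qed

lemma fiber_in_triangle:
  assumes ar: "fst a \<noteq> fst r" "fst b \<noteq> fst r"
    and l: "0 < ratio r b i" "ratio r b i \<le> 1" and m: "0 < ratio r a i" "ratio r a i < 1"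
    and y: "min (line_at r b i) (line_at r a i) < of_int y"
      "of_int y < min (line_at r b i) (line_at r a i) + ratio r b i * gap_height a b r"
  shows "in_triangle (pt a) (pt b) (pt r) (pt (i, y))"
proof -
  have "min (line_at r b i) (line_at r a i) + ratio r b i * gap_height a b r
      = max (line_at r b i) (line_at r a i)"
    unfolding line_at_diff[OF ar l(1), symmetric] by (rule min_add_abs_diff)
  then obtain s where s: "0 < s" "s < 1" "of_int y = (1 - s) * line_at r b i + s * line_at r a i"
    using strictly_between_convex y by metis
  define l where "l = ratio r b i"
  define u where "u = ratio r a i"
  have ix: "of_int (i - fst r) = l * of_int (fst b - fst r)" "of_int (i - fst r) = u * of_int (fst a - fst r)"
    using ar by (auto simp: l_def u_def ratio_def)
  have "gap_height a b r \<noteq> 0" using y l by auto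
  then have "cross (pt a) (pt b) (pt r) \<noteq> 0" by (auto simp: gap_height_def area2_def)
  moreover have "s * u > 0" "(1 - s) * l > 0" using s l m by (auto simp: l_def u_def)
  moreover have "s * u + (1 - s) * l < 1"
  proof -
    have "s * u < s * 1" using s m by (simp add: u_def)
    moreover have "(1 - s) * l \<le> (1 - s) * 1" using s l by (intro mult_left_mono) (auto simp: l_def)
    ultimately show ?thesis by simp
  qed
  ultimately have "in_triangle (pt a) (pt b) (pt r)
      (pt r + (s * u) *\<^sub>R (pt a - pt r) + ((1 - s) * l) *\<^sub>R (pt b - pt r))"
    by (intro barycentric_in_triangle)
  moreover have "pt r + (s * u) *\<^sub>R (pt a - pt r) + ((1 - s) * l) *\<^sub>R (pt b - pt r) = pt (i, y)"
  proof -
    have "of_int (fst r) + (s * u) * of_int (fst a - fst r) + ((1 - s) * l) * of_int (fst b - fst r)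
      = of_int (fst r) + s * (u * of_int (fst a - fst r)) + (1 - s) * (l * of_int (fst b - fst r))"
      by (simp add: mult.assoc)
    also have "\<dots> = (of_int i :: real)" unfolding ix[symmetric] by (simp add: algebra_simps)
    finally have x: "of_int (fst r) + (s * u) * of_int (fst a - fst r) + ((1 - s) * l) * of_int (fst b - fst r)
      = (of_int i :: real)" .
    have yy: "of_int y = of_int (snd r) + (s * u) * of_int (snd a - snd r) + ((1 - s) * l) * of_int (snd b - snd r)"
      unfolding s(3) line_at_def l_def[symmetric] u_def[symmetric] by (simp add: algebra_simps)
    show ?thesis using x yy by (simp add: pt_def complex_eq_iff)
  qed
  ultimately show ?thesis by simp
qed

text \<open>An open interval of length \<open>g\<close> contains at least \<open>g - 1\<close>
  consecutive integers, and up to \<open>m\<close> of these have distinct residues. At most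
  \<open>m - (g - 1)\<close> residues are therefore missed unless all are hit, and
  \<open>1 + x \<le> exp x\<close> gives the exponential form, which multiplies well over
  columns.\<close>

lemma card_missed_residues:
  fixes u g :: real
  assumes "m > 0"
  shows "real (card {t \<in> {0..<int m}. \<forall>y::int. y mod int m = t \<longrightarrow> \<not> (u < y \<and> y < u + g)})
    \<le> m * exp (- (g - 1) / m)"
proof -
  define B where "B = {t \<in> {0..<int m}. \<forall>y::int. y mod int m = t \<longrightarrow> \<not> (u < y \<and> y < u + g)}"
  define k where "k = min (nat \<lceil>g - 1\<rceil>) m"
  define y0 where "y0 = \<lfloor>u\<rfloor> + 1"
  define H where "H = (\<lambda>j. (y0 + int j) mod int m) ` {..<k}"
  have inj: "inj_on (\<lambda>j. (y0 + int j) mod int m) {..<k}"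
  proof (rule inj_onI)
    fix j j' assume jj: "j \<in> {..<k}" "j' \<in> {..<k}" "(y0 + int j) mod int m = (y0 + int j') mod int m"
    then have "int m dvd (int j - int j')" by (auto simp: mod_eq_dvd_iff)
    moreover have "\<bar>int j - int j'\<bar> < int m" using jj(1,2) by (auto simp: k_def)
    ultimately have "int j - int j' = 0"
      using dvd_imp_le_int[of "int j - int j'" "int m"] by (metis abs_of_nat linorder_not_less)
    then show "j = j'" by simp
  qed
  have cH: "card H = k" unfolding H_def using card_image[OF inj] by simp
  have HI: "H \<subseteq> {0..<int m}" unfolding H_def using assms by auto
  have "B \<subseteq> {0..<int m} - H"
  proof
    fix t assume t: "t \<in> B"
    have "t \<notin> H"
    proof
      assume "t \<in> H"
      then obtain j where j: "j < k" "t = (y0 + int j) mod int m" by (auto simp: H_def)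
      have "u < real_of_int (y0 + int j)" unfolding y0_def by linarith
      moreover have "real_of_int (y0 + int j) < u + g"
      proof -
        have "int j < \<lceil>g - 1\<rceil>" using j(1) by (auto simp: k_def)
        then have "real j < g - 1" by linarith
        moreover have "real_of_int y0 \<le> u + 1" unfolding y0_def by linarith
        ultimately show ?thesis by simp
      qed
      ultimately show False using t j(2) by (auto simp: B_def)
    qed
    then show "t \<in> {0..<int m} - H" using t by (auto simp: B_def)
  qed
  then have "card B \<le> card ({0..<int m} - H)" by (intro card_mono) auto
  also have "\<dots> = m - k" using HI cH by (subst card_Diff_subset) (auto simp: finite_subset)
  finally have cB: "card B \<le> m - k" .
  have "real (card B) \<le> m * exp (- (g - 1) / m)"
  proof (cases "k = m")
    case True
    then show ?thesis using cB by simp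
  next
    case False
    then have "g - 1 \<le> real k" "k \<le> m" by (auto simp: k_def min_def split: if_splits) linarith+
    then have "real (card B) \<le> m - (g - 1)" using cB by linarith
    also have "\<dots> = m * (1 + (- (g - 1) / m))" using assms by (simp add: field_simps)
    also have "\<dots> \<le> m * exp (- (g - 1) / m)" by (intro mult_left_mono exp_ge_add_one_self) auto
    finally show ?thesis .
  qed
  then show ?thesis by (simp add: B_def)
qed

section \<open>The number of shifts that leave a triangle vacant\<close>

text \<open>Heights are scaled by \<open>m\<close>, so that consecutive points of a column have distance \<open>m\<close> and the
  shifts \<open>w\<close> of the columns take integer values.\<close>
definition board :: "nat \<Rightarrow> (int \<times> int) set" where
  "board m = {0..<int m} \<times> {0..<int m * int m}"

definition shifts :: "nat \<Rightarrow> (int \<Rightarrow> int) set" where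
  "shifts m = PiE {0..<int m} (\<lambda>_. {0..<int m})"

text \<open>Selecting a residue class in a height range of length \<open>m * m\<close>, instead of
  translating the column, keeps exactly \<open>m\<close> points per column for every shift.\<close>

definition config :: "nat \<Rightarrow> (int \<Rightarrow> int) \<Rightarrow> (int \<times> int) set" where
  "config m w = {P \<in> board m. snd P mod int m = w (fst P)}"

text \<open>Degenerate triples are always vacant, as \<open>in_triangle\<close> fails for them. This
  is intended, since a collinear triple may become an empty triangle after the perturbation.\<close>

definition vacant :: "nat \<Rightarrow> (int \<Rightarrow> int) \<Rightarrow> int \<times> int \<Rightarrow> int \<times> int \<Rightarrow> int \<times> int \<Rightarrow> bool" where
  "vacant m w a b c \<longleftrightarrow> {a, b, c} \<subseteq> config m w \<and>
     (\<forall>d\<in>config m w. \<not> in_triangle (pt a) (pt b) (pt c) (pt d))"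

text \<open>The longer of the two parts into which \<open>b\<close> divides the horizontal range of the triangle is
  on the side of \<open>r\<close>; only the columns of that part are used to bound probabilities.\<close>
definition wide :: "int \<times> int \<Rightarrow> int \<times> int \<Rightarrow> int \<times> int \<Rightarrow> bool" where
  "wide a b r \<longleftrightarrow> (fst a \<le> fst b \<and> fst b < fst r \<or> fst r < fst b \<and> fst b \<le> fst a) \<and>
     \<bar>fst a - fst r\<bar> \<le> 2 * \<bar>fst b - fst r\<bar> \<and> 2 \<le> \<bar>fst a - fst r\<bar>"

lemma wide_ne: "wide a b r \<Longrightarrow> fst a \<noteq> fst r" "wide a b r \<Longrightarrow> fst b \<noteq> fst r"
  by (auto simp: wide_def)

text \<open>This ensures that an integer height between the two sides, with the right residue, is a
  point of the configuration and not one cut off by the border.\<close>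

lemma line_at_in_range:
  assumes "a \<in> board m" "r \<in> board m" "0 \<le> ratio r a i" "ratio r a i \<le> 1"
  shows "0 \<le> line_at r a i" "line_at r a i \<le> real m * real m - 1"
proof -
  define l where "l = ratio r a i"
  have eq: "line_at r a i = (1 - l) * of_int (snd r) + l * of_int (snd a)"
    by (simp add: line_at_def l_def algebra_simps)
  have l: "0 \<le> l" "l \<le> 1" using assms by (auto simp: l_def)
  have le: "real_of_int (snd P) \<le> real m * real m - 1" if "P \<in> board m" for P
  proof -
    have "snd P \<le> int m * int m - 1" using that by (auto simp: board_def)
    then have "real_of_int (snd P) \<le> real_of_int (int m * int m - 1)" by (simp only: of_int_le_iff)
    then show ?thesis by simp
  qed
  have ge: "real_of_int (snd P) \<ge> 0" if "P \<in> board m" for P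
    using that by (auto simp: board_def)
  show "0 \<le> line_at r a i" unfolding eq using l ge assms by simp
  show "line_at r a i \<le> real m * real m - 1" unfolding eq
    by (rule convex_bound_le) (use l le assms in auto)
qed

lemma vacant_column:
  assumes v: "vacant m w a b r" and ne: "fst a \<noteq> fst r" "fst b \<noteq> fst r"
    and l: "0 < ratio r b i" "ratio r b i \<le> 1" and u: "0 < ratio r a i" "ratio r a i < 1"
    and i: "i \<in> {0..<int m}" and y: "y mod int m = w i"
  shows "\<not> (min (line_at r b i) (line_at r a i) < of_int y \<and>
      of_int y < min (line_at r b i) (line_at r a i) + ratio r b i * gap_height a b r)"
proof
  assume *: "min (line_at r b i) (line_at r a i) < of_int y \<and>
      of_int y < min (line_at r b i) (line_at r a i) + ratio r b i * gap_height a b r"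
  then have inT: "in_triangle (pt a) (pt b) (pt r) (pt (i, y))"
    using fiber_in_triangle[OF ne l u] by blast
  have box: "a \<in> board m" "b \<in> board m" "r \<in> board m" using v by (auto simp: vacant_def config_def)
  have "min (line_at r b i) (line_at r a i) + ratio r b i * gap_height a b r
      = max (line_at r b i) (line_at r a i)"
    unfolding line_at_diff[OF ne l(1), symmetric] by (rule min_add_abs_diff)
  then have "0 < real_of_int y" "real_of_int y < real m * real m"
    using * line_at_in_range[of a m r i] line_at_in_range[of b m r i] box l u
    by (auto simp: min_def max_def split: if_splits)
  then have "0 \<le> y" "y < int m * int m"
    by (simp, metis of_int_less_iff of_int_mult of_int_of_nat_eq)
  then have "(i, y) \<in> config m w" using i y by (auto simp: config_def board_def)
  then show False using v inT by (auto simp: vacant_def)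
qed

definition vacant_shifts :: "nat \<Rightarrow> int \<times> int \<Rightarrow> int \<times> int \<Rightarrow> int \<times> int \<Rightarrow> (int \<Rightarrow> int) set" where
  "vacant_shifts m a b r = {w \<in> shifts m. vacant m w a b r}"

text \<open>The reflection \<open>i \<mapsto> fst b + fst r - i\<close> exchanges a ratio
  \<open>x\<close> with \<open>1 - x\<close>, so the average ratio is one half.\<close>

lemma sum_ratio:
  assumes "fst b \<noteq> fst r"
  shows "(\<Sum>i\<in>{min (fst b) (fst r)<..<max (fst b) (fst r)}. ratio r b i) = (real_of_int \<bar>fst b - fst r\<bar> - 1) / 2"
    "real (card {min (fst b) (fst r)<..<max (fst b) (fst r)}) = real_of_int \<bar>fst b - fst r\<bar> - 1"
proof -
  define K where "K = {min (fst b) (fst r)<..<max (fst b) (fst r)}"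
  have "card K = nat (\<bar>fst b - fst r\<bar> - 1)" by (auto simp: K_def min_def max_def)
  then show card: "real (card {min (fst b) (fst r)<..<max (fst b) (fst r)}) = real_of_int \<bar>fst b - fst r\<bar> - 1"
    using assms unfolding K_def by (simp add: of_nat_nat)
  have "(\<Sum>i\<in>K. ratio r b i) = (\<Sum>i\<in>K. ratio r b (fst b + fst r - i))"
    by (rule sum.reindex_bij_witness[of _ "\<lambda>i. fst b + fst r - i" "\<lambda>i. fst b + fst r - i"])
      (auto simp: K_def min_def max_def)
  also have "\<dots> = (\<Sum>i\<in>K. 1 - ratio r b i)"
    using assms by (intro sum.cong refl) (simp add: ratio_def field_simps)
  also have "\<dots> = real (card K) - (\<Sum>i\<in>K. ratio r b i)" by (simp add: sum_subtractf)
  finally show "(\<Sum>i\<in>{min (fst b) (fst r)<..<max (fst b) (fst r)}. ratio r b i) = (real_of_int \<bar>fst b - fst r\<bar> - 1) / 2"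
    using card unfolding K_def[symmetric] by (simp only: eq_divide_eq_numeral1) simp
qed

lemma ratio_between:
  assumes "wide a b r" "i \<in> {min (fst b) (fst r)<..<max (fst b) (fst r)}"
  shows "0 < ratio r b i" "ratio r b i \<le> 1" "0 < ratio r a i" "ratio r a i < 1"
  using assms unfolding wide_def ratio_def
  by (auto simp: min_def max_def zero_less_divide_iff divide_less_eq divide_le_eq split: if_splits)

text \<open>Independence of the columns becomes a product of sets of admissible residues. The
  columns \<open>J\<close> of the vertices have a single admissible residue, the columns
  \<open>K\<close> strictly between \<open>b\<close> and \<open>r\<close> must miss their section of
  the triangle, and the other columns are free.\<close>

lemma card_vacant_shifts_aux:
  assumes m: "m > 0" and box: "a \<in> board m" "b \<in> board m" "r \<in> board m" and wd: "wide a b r"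
  shows "real (card (vacant_shifts m a b r)) \<le> real m ^ (m - card {fst a, fst b, fst r}) *
    exp (1 - gap_height a b r * (real_of_int \<bar>fst b - fst r\<bar> - 1) / (2 * m))"
proof -
  define I where "I = {0..<int m}"
  define J where "J = {fst a, fst b, fst r}"
  define K where "K = {min (fst b) (fst r)<..<max (fst b) (fst r)}"
  define L where "L = gap_height a b r"
  define low where "low i = min (line_at r b i) (line_at r a i)" for i
  define g where "g i = ratio r b i * L" for i
  define res where "res i = (if i = fst a then snd a mod int m else if i = fst b then snd b mod int m
      else snd r mod int m)" for i
  define B where "B i = {t \<in> I. \<forall>y::int. y mod int m = t \<longrightarrow> \<not> (low i < y \<and> y < low i + g i)}" for i
  define F where "F i = (if i \<in> J then {res i} else if i \<in> K then B i else I)" for i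
  note ne = wide_ne[OF wd]
  have JI: "J \<subseteq> I" using box by (auto simp: J_def I_def board_def)
  have KI: "K \<subseteq> I" using box by (auto simp: K_def I_def board_def)
  have "vacant_shifts m a b r \<subseteq> PiE I F"
  proof
    fix w assume "w \<in> vacant_shifts m a b r"
    then have w: "w \<in> PiE I (\<lambda>_. I)" "vacant m w a b r"
      by (auto simp: vacant_shifts_def shifts_def I_def)
    then have wJ: "w (fst a) = snd a mod int m" "w (fst b) = snd b mod int m" "w (fst r) = snd r mod int m"
      by (auto simp: vacant_def config_def)
    have "w i \<in> F i" if "i \<in> I" for i
    proof -
      have wi: "w i \<in> I" using w(1) that by blast
      have "w i \<in> B i" if "i \<in> K"
        using vacant_column[OF w(2) ne ratio_between[OF wd that[unfolded K_def]]] wi \<open>i \<in> I\<close>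
        unfolding B_def low_def g_def L_def I_def by blast
      then show ?thesis using wJ wi by (auto simp: F_def J_def res_def)
    qed
    then show "w \<in> PiE I F" using w(1) by (auto simp: PiE_def)
  qed
  moreover have "finite (PiE I F)"
  proof (intro finite_PiE)
    show "finite (F i)" for i
      by (rule finite_subset[of _ "insert (res i) I"]) (auto simp: F_def B_def I_def)
  qed (simp add: I_def)
  ultimately have "card (vacant_shifts m a b r) \<le> card (PiE I F)" by (rule card_mono[rotated])
  also have "\<dots> = (\<Prod>i\<in>I. card (F i))" by (rule card_PiE) (simp add: I_def)
  finally have "real (card (vacant_shifts m a b r)) \<le> (\<Prod>i\<in>I. real (card (F i)))"
    by (metis of_nat_le_iff of_nat_prod)
  also have "\<dots> \<le> (\<Prod>i\<in>I. (if i \<in> J then 1 else real m) * (if i \<in> K then exp (- (g i - 1) / m) else 1))"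
  proof (intro prod_mono conjI)
    fix i assume "i \<in> I"
    have JK: "i \<notin> K" if "i \<in> J" using that wd by (auto simp: J_def K_def wide_def)
    have "real (card (B i)) \<le> m * exp (- (g i - 1) / m)"
      unfolding B_def I_def by (rule card_missed_residues[OF m])
    then show "real (card (F i)) \<le> (if i \<in> J then 1 else real m) * (if i \<in> K then exp (- (g i - 1) / m) else 1)"
      using JK by (auto simp: F_def I_def)
  qed simp
  also have "\<dots> = (\<Prod>i\<in>I. if i \<in> J then 1 else real m) * (\<Prod>i\<in>I. if i \<in> K then exp (- (g i - 1) / m) else 1)"
    by (rule prod.distrib)
  also have "(\<Prod>i\<in>I. if i \<in> J then 1 else real m) = real m ^ (m - card J)"
  proof -
    have "I \<inter> - {i. i \<in> J} = I - J" by auto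
    then have "(\<Prod>i\<in>I. if i \<in> J then 1 else real m) = real m ^ card (I - J)"
      by (simp add: prod.If_cases I_def)
    also have "card (I - J) = m - card J"
      using card_Diff_subset[of J I] JI by (simp add: J_def I_def)
    finally show ?thesis .
  qed
  also have "(\<Prod>i\<in>I. if i \<in> K then exp (- (g i - 1) / m) else 1) = exp (\<Sum>i\<in>K. - (g i - 1) / m)"
  proof -
    have "I \<inter> {i. i \<in> K} = K" using KI by auto
    then have "(\<Prod>i\<in>I. if i \<in> K then exp (- (g i - 1) / m) else 1) = (\<Prod>i\<in>K. exp (- (g i - 1) / m))"
      by (simp add: prod.If_cases I_def)
    also have "\<dots> = exp (\<Sum>i\<in>K. - (g i - 1) / m)" by (rule exp_sum[symmetric]) (simp add: K_def)
    finally show ?thesis .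
  qed
  also have "(\<Sum>i\<in>K. - (g i - 1) / m) = (real (card K) - L * (\<Sum>i\<in>K. ratio r b i)) / m"
    by (simp add: g_def sum_divide_distrib[symmetric] sum_subtractf sum_distrib_left mult.commute)
  \<comment> \<open>Each of the at most \<open>m\<close> columns in \<open>K\<close> loses
    \<open>1 / m\<close> to rounding, which adds up to the summand 1.\<close>
  also have "\<dots> \<le> 1 - L * (real_of_int \<bar>fst b - fst r\<bar> - 1) / (2 * m)"
  proof -
    have "card K \<le> card I" using KI by (intro card_mono) (auto simp: I_def)
    then have "real (card K) / m \<le> 1" using m by (simp add: I_def)
    then have c: "real (card K) / m \<le> 1" .
    define X where "X = real_of_int \<bar>fst b - fst r\<bar> - 1"
    have S: "(\<Sum>i\<in>K. ratio r b i) = X / 2" using sum_ratio(1)[OF ne(2)] by (simp only: K_def X_def)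
    show ?thesis unfolding S X_def[symmetric] using c by (simp add: diff_divide_distrib)
  qed
  finally show ?thesis using m by (simp add: L_def J_def mult_left_mono)
qed

lemma gap_height_nonneg: "gap_height a b r \<ge> 0"
  by (simp add: gap_height_def area2_def)

lemma area2_gap:
  assumes "fst a \<noteq> fst r"
  shows "area2 a b r = gap_height a b r * real_of_int \<bar>fst a - fst r\<bar>"
proof -
  have "real_of_int \<bar>fst a - fst r\<bar> \<noteq> 0" using assms by simp
  then show ?thesis by (simp add: gap_height_def del: of_int_diff)
qed

lemma area2_line:
  assumes "fst a \<noteq> fst r"
  shows "area2 a b r = real_of_int \<bar>fst a - fst r\<bar> * \<bar>of_int (snd b) - line_at r a (fst b)\<bar>"
proof -
  define A where "A = real_of_int (fst a - fst r)"
  define B where "B = real_of_int (fst b - fst r)"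
  define ya where "ya = real_of_int (snd a - snd r)"
  define yb where "yb = real_of_int (snd b - snd r)"
  have nz: "A \<noteq> 0" using assms by (simp add: A_def)
  have cr: "cross (pt a) (pt b) (pt r) = A * yb - B * ya"
    by (simp add: cross_def pt_def A_def B_def ya_def yb_def algebra_simps)
  have "of_int (snd b) - line_at r a (fst b) = yb - B / A * ya"
    unfolding line_at_def ratio_def A_def[symmetric] B_def[symmetric] ya_def[symmetric]
    by (simp add: yb_def)
  also have "A * \<dots> = A * yb - B * ya" using nz by (simp add: algebra_simps)
  finally have "area2 a b r = \<bar>A * (of_int (snd b) - line_at r a (fst b))\<bar>"
    unfolding area2_def cr by simp
  then show ?thesis by (simp add: abs_mult A_def)
qed

text \<open>Otherwise the neighbour of \<open>b\<close> in its own column would lie in the triangle.\<close>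
lemma wide_small_gap:
  assumes v: "vacant m w a b r" and wd: "wide a b r" and ab: "fst a \<noteq> fst b" and m: "m > 0"
  shows "gap_height a b r \<le> m"
proof (rule ccontr)
  assume big: "\<not> ?thesis"
  note ne = wide_ne[OF wd]
  have rb: "ratio r b (fst b) = 1" using ne by (simp add: ratio_def)
  have ra: "0 < ratio r a (fst b)" "ratio r a (fst b) < 1"
    using wd ab unfolding wide_def ratio_def by (auto simp: zero_less_divide_iff divide_less_eq)
  have lb: "line_at r b (fst b) = of_int (snd b)" by (simp add: line_at_def rb)
  define z where "z = line_at r a (fst b)"
  have gap: "\<bar>of_int (snd b) - z\<bar> = gap_height a b r"
    using line_at_diff[OF ne, of "fst b"] by (simp add: rb lb z_def)
  have b: "fst b \<in> {0..<int m}" "w (fst b) = snd b mod int m"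
    using v by (auto simp: vacant_def config_def board_def)
  define y where "y = (if z < of_int (snd b) then snd b - int m else snd b + int m)"
  have "y mod int m = w (fst b)" unfolding b(2) y_def by simp
  moreover have "min (of_int (snd b)) z < real_of_int y"
    "real_of_int y < min (of_int (snd b)) z + gap_height a b r"
    using gap big m unfolding y_def by (auto simp: abs_if min_def split: if_splits)
  ultimately show False
    using vacant_column[OF v ne, of "fst b" y] rb ra b by (simp add: lb z_def)
qed

text \<open>Three columns are determined, hence \<open>m ^ 3\<close>. The range from
  \<open>b\<close> to \<open>r\<close> is at least half the width, which turns the exponent into a
  quarter of \<open>area2 / m\<close>. Its missing end column costs \<open>L / (2 * m)\<close>, at
  most one half by \<open>wide_small_gap\<close>.\<close>

lemma card_vacant_shifts_generic:
  assumes m: "m > 0" and box: "a \<in> board m" "b \<in> board m" "r \<in> board m" and wd: "wide a b r"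
    and ab: "fst a \<noteq> fst b"
  shows "real (card (vacant_shifts m a b r)) \<le> real m ^ m / real m ^ 3 * exp (2 - area2 a b r / (4 * m))"
proof (cases "vacant_shifts m a b r = {}")
  case False
  define L where "L = gap_height a b r"
  define W where "W = real_of_int \<bar>fst a - fst r\<bar>"
  define V where "V = real_of_int \<bar>fst b - fst r\<bar>"
  have L: "0 \<le> L" "L \<le> m"
    using False wide_small_gap[OF _ wd ab m] gap_height_nonneg by (auto simp: vacant_shifts_def L_def)
  have WV: "W \<le> 2 * V" using wd unfolding wide_def W_def V_def by linarith
  have "card {fst a, fst b, fst r} = 3" using ab wide_ne[OF wd] by (auto simp: card_insert_if)
  moreover have "3 \<le> m"
  proof -
    have "{fst a, fst b, fst r} \<subseteq> {0..<int m}" using box by (auto simp: board_def)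
    from card_mono[OF _ this] show ?thesis using \<open>card {fst a, fst b, fst r} = 3\<close> by simp
  qed
  ultimately have pow: "real m ^ (m - card {fst a, fst b, fst r}) = real m ^ m / real m ^ 3"
    using m by (simp add: power_diff)
  have "1 - L * (V - 1) / (2 * m) \<le> 2 - L * W / (4 * m)"
  proof -
    have "L * W \<le> L * (2 * V)" using WV L by (intro mult_left_mono) auto
    then have "L * W / (4 * m) \<le> L * (2 * V) / (4 * m)" by (intro divide_right_mono) auto
    moreover have "L / (2 * m) \<le> 1 / 2" using L m by (simp add: field_simps)
    moreover have "L * (V - 1) / (2 * m) = L * (2 * V) / (4 * m) - L / (2 * m)"
      using m by (simp add: field_simps)
    ultimately show ?thesis by simp
  qed
  then have "exp (1 - L * (V - 1) / (2 * m)) \<le> exp (2 - area2 a b r / (4 * m))"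
    using area2_gap[OF wide_ne(1)[OF wd]] by (simp add: L_def W_def)
  then show ?thesis
    using card_vacant_shifts_aux[OF m box wd] unfolding pow L_def[symmetric] V_def[symmetric]
    by (meson mult_left_mono order_trans divide_nonneg_nonneg of_nat_0_le_iff zero_le_power)
qed simp

text \<open>With \<open>a\<close> and \<open>b\<close> in one column the gap may be large, but now
  the full width \<open>W \<ge> 2\<close> is available and \<open>W - 1 \<ge> W / 2\<close>. Only
  two columns are determined; the factor \<open>m\<close> lost in this way is regained later because
  \<open>b\<close> is confined to the residue of \<open>a\<close>.\<close>

lemma card_vacant_shifts_same:
  assumes m: "m > 0" and box: "a \<in> board m" "b \<in> board m" "r \<in> board m" and wd: "wide a b r"
    and ab: "fst a = fst b"
  shows "real (card (vacant_shifts m a b r)) \<le>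
    (if snd b mod int m = snd a mod int m then real m ^ m / real m ^ 2 * exp (2 - area2 a b r / (4 * m)) else 0)"
proof (cases "snd b mod int m = snd a mod int m")
  case True
  define L where "L = gap_height a b r"
  define W where "W = real_of_int \<bar>fst a - fst r\<bar>"
  have L: "0 \<le> L" using gap_height_nonneg by (simp add: L_def)
  have W: "2 \<le> W" "W = real_of_int \<bar>fst b - fst r\<bar>"
    using wd ab unfolding wide_def W_def by linarith+
  have "card {fst a, fst b, fst r} = 2" using ab wide_ne[OF wd] by (auto simp: card_insert_if)
  moreover have "2 \<le> m"
  proof -
    have "{fst a, fst b, fst r} \<subseteq> {0..<int m}" using box by (auto simp: board_def)
    from card_mono[OF _ this] show ?thesis using \<open>card {fst a, fst b, fst r} = 2\<close> by simp
  qed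
  ultimately have pow: "real m ^ (m - card {fst a, fst b, fst r}) = real m ^ m / real m ^ 2"
    using m by (simp add: power_diff)
  have "1 - L * (W - 1) / (2 * m) \<le> 2 - L * W / (4 * m)"
  proof -
    have "L * (W / 2) \<le> L * (W - 1)" using W L by (intro mult_left_mono) auto
    then have "L * (W / 2) / (2 * m) \<le> L * (W - 1) / (2 * m)" by (intro divide_right_mono) auto
    moreover have "L * (W / 2) / (2 * m) = L * W / (4 * m)" by simp
    ultimately show ?thesis by simp
  qed
  then have "exp (1 - L * (W - 1) / (2 * m)) \<le> exp (2 - area2 a b r / (4 * m))"
    using area2_gap[OF wide_ne(1)[OF wd]] by (simp add: L_def W_def)
  then have "real (card (vacant_shifts m a b r)) \<le> real m ^ m / real m ^ 2 * exp (2 - area2 a b r / (4 * m))"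
    using card_vacant_shifts_aux[OF m box wd] unfolding pow L_def[symmetric] W(2)[symmetric]
    by (meson mult_left_mono order_trans divide_nonneg_nonneg of_nat_0_le_iff zero_le_power)
  then show ?thesis using True by simp
next
  case False
  then have "vacant_shifts m a b r = {}"
    using ab by (auto simp: vacant_shifts_def vacant_def config_def)
  then show ?thesis by simp
qed

section \<open>Exponential sums over arithmetic progressions\<close>

lemma geometric_exp_sum:
  fixes x :: real
  assumes "x > 0" "finite N"
  shows "(\<Sum>k\<in>N. exp (- x) ^ k) \<le> 1 + 1 / x"
proof -
  define q where "q = exp (- x)"
  have q: "0 \<le> q" "q < 1" using assms by (auto simp: q_def)
  have "(\<Sum>k\<in>N. q ^ k) \<le> (\<Sum>k. q ^ k)"
    using q assms by (intro sum_le_suminf summable_geometric) auto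
  also have "\<dots> = 1 / (1 - q)" using q by (intro suminf_geometric) auto
  also have "\<dots> \<le> 1 + 1 / x"
  proof -
    have "(1 + x) * q \<le> exp x * q" using q by (intro mult_right_mono exp_ge_add_one_self) auto
    also have "\<dots> = 1" by (simp add: q_def exp_minus)
    finally have "(1 + x) * (1 - q) \<ge> x" by (simp add: algebra_simps)
    then show ?thesis using q assms by (simp add: field_simps)
  qed
  finally show ?thesis by (simp add: q_def)
qed

text \<open>The members of a residue class modulo \<open>h\<close> are numbered by the blocks of
  length \<open>h\<close> above \<open>u\<close>: two of them in one block would differ by less than
  \<open>h\<close>.\<close>

lemma spaced_floor:
  fixes u :: real and h s :: int
  assumes res: "\<And>y. y \<in> Y \<Longrightarrow> y mod h = s" and lower: "\<And>y. y \<in> Y \<Longrightarrow> u \<le> of_int y" and h: "h > 0"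
  shows "inj_on (\<lambda>y. nat \<lfloor>(of_int y - u) / h\<rfloor>) Y"
    "\<And>y. y \<in> Y \<Longrightarrow> real (nat \<lfloor>(of_int y - u) / h\<rfloor>) \<le> (of_int y - u) / h"
proof -
  define f where "f y = nat \<lfloor>(of_int y - u) / h\<rfloor>" for y :: int
  have f: "real (f y) \<le> (of_int y - u) / h" "(of_int y - u) / h < real (f y) + 1" if "y \<in> Y" for y
  proof -
    have "(of_int y - u) / h \<ge> 0" using lower[OF that] h by simp
    then show "real (f y) \<le> (of_int y - u) / h" "(of_int y - u) / h < real (f y) + 1"
      unfolding f_def by linarith+
  qed
  have "inj_on f Y"
  proof (rule inj_onI)
    fix y y' assume yy: "y \<in> Y" "y' \<in> Y" "f y = f y'"
    have "\<bar>(of_int y - u) / h - (of_int y' - u) / h\<bar> < 1" using f[OF yy(1)] f[OF yy(2)] yy(3) by linarith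
    then have "\<bar>real_of_int (y - y')\<bar> / h < 1"
      using h by (simp add: diff_divide_distrib[symmetric] abs_divide)
    then have "\<bar>real_of_int (y - y')\<bar> < real_of_int h" using h by (simp add: divide_less_eq)
    then have "\<bar>y - y'\<bar> < h" by (metis of_int_abs of_int_less_iff)
    moreover have "h dvd y - y'" using res yy by (simp add: mod_eq_dvd_iff[symmetric])
    ultimately have "y - y' = 0"
      using dvd_imp_le_int[of "y - y'" h] h by linarith
    then show "y = y'" by simp
  qed
  then show "inj_on (\<lambda>y. nat \<lfloor>(of_int y - u) / h\<rfloor>) Y" unfolding f_def[abs_def] .
  show "real (nat \<lfloor>(of_int y - u) / h\<rfloor>) \<le> (of_int y - u) / h" if "y \<in> Y" for y
    using f(1)[OF that] by (simp add: f_def)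
qed

lemma spaced_card:
  fixes p q :: real and h s :: int
  assumes "\<And>y. y \<in> Y \<Longrightarrow> y mod h = s" "\<And>y. y \<in> Y \<Longrightarrow> p \<le> of_int y \<and> of_int y \<le> q" "h > 0" "p \<le> q"
  shows "real (card Y) \<le> (q - p) / h + 1"
proof -
  define f where "f y = nat \<lfloor>(of_int y - p) / h\<rfloor>" for y :: int
  have inj: "inj_on f Y" unfolding f_def[abs_def] by (rule spaced_floor) (use assms in auto)
  have "f ` Y \<subseteq> {..nat \<lfloor>(q - p) / h\<rfloor>}"
  proof
    fix k assume "k \<in> f ` Y"
    then obtain y where y: "y \<in> Y" "k = f y" by blast
    have "(of_int y - p) / h \<le> (q - p) / h" using assms y by (intro divide_right_mono) auto
    then show "k \<in> {..nat \<lfloor>(q - p) / h\<rfloor>}" unfolding y(2) f_def atMost_iff by (intro nat_mono floor_mono)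
  qed
  then have "card (f ` Y) \<le> card {..nat \<lfloor>(q - p) / h\<rfloor>}" by (intro card_mono) auto
  then have "card Y \<le> nat \<lfloor>(q - p) / h\<rfloor> + 1" by (simp add: card_image[OF inj])
  moreover have "(q - p) / h \<ge> 0" using assms by simp
  ultimately show ?thesis by linarith
qed

lemma spaced_exp_sum_above:
  fixes u c :: real and h s :: int
  assumes "finite Y" "\<And>y. y \<in> Y \<Longrightarrow> y mod h = s" "\<And>y. y \<in> Y \<Longrightarrow> u \<le> of_int y" "c > 0" "h > 0"
  shows "(\<Sum>y\<in>Y. exp (- c * (of_int y - u))) \<le> 1 + 1 / (c * h)"
proof -
  define f where "f y = nat \<lfloor>(of_int y - u) / h\<rfloor>" for y :: int
  have f: "real (f y) \<le> (of_int y - u) / h" if "y \<in> Y" for y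
    unfolding f_def by (rule spaced_floor) (use assms that in auto)
  have inj: "inj_on f Y" unfolding f_def[abs_def] by (rule spaced_floor) (use assms in auto)
  have "(\<Sum>y\<in>Y. exp (- c * (of_int y - u))) \<le> (\<Sum>y\<in>Y. exp (- (c * h)) ^ f y)"
  proof (rule sum_mono)
    fix y assume y: "y \<in> Y"
    have "real (f y) * h \<le> of_int y - u" using f[OF y] assms(5) by (simp add: pos_le_divide_eq)
    then have "c * (real (f y) * h) \<le> c * (of_int y - u)" using assms(4) by (intro mult_left_mono) auto
    then have "- c * (of_int y - u) \<le> real (f y) * - (c * h)" by (simp add: algebra_simps)
    then show "exp (- c * (of_int y - u)) \<le> exp (- (c * h)) ^ f y"
      unfolding exp_of_nat_mult[symmetric] by simp
  qed
  also have "\<dots> = (\<Sum>k\<in>f ` Y. exp (- (c * h)) ^ k)"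
    by (simp add: sum.reindex[OF inj])
  also have "\<dots> \<le> 1 + 1 / (c * h)"
    using assms by (intro geometric_exp_sum) auto
  finally show ?thesis .
qed

lemma spaced_exp_sum:
  fixes u c :: real and h s :: int
  assumes "finite Y" "\<And>y. y \<in> Y \<Longrightarrow> y mod h = s" "c > 0" "h > 0"
  shows "(\<Sum>y\<in>Y. exp (- c * \<bar>of_int y - u\<bar>)) \<le> 2 * (1 + 1 / (c * h))"
proof -
  define Y1 where "Y1 = {y \<in> Y. u \<le> of_int y}"
  define Y2 where "Y2 = {y \<in> Y. of_int y < u}"
  have "(\<Sum>y\<in>Y1. exp (- c * \<bar>of_int y - u\<bar>)) = (\<Sum>y\<in>Y1. exp (- c * (of_int y - u)))"
    by (intro sum.cong refl) (auto simp: Y1_def)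
  also have "\<dots> \<le> 1 + 1 / (c * h)"
    by (rule spaced_exp_sum_above[where s = s]) (use assms in \<open>auto simp: Y1_def\<close>)
  finally have 1: "(\<Sum>y\<in>Y1. exp (- c * \<bar>of_int y - u\<bar>)) \<le> 1 + 1 / (c * h)" .
  have "(\<Sum>y\<in>Y2. exp (- c * \<bar>of_int y - u\<bar>)) = (\<Sum>y\<in>uminus ` Y2. exp (- c * (of_int y - (- u))))"
    by (subst sum.reindex) (auto simp: Y2_def intro!: sum.cong)
  also have "\<dots> \<le> 1 + 1 / (c * h)"
  proof (rule spaced_exp_sum_above[where s = "(- s) mod h"])
    fix y assume "y \<in> uminus ` Y2"
    then obtain x where "x \<in> Y" "y = - x" "of_int x < u" by (auto simp: Y2_def)
    then show "y mod h = (- s) mod h" "- u \<le> real_of_int y"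
      using assms(2)[of x] by (auto simp: mod_minus_eq)
  qed (use assms in \<open>auto simp: Y2_def\<close>)
  finally have 2: "(\<Sum>y\<in>Y2. exp (- c * \<bar>of_int y - u\<bar>)) \<le> 1 + 1 / (c * h)" .
  have eq: "(\<Sum>y\<in>Y. exp (- c * \<bar>of_int y - u\<bar>)) =
      (\<Sum>y\<in>Y1. exp (- c * \<bar>of_int y - u\<bar>)) + (\<Sum>y\<in>Y2. exp (- c * \<bar>of_int y - u\<bar>))"
    using assms(1) by (subst sum.union_disjoint[symmetric]) (auto simp: Y1_def Y2_def intro: sum.cong)
  show ?thesis unfolding eq mult_2 by (rule add_mono[OF 1 2])
qed

text \<open>Half of the decay \<open>exp (- area2 a b r / (4 * m))\<close> pays for the weight. The
  other half makes the sum over the heights of \<open>b\<close> geometric in the distance from the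
  line \<open>r a\<close>. The constant is \<open>28 = 10 + 18\<close>: the column of
  \<open>a\<close>, and the columns between \<open>a\<close> and \<open>r\<close>.\<close>

lemma weighted_sum_wide:
  assumes m: "m > 0" and box: "a \<in> board m" "r \<in> board m"
  shows "(\<Sum>b\<in>{b \<in> board m. wide a b r}. exp (area2 a b r / (8 * m)) * card (vacant_shifts m a b r))
    \<le> 28 * exp 2 * (real m ^ m / real m ^ 2)"
proof (cases "\<bar>fst a - fst r\<bar> \<ge> 2")
  case False
  then have empty: "{b \<in> board m. wide a b r} = {}" by (auto simp: wide_def)
  show ?thesis unfolding empty by simp
next
  case True
  define W where "W = real_of_int \<bar>fst a - fst r\<bar>"
  define c where "c = W / (8 * m)"
  define M where "M k = exp 2 * (real m ^ m / real m ^ k)" for k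
  define Y where "Y = {0..<int m * int m}"
  define K where "K = {min (fst a) (fst r)<..<max (fst a) (fst r)}"
  define H where "H b = (if fst b = fst a
      then (if snd b mod int m = snd a mod int m then M 2 * exp (- c * \<bar>of_int (snd b) - of_int (snd a)\<bar>) else 0)
      else M 3 * exp (- c * \<bar>of_int (snd b) - line_at r a (fst b)\<bar>))" for b
  have W2: "W \<ge> 2" using True by (simp add: W_def)
  have Wm: "W \<le> m"
  proof -
    have "\<bar>fst a - fst r\<bar> \<le> int m" using box by (auto simp: board_def)
    then show ?thesis unfolding W_def by linarith
  qed
  have c: "c > 0" using W2 m by (simp add: c_def)
  have ne: "fst a \<noteq> fst r" using True by auto
  have M0: "M k \<ge> 0" for k by (simp add: M_def)
  have H0: "H b \<ge> 0" for b using M0 by (simp add: H_def)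
  have merge: "exp (x / (8 * m)) * (P * exp (2 - x / (4 * m))) = exp 2 * P * exp (- (x / (8 * m)))" for x P :: real
  proof -
    have "x / (8 * m) + (2 - x / (4 * m)) = 2 + - (x / (8 * m))" using m by (simp add: field_simps)
    then have "exp (x / (8 * m)) * exp (2 - x / (4 * m)) = exp 2 * exp (- (x / (8 * m)))"
      by (simp only: exp_add[symmetric])
    then show ?thesis by (simp add: algebra_simps)
  qed
  have lin: "area2 a b r / (8 * m) = c * \<bar>of_int (snd b) - line_at r a (fst b)\<bar>" for b
    using area2_line[OF ne, of b] by (simp add: c_def W_def)
  have "exp (area2 a b r / (8 * m)) * card (vacant_shifts m a b r) \<le> H b"
    if "b \<in> {b \<in> board m. wide a b r}" for b
  proof (cases "fst b = fst a")
    case False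
    have "exp (area2 a b r / (8 * m)) * card (vacant_shifts m a b r) \<le>
        exp (area2 a b r / (8 * m)) * (real m ^ m / real m ^ 3 * exp (2 - area2 a b r / (4 * m)))"
      using card_vacant_shifts_generic[of m a b r] that m box False by (intro mult_left_mono) auto
    also have "\<dots> = H b" unfolding merge unfolding lin using False by (simp add: H_def M_def)
    finally show ?thesis .
  next
    case same: True
    have "line_at r a (fst b) = of_int (snd a)"
      using ne same by (simp add: line_at_def ratio_def)
    then have lin': "area2 a b r / (8 * m) = c * \<bar>of_int (snd b) - of_int (snd a)\<bar>"
      using lin by simp
    have "exp (area2 a b r / (8 * m)) * card (vacant_shifts m a b r) \<le>
        exp (area2 a b r / (8 * m)) * (if snd b mod int m = snd a mod int m
          then real m ^ m / real m ^ 2 * exp (2 - area2 a b r / (4 * m)) else 0)"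
      using card_vacant_shifts_same[of m a b r] that m box same by (intro mult_left_mono) auto
    also have "\<dots> = H b"
    proof (cases "snd b mod int m = snd a mod int m")
      case res: True
      show ?thesis unfolding if_P[OF res] merge unfolding lin' using same res by (simp add: H_def M_def)
    next
      case res: False
      show ?thesis unfolding if_not_P[OF res] using same res by (simp add: H_def)
    qed
    finally show ?thesis .
  qed
  then have "(\<Sum>b\<in>{b \<in> board m. wide a b r}. exp (area2 a b r / (8 * m)) * card (vacant_shifts m a b r))
      \<le> (\<Sum>b\<in>{b \<in> board m. wide a b r}. H b)" by (rule sum_mono)
  also have "\<dots> \<le> (\<Sum>b\<in>insert (fst a) K \<times> Y. H b)"
    by (rule sum_mono2) (use H0 in \<open>auto simp: K_def Y_def board_def wide_def\<close>)
  also have "\<dots> = (\<Sum>i\<in>insert (fst a) K. \<Sum>y\<in>Y. H (i, y))"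
    by (simp add: sum.cartesian_product)
  also have "\<dots> = (\<Sum>y\<in>Y. H (fst a, y)) + (\<Sum>i\<in>K. \<Sum>y\<in>Y. H (i, y))"
    by (subst sum.insert) (auto simp: K_def)
  \<comment> \<open>Here \<open>b\<close> runs through one residue class, of spacing
    \<open>m\<close>. Since \<open>c * m = W / 8\<close> and \<open>W \<ge> 2\<close>, the sum is at
    most \<open>2 * (1 + 8 / W) \<le> 10\<close>.\<close>
  also have "(\<Sum>y\<in>Y. H (fst a, y)) \<le> M 2 * 10"
  proof -
    define Y' where "Y' = {y \<in> Y. y mod int m = snd a mod int m}"
    have finY': "finite Y'" by (rule finite_subset[of _ Y]) (auto simp: Y'_def Y_def)
    have "(\<Sum>y\<in>Y. H (fst a, y)) = (\<Sum>y\<in>Y'. M 2 * exp (- c * \<bar>of_int y - of_int (snd a)\<bar>))"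
      unfolding Y'_def by (subst sum.inter_filter) (auto simp: H_def Y_def intro!: sum.cong)
    also have "\<dots> = M 2 * (\<Sum>y\<in>Y'. exp (- c * \<bar>of_int y - of_int (snd a)\<bar>))"
      by (simp add: sum_distrib_left)
    also have "\<dots> \<le> M 2 * (2 * (1 + 1 / (c * int m)))"
      by (intro mult_left_mono spaced_exp_sum[where s = "snd a mod int m"])
        (use c m M0 finY' in \<open>auto simp: Y'_def\<close>)
    also have "2 * (1 + 1 / (c * int m)) \<le> 10"
    proof -
      have "c * int m = W / 8" using m by (simp add: c_def)
      then show ?thesis using W2 by (simp add: field_simps)
    qed
    finally show ?thesis using M0 by (simp add: mult_left_mono)
  qed
  \<comment> \<open>Here all heights occur, so a column contributes
    \<open>2 * (1 + 8 * m / W) \<le> 18 * m / W\<close>, using \<open>W \<le> m\<close>. At most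
    \<open>W\<close> columns turn this into \<open>18 * m\<close>, and the factor \<open>m\<close>
    changes \<open>M 3\<close> into \<open>M 2\<close>.\<close>
  also have "(\<Sum>i\<in>K. \<Sum>y\<in>Y. H (i, y)) \<le> M 2 * 18"
  proof -
    have col: "(\<Sum>y\<in>Y. H (i, y)) \<le> M 3 * (18 * m / W)" if "i \<in> K" for i
    proof -
      have "i \<noteq> fst a" using that by (auto simp: K_def)
      then have "(\<Sum>y\<in>Y. H (i, y)) = M 3 * (\<Sum>y\<in>Y. exp (- c * \<bar>of_int y - line_at r a i\<bar>))"
        by (simp add: H_def sum_distrib_left)
      also have "\<dots> \<le> M 3 * (2 * (1 + 1 / (c * (1::int))))"
        by (intro mult_left_mono spaced_exp_sum[where s = 0]) (use c M0 in \<open>auto simp: Y_def\<close>)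
      also have "2 * (1 + 1 / (c * (1::int))) \<le> 18 * m / W"
        using Wm W2 m by (simp add: c_def field_simps)
      finally show ?thesis using M0 by (simp add: mult_left_mono)
    qed
    have cK: "real (card K) \<le> W"
    proof -
      have "card K = nat (\<bar>fst a - fst r\<bar> - 1)" by (auto simp: K_def min_def max_def)
      then show ?thesis unfolding W_def by linarith
    qed
    have "(\<Sum>i\<in>K. \<Sum>y\<in>Y. H (i, y)) \<le> real (card K) * (M 3 * (18 * m / W))"
      by (rule sum_bounded_above) (rule col)
    also have "\<dots> \<le> W * (M 3 * (18 * m / W))"
      using cK M0 W2 by (intro mult_right_mono) auto
    also have "\<dots> = M 2 * 18"
      using W2 m by (simp add: M_def field_simps power2_eq_square power3_eq_cube)
    finally show ?thesis .
  qed
  finally show ?thesis by (simp add: M_def mult_ac)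
qed

lemma card_board: "card (board m) = m * m * m"
  by (simp add: board_def card_cartesian_product nat_mult_distrib)

lemma finite_board: "finite (board m)"
  by (simp add: board_def)

section \<open>Choosing the shifts\<close>

text \<open>One bound on this sum serves twice: every nonzero term is at least 1, so it bounds the
  number of triples, and no term exceeds the sum, so it bounds every single area.\<close>

definition potential :: "nat \<Rightarrow> (int \<Rightarrow> int) \<Rightarrow> real" where
  "potential m w = (\<Sum>a\<in>board m. \<Sum>r\<in>board m. \<Sum>b\<in>{b \<in> board m. wide a b r}.
     if vacant m w a b r then exp (area2 a b r / (8 * m)) else 0)"

text \<open>The board has \<open>m^3\<close> places, so there are \<open>m^6\<close> pairs
  \<open>a\<close>, \<open>r\<close>, each contributing a constant times \<open>m^m / m^2\<close>.
  Divided by the \<open>m^m\<close> shifts, this is an average of order \<open>m^4\<close>.\<close>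

lemma sum_potential:
  assumes "m > 0"
  shows "(\<Sum>w\<in>shifts m. potential m w) \<le> 28 * exp 2 * real m ^ 4 * real m ^ m"
proof -
  have fin: "finite (shifts m)" by (simp add: shifts_def finite_PiE)
  have "(\<Sum>w\<in>shifts m. potential m w) = (\<Sum>a\<in>board m. \<Sum>r\<in>board m. \<Sum>b\<in>{b \<in> board m. wide a b r}.
      \<Sum>w\<in>shifts m. if vacant m w a b r then exp (area2 a b r / (8 * m)) else 0)"
    unfolding potential_def by (simp only: sum.swap[where A = "shifts m"])
  also have "\<dots> = (\<Sum>a\<in>board m. \<Sum>r\<in>board m. \<Sum>b\<in>{b \<in> board m. wide a b r}.
      exp (area2 a b r / (8 * m)) * card (vacant_shifts m a b r))"
    unfolding vacant_shifts_def using fin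
    by (intro sum.cong refl) (simp add: sum.inter_filter[symmetric])
  also have "\<dots> \<le> (\<Sum>a\<in>board m. \<Sum>r\<in>board m. 28 * exp 2 * (real m ^ m / real m ^ 2))"
    using assms by (intro sum_mono weighted_sum_wide)
  also have "\<dots> = 28 * exp 2 * real m ^ 4 * real m ^ m"
    using assms by (simp add: card_board field_simps power2_eq_square power4_eq_xxxx)
  finally show ?thesis .
qed

lemma good_shift:
  assumes m: "m > 0"
  obtains w where "w \<in> shifts m" "potential m w \<le> 28 * exp 2 * real m ^ 4"
proof -
  have fin: "finite (shifts m)" by (simp add: shifts_def finite_PiE)
  have card: "card (shifts m) = m ^ m" by (simp add: shifts_def card_PiE)
  have "\<exists>w\<in>shifts m. potential m w \<le> 28 * exp 2 * real m ^ 4"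
  proof (rule ccontr)
    assume "\<not> ?thesis"
    then have *: "28 * exp 2 * real m ^ 4 < potential m w" if "w \<in> shifts m" for w
      using that by force
    have "shifts m \<noteq> {}" using card m by auto
    then have "(\<Sum>w\<in>shifts m. 28 * exp 2 * real m ^ 4) < (\<Sum>w\<in>shifts m. potential m w)"
      using fin * by (intro sum_strict_mono)
    then show False using sum_potential[OF m] by (simp add: card mult.commute)
  qed
  then show ?thesis using that by blast
qed

section \<open>From the potential to the number of vacant triangles\<close>

lemma in_triangle_swap:
  "in_triangle b a c d = in_triangle a b c d" "in_triangle a c b d = in_triangle a b c d"
proof -
  have "cross b a c = - cross a b c" "cross d a c = - cross a d c" "cross b d c = - cross d b c"
    "cross b a d = - cross a b d"
    by (simp_all add: cross_def algebra_simps)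
  then show "in_triangle b a c d = in_triangle a b c d" by (auto simp: in_triangle_def)
  have "cross a c b = - cross a b c" "cross d c b = - cross d b c" "cross a d b = - cross a b d"
    "cross a c d = - cross a d c"
    by (simp_all add: cross_def algebra_simps)
  then show "in_triangle a c b d = in_triangle a b c d" by (auto simp: in_triangle_def)
qed

lemma vacant_swap: "vacant m w b a c = vacant m w a b c" "vacant m w a c b = vacant m w a b c"
  unfolding vacant_def by (auto simp: in_triangle_swap)

lemma area2_swap: "area2 b a c = area2 a b c" "area2 a c b = area2 a b c"
proof -
  have "cross (pt b) (pt a) (pt c) = - cross (pt a) (pt b) (pt c)"
    "cross (pt a) (pt c) (pt b) = - cross (pt a) (pt b) (pt c)"
    by (simp_all add: cross_def algebra_simps)
  then show "area2 b a c = area2 a b c" "area2 a c b = area2 a b c" by (simp_all add: area2_def)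
qed

definition near :: "int \<times> int \<Rightarrow> int \<times> int \<Rightarrow> bool" where
  "near a b \<longleftrightarrow> \<bar>fst a - fst b\<bar> \<le> 1"

text \<open>Sorted by columns, the middle vertex serves as \<open>b\<close>, and \<open>r\<close> is
  the outer vertex that is at least as far from it as the other one.\<close>

lemma wide_permutation:
  assumes "\<not> (near a b \<and> near a c \<and> near b c)"
  shows "wide a b c \<or> wide a c b \<or> wide b a c \<or> wide b c a \<or> wide c a b \<or> wide c b a"
proof -
  have sorted: "wide x y z \<or> wide z y x" if "fst x \<le> fst y" "fst y \<le> fst z" "fst z - fst x \<ge> 2" for x y z
  proof (cases "fst z - fst x \<le> 2 * (fst z - fst y)")
    case True
    then have "wide x y z" using that unfolding wide_def by (simp add: abs_if)
    then show ?thesis ..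
  next
    case False
    then have "wide z y x" using that unfolding wide_def by (simp add: abs_if)
    then show ?thesis ..
  qed
  have far: "fst a - fst b \<ge> 2 \<or> fst b - fst a \<ge> 2 \<or> fst a - fst c \<ge> 2 \<or> fst c - fst a \<ge> 2 \<or>
      fst b - fst c \<ge> 2 \<or> fst c - fst b \<ge> 2"
    using assms unfolding near_def by linarith
  consider "fst a \<le> fst b" "fst b \<le> fst c" | "fst a \<le> fst c" "fst c \<le> fst b"
    | "fst b \<le> fst a" "fst a \<le> fst c" | "fst b \<le> fst c" "fst c \<le> fst a"
    | "fst c \<le> fst a" "fst a \<le> fst b" | "fst c \<le> fst b" "fst b \<le> fst a" by linarith
  then show ?thesis
  proof cases
    case 1 then show ?thesis using sorted[of a b c] far by linarith
  next
    case 2 then show ?thesis using sorted[of a c b] far by linarith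
  next
    case 3 then show ?thesis using sorted[of b a c] far by linarith
  next
    case 4 then show ?thesis using sorted[of b c a] far by linarith
  next
    case 5 then show ?thesis using sorted[of c a b] far by linarith
  next
    case 6 then show ?thesis using sorted[of c b a] far by linarith
  qed
qed

definition wide_vacant :: "nat \<Rightarrow> (int \<Rightarrow> int) \<Rightarrow> ((int \<times> int) \<times> (int \<times> int) \<times> (int \<times> int)) set" where
  "wide_vacant m w = {(a, b, r). wide a b r \<and> vacant m w a b r}"

lemma vacant_board: "vacant m w a b c \<Longrightarrow> a \<in> board m \<and> b \<in> board m \<and> c \<in> board m"
  by (auto simp: vacant_def config_def)

lemma finite_wide_vacant: "finite (wide_vacant m w)"
  by (rule finite_subset[of _ "board m \<times> board m \<times> board m"])
    (auto simp: wide_vacant_def finite_board dest: vacant_board)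

lemma potential_eq:
  "potential m w = (\<Sum>(a, b, r)\<in>wide_vacant m w. exp (area2 a b r / (8 * m)))"
proof -
  have "potential m w = (\<Sum>a\<in>board m. \<Sum>r\<in>board m. \<Sum>b\<in>board m.
      if wide a b r \<and> vacant m w a b r then exp (area2 a b r / (8 * m)) else 0)"
    unfolding potential_def sum.inter_filter[OF finite_board] by (intro sum.cong refl) simp
  also have "\<dots> = (\<Sum>(a, r, b)\<in>board m \<times> board m \<times> board m.
      if wide a b r \<and> vacant m w a b r then exp (area2 a b r / (8 * m)) else 0)"
    by (simp add: sum.cartesian_product)
  also have "\<dots> = (\<Sum>(a, r, b)\<in>{(a, r, b). wide a b r \<and> vacant m w a b r}. exp (area2 a b r / (8 * m)))"
    by (rule sum.mono_neutral_cong_right) (auto simp: finite_board dest: vacant_board split: if_splits)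
  also have "\<dots> = (\<Sum>(a, b, r)\<in>wide_vacant m w. exp (area2 a b r / (8 * m)))"
    by (rule sum.reindex_bij_witness[of _ "\<lambda>(a, b, r). (a, r, b)" "\<lambda>(a, r, b). (a, b, r)"])
      (auto simp: wide_vacant_def)
  finally show ?thesis .
qed

lemma card_wide_vacant: "real (card (wide_vacant m w)) \<le> potential m w"
proof -
  have "real (card (wide_vacant m w)) = (\<Sum>t\<in>wide_vacant m w. 1)" by simp
  also have "\<dots> \<le> potential m w"
    unfolding potential_eq by (rule sum_mono) (auto simp: area2_def)
  finally show ?thesis .
qed

lemma wide_vacant_area:
  assumes "wide a b r" "vacant m w a b r" "potential m w \<le> P" "m > 0" "P > 0"
  shows "area2 a b r \<le> m * (8 * ln P)"
proof -
  have "exp (area2 a b r / (8 * m)) \<le> potential m w"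
    unfolding potential_eq
    using member_le_sum[of "(a, b, r)" "wide_vacant m w" "\<lambda>(a, b, r). exp (area2 a b r / (8 * m))"]
      assms finite_wide_vacant by (auto simp: wide_vacant_def)
  then have "exp (area2 a b r / (8 * m)) \<le> P" using assms by simp
  then have "area2 a b r / (8 * m) \<le> ln P" using assms by (simp add: ln_ge_iff)
  then show ?thesis using assms by (simp add: field_simps)
qed

lemma spread_vacant_area:
  assumes "\<not> (near a b \<and> near a c \<and> near b c)" "vacant m w a b c" "potential m w \<le> P" "m > 0" "P > 0"
  shows "area2 a b c \<le> m * (8 * ln P)"
proof -
  have area: "area2 a c b = area2 a b c" "area2 b a c = area2 a b c" "area2 b c a = area2 a b c"
    "area2 c a b = area2 a b c" "area2 c b a = area2 a b c" by (metis area2_swap)+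
  have vac: "vacant m w a c b" "vacant m w b a c" "vacant m w b c a" "vacant m w c a b" "vacant m w c b a"
    using assms(2) by (metis vacant_swap)+
  note A = wide_vacant_area[OF _ _ assms(3-5)]
  show ?thesis
    using wide_permutation[OF assms(1)] A[OF _ assms(2)] A[OF _ vac(1), unfolded area]
      A[OF _ vac(2), unfolded area] A[OF _ vac(3), unfolded area] A[OF _ vac(4), unfolded area]
      A[OF _ vac(5), unfolded area] by blast
qed

lemma finite_config: "finite (config m w)"
  by (simp add: config_def finite_board)

lemma card_column:
  assumes "m > 0"
  shows "card {P \<in> config m w. fst P = i} \<le> m"
proof -
  define Y where "Y = {y. (i, y) \<in> config m w}"
  have "{P \<in> config m w. fst P = i} = Pair i ` Y" by (auto simp: Y_def)
  then have "card {P \<in> config m w. fst P = i} = card Y" by (simp add: card_image inj_on_def)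
  moreover have "real (card Y) \<le> (real m * real m - 1 - 0) / (int m) + 1"
  proof (rule spaced_card)
    fix y assume "y \<in> Y"
    then have y: "0 \<le> y" "y \<le> int m * int m - 1" "y mod int m = w i" by (auto simp: Y_def config_def board_def)
    show "y mod int m = w i" by (rule y)
    have "real_of_int y \<le> real_of_int (int m * int m - 1)" using y(2) by (simp only: of_int_le_iff)
    then show "0 \<le> real_of_int y \<and> real_of_int y \<le> real m * real m - 1" using y(1) by simp
  next
    have "1 * 1 \<le> real m * real m" using assms by (intro mult_mono) auto
    then show "0 \<le> real m * real m - 1" by simp
  qed (use assms in auto)
  \<comment> \<open>The largest height is \<open>m * m - 1\<close>, so the bound stays strictly
    below \<open>m + 1\<close>; integrality then gives \<open>m\<close>.\<close>
  moreover have "(real m * real m - 1 - 0) / (int m) + 1 < real m + 1"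
    using assms by (simp add: field_simps)
  ultimately show ?thesis by linarith
qed

lemma card_columns:
  assumes "m > 0" "finite I"
  shows "card {P \<in> config m w. fst P \<in> I} \<le> card I * m"
proof -
  have "{P \<in> config m w. fst P \<in> I} = (\<Union>i\<in>I. {P \<in> config m w. fst P = i})" by auto
  then have "card {P \<in> config m w. fst P \<in> I} \<le> (\<Sum>i\<in>I. card {P \<in> config m w. fst P = i})"
    using card_UN_le[OF assms(2), of "\<lambda>i. {P \<in> config m w. fst P = i}"] by (simp only:)
  also have "\<dots> \<le> card I * m" using sum_bounded_above[of I _ m] card_column[OF assms(1)] by simp
  finally show ?thesis .
qed

lemma card_near:
  assumes "m > 0"
  shows "card {P \<in> config m w. near a P} \<le> 3 * m"
proof -
  have "{P \<in> config m w. near a P} = {P \<in> config m w. fst P \<in> {fst a - 1..fst a + 1}}"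
    by (auto simp: near_def)
  then show ?thesis using card_columns[OF assms, of "{fst a - 1..fst a + 1}" w] by simp
qed

lemma card_config:
  assumes "m > 0" "w \<in> shifts m"
  shows "card (config m w) = m * m"
proof -
  have w: "0 \<le> w i" "w i < int m" if "0 \<le> i" "i < int m" for i
    using assms(2) that by (auto simp: shifts_def dest!: PiE_mem)
  have "bij_betw (\<lambda>(i, j). (i, int m * j + w i)) ({0..<int m} \<times> {0..<int m}) (config m w)"
  proof (rule bij_betw_byWitness[where f' = "\<lambda>(i, y). (i, y div int m)"])
    show "\<forall>a\<in>{0..<int m} \<times> {0..<int m}. (case case a of (i, j) \<Rightarrow> (i, int m * j + w i) of (i, y) \<Rightarrow> (i, y div int m)) = a"
      using w assms by auto
    show "\<forall>a'\<in>config m w. (case case a' of (i, y) \<Rightarrow> (i, y div int m) of (i, j) \<Rightarrow> (i, int m * j + w i)) = a'"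
      by (auto simp: config_def) (metis mult_div_mod_eq)
    show "(\<lambda>(i, j). (i, int m * j + w i)) ` ({0..<int m} \<times> {0..<int m}) \<subseteq> config m w"
    proof clarify
      fix i j assume ij: "i \<in> {0..<int m}" "j \<in> {0..<int m}"
      have "int m * j \<le> int m * (int m - 1)" using ij by (intro mult_left_mono) auto
      then have "int m * j + w i < int m * int m" using w[of i] ij by (simp add: algebra_simps)
      then show "(i, int m * j + w i) \<in> config m w" using w[of i] ij by (auto simp: config_def board_def)
    qed
    show "(\<lambda>(i, y). (i, y div int m)) ` config m w \<subseteq> {0..<int m} \<times> {0..<int m}"
    proof clarify
      fix i y assume "(i, y) \<in> config m w"
      then have y: "0 \<le> i" "i < int m" "0 \<le> y" "y < int m * int m" by (auto simp: config_def board_def)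
      have "int m * (y div int m) \<le> y"
        using mult_div_mod_eq[of "int m" y] pos_mod_sign[of "int m" y] assms(1) by linarith
      then have "int m * (y div int m) < int m * int m" using y by linarith
      then have "y div int m < int m" using assms(1) by simp
      moreover have "0 \<le> y div int m" using y assms(1) by (simp add: pos_imp_zdiv_nonneg_iff)
      ultimately show "i \<in> {0..<int m} \<and> y div int m \<in> {0..<int m}" using y by simp
    qed
  qed
  then have "card (config m w) = card ({0..<int m} \<times> {0..<int m})" by (rule bij_betw_same_card[symmetric])
  then show ?thesis by (simp add: card_cartesian_product)
qed

text \<open>A triple that is not pairwise \<open>near\<close> is wide in one of its six orders,
  hence the factor 6. For the others, \<open>a\<close> is any of \<open>m * m\<close> points, and
  \<open>b\<close> and \<open>c\<close> are each among at most \<open>3 * m\<close> points near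
  it.\<close>

lemma card_vacant:
  assumes m: "m > 0" and w: "w \<in> shifts m"
  shows "finite {(a, b, c). vacant m w a b c}"
    "real (card {(a, b, c). vacant m w a b c}) \<le> 6 * potential m w + 9 * real m ^ 4"
proof -
  define X where "X = {(a, b, c). vacant m w a b c}"
  define W where "W = wide_vacant m w"
  define N where "N = (SIGMA a:config m w. {P \<in> config m w. near a P} \<times> {P \<in> config m w. near a P})"
  define p1 p2 p3 p4 p5 :: "(int \<times> int) \<times> (int \<times> int) \<times> (int \<times> int) \<Rightarrow> (int \<times> int) \<times> (int \<times> int) \<times> (int \<times> int)"
    where "p1 = (\<lambda>(a, b, c). (a, c, b))" and "p2 = (\<lambda>(a, b, c). (b, a, c))" and "p3 = (\<lambda>(a, b, c). (c, a, b))"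
      and "p4 = (\<lambda>(a, b, c). (b, c, a))" and "p5 = (\<lambda>(a, b, c). (c, b, a))"
  have "X \<subseteq> N \<union> (W \<union> p1 ` W \<union> p2 ` W \<union> p3 ` W \<union> p4 ` W \<union> p5 ` W)"
  proof
    fix t assume "t \<in> X"
    then obtain a b c where t: "t = (a, b, c)" "vacant m w a b c" by (auto simp: X_def)
    have vac: "vacant m w a c b" "vacant m w b a c" "vacant m w b c a" "vacant m w c a b" "vacant m w c b a"
      using t(2) by (metis vacant_swap)+
    show "t \<in> N \<union> (W \<union> p1 ` W \<union> p2 ` W \<union> p3 ` W \<union> p4 ` W \<union> p5 ` W)"
    proof (cases "near a b \<and> near a c \<and> near b c")
      case True
      then have "t \<in> N" using t by (auto simp: N_def vacant_def)
      then show ?thesis by blast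
    next
      case False
      have W: "(x, y, z) \<in> W" if "wide x y z" "vacant m w x y z" for x y z
        using that by (simp add: W_def wide_vacant_def)
      have eqs: "t = p1 (a, c, b)" "t = p2 (b, a, c)" "t = p3 (b, c, a)" "t = p4 (c, a, b)" "t = p5 (c, b, a)"
        by (simp_all add: t p1_def p2_def p3_def p4_def p5_def)
      have "(a, b, c) \<in> W \<or> (a, c, b) \<in> W \<or> (b, a, c) \<in> W \<or> (b, c, a) \<in> W \<or> (c, a, b) \<in> W \<or> (c, b, a) \<in> W"
        using wide_permutation[OF False] W[OF _ t(2)] W[OF _ vac(1)] W[OF _ vac(2)] W[OF _ vac(3)]
          W[OF _ vac(4)] W[OF _ vac(5)] by blast
      then have "t \<in> W \<or> t \<in> p1 ` W \<or> t \<in> p2 ` W \<or> t \<in> p3 ` W \<or> t \<in> p4 ` W \<or> t \<in> p5 ` W"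
        using eqs t(1) by (metis imageI)
      then show ?thesis by blast
    qed
  qed
  moreover have finN: "finite N" unfolding N_def by (simp add: finite_config)
  moreover have finW: "finite W" unfolding W_def by (rule finite_wide_vacant)
  ultimately have fin: "finite X" and c: "card X \<le> card (N \<union> (W \<union> p1 ` W \<union> p2 ` W \<union> p3 ` W \<union> p4 ` W \<union> p5 ` W))"
    by (auto intro: finite_subset card_mono)
  note c
  also have "\<dots> \<le> card N + (card W + card W + card W + card W + card W + card W)"
    using finW by (intro order_trans[OF card_Un_le] add_mono card_image_le order_refl)
  also have "card N \<le> m * m * (3 * m * (3 * m))"
  proof -
    have "card N = (\<Sum>a\<in>config m w. card {P \<in> config m w. near a P} * card {P \<in> config m w. near a P})"
      unfolding N_def by (subst card_SigmaI) (auto simp: finite_config card_cartesian_product)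
    also have "\<dots> \<le> (\<Sum>a\<in>config m w. 3 * m * (3 * m))"
      by (intro sum_mono mult_mono card_near m) auto
    finally show ?thesis by (simp add: card_config[OF m w])
  qed
  finally have "card X \<le> m * m * (3 * m * (3 * m)) + 6 * card W" by simp
  then have "real (card X) \<le> real (m * m * (3 * m * (3 * m)) + 6 * card W)" by (simp only: of_nat_le_iff)
  also have "\<dots> = 9 * real m ^ 4 + 6 * real (card W)" by (simp add: power4_eq_xxxx)
  also have "\<dots> \<le> 9 * real m ^ 4 + 6 * potential m w" using card_wide_vacant by (simp add: W_def)
  finally show "real (card {(a, b, c). vacant m w a b c}) \<le> 6 * potential m w + 9 * real m ^ 4"
    by (simp add: X_def)
  show "finite {(a, b, c). vacant m w a b c}" using fin by (simp add: X_def)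
qed

text \<open>If \<open>p\<close> and \<open>q\<close> are in different columns, the strip meets every
  column in a section of length at most \<open>2 * m * K\<close>, which holds
  \<open>2 * K + 1\<close> points of spacing \<open>m\<close>. If they share a column, they are at
  least \<open>m\<close> apart, so \<open>r\<close> is within \<open>K\<close> columns of them, and
  each such column has \<open>m\<close> points.\<close>

lemma card_strip:
  fixes K :: real
  assumes m: "m > 0" and pq: "p \<in> config m w" "q \<in> config m w" "p \<noteq> q" and K: "K \<ge> 0"
  shows "real (card {r \<in> config m w. area2 p r q \<le> m * K}) \<le> m * (2 * K + 1)"
proof (cases "fst p = fst q")
  case False
  define Y where "Y i = {y. (i, y) \<in> config m w \<and> area2 p (i, y) q \<le> m * K}" for i
  have "{r \<in> config m w. area2 p r q \<le> m * K} = (\<Union>i\<in>{0..<int m}. Pair i ` Y i)"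
    by (auto simp: Y_def config_def board_def)
  then have "real (card {r \<in> config m w. area2 p r q \<le> m * K}) \<le> real (\<Sum>i\<in>{0..<int m}. card (Pair i ` Y i))"
    using card_UN_le[of "{0..<int m}" "\<lambda>i. Pair i ` Y i"] by (simp only: of_nat_le_iff finite_atLeastLessThan_int)
  also have "\<dots> = (\<Sum>i\<in>{0..<int m}. real (card (Y i)))" by (simp add: card_image inj_on_def)
  also have "\<dots> \<le> (\<Sum>i\<in>{0..<int m}. 2 * K + 1)"
  proof (rule sum_mono)
    fix i
    define z where "z = line_at q p i"
    have "real (card (Y i)) \<le> ((z + m * K) - (z - m * K)) / int m + 1"
    proof (rule spaced_card)
      fix y assume "y \<in> Y i"
      then have y: "y mod int m = w i" "area2 p (i, y) q \<le> m * K" by (auto simp: Y_def config_def)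
      show "y mod int m = w i" by (rule y)
      have "1 \<le> real_of_int \<bar>fst p - fst q\<bar>" using False by linarith
      then have "1 * \<bar>of_int y - z\<bar> \<le> real_of_int \<bar>fst p - fst q\<bar> * \<bar>of_int y - z\<bar>"
        by (intro mult_right_mono) auto
      also have "\<dots> \<le> m * K" using y(2) area2_line[OF False, of "(i, y)"] by (simp add: z_def)
      finally show "z - m * K \<le> of_int y \<and> of_int y \<le> z + m * K" by (simp add: abs_le_iff algebra_simps)
    qed (use m K in auto)
    also have "((z + m * K) - (z - m * K)) / int m + 1 = 2 * K + 1" using m by (simp add: field_simps)
    finally show "real (card (Y i)) \<le> 2 * K + 1" .
  qed
  finally show ?thesis by simp
next
  case True
  define I where "I = {i. \<bar>i - fst p\<bar> \<le> K}"
  have dy: "real m \<le> \<bar>real_of_int (snd p - snd q)\<bar>"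
  proof -
    have "snd p mod int m = snd q mod int m" using pq True by (auto simp: config_def)
    then have "int m dvd snd p - snd q" by (simp add: mod_eq_dvd_iff)
    moreover have "snd p - snd q \<noteq> 0" using pq(3) True by (auto simp: prod_eq_iff)
    ultimately have "int m \<le> \<bar>snd p - snd q\<bar>" using dvd_imp_le_int[of "snd p - snd q" "int m"] by simp
    then show ?thesis by linarith
  qed
  have "fst r \<in> I" if "area2 p r q \<le> m * K" for r
  proof -
    have "cross (pt p) (pt r) (pt q) = - (real_of_int (fst r - fst p) * real_of_int (snd p - snd q))"
      using True by (simp add: cross_def pt_def algebra_simps)
    then have "area2 p r q = \<bar>real_of_int (fst r - fst p)\<bar> * \<bar>real_of_int (snd p - snd q)\<bar>"
      by (simp only: area2_def abs_minus_cancel abs_mult)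
    moreover have "\<bar>real_of_int (fst r - fst p)\<bar> * real m \<le> \<bar>real_of_int (fst r - fst p)\<bar> * \<bar>real_of_int (snd p - snd q)\<bar>"
      using dy by (intro mult_left_mono) auto
    ultimately have "\<bar>real_of_int (fst r - fst p)\<bar> * real m \<le> K * real m" using that by (simp only: mult.commute[of K])
    then show ?thesis using m by (simp add: I_def)
  qed
  then have "{r \<in> config m w. area2 p r q \<le> m * K} \<subseteq> {r \<in> config m w. fst r \<in> I}" by blast
  then have "card {r \<in> config m w. area2 p r q \<le> m * K} \<le> card {r \<in> config m w. fst r \<in> I}"
    by (intro card_mono) (auto simp: finite_config)
  also have "\<dots> \<le> card I * m"
  proof (rule card_columns[OF m])
    have "I \<subseteq> {fst p - \<lceil>K\<rceil>..fst p + \<lceil>K\<rceil>}" unfolding I_def by (auto; linarith)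
    then show "finite I" by (rule finite_subset) simp
  qed
  finally have "real (card {r \<in> config m w. area2 p r q \<le> m * K}) \<le> real (card I) * real m"
    by (metis of_nat_le_iff of_nat_mult)
  moreover have "real (card I) \<le> ((of_int (fst p) + K) - (of_int (fst p) - K)) / (1::int) + 1"
    by (rule spaced_card[where s = 0]) (use K in \<open>auto simp: I_def\<close>)
  ultimately show ?thesis
    using mult_right_mono[of "real (card I)" "2 * K + 1" "real m"] by (simp add: mult.commute)
qed

lemma card_vacant_edge:
  assumes m: "m > 0" and pq: "p \<noteq> q" and P: "potential m w \<le> P" "P \<ge> 1"
  shows "finite {r. vacant m w p r q}" "real (card {r. vacant m w p r q}) \<le> m * (16 * ln P + 4)"
proof -
  have sub: "{r. vacant m w p r q} \<subseteq> config m w" by (auto simp: vacant_def)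
  show "finite {r. vacant m w p r q}" by (rule finite_subset[OF sub finite_config])
  show "real (card {r. vacant m w p r q}) \<le> m * (16 * ln P + 4)"
  proof (cases "{r. vacant m w p r q} = {}")
    case True
    show ?thesis unfolding True using P(2) by simp
  next
    case False
    then have pqc: "p \<in> config m w" "q \<in> config m w" by (auto simp: vacant_def)
    \<comment> \<open>The area bound for triples that are not pairwise \<open>near\<close>. Together
      with the \<open>3 * m\<close> points near \<open>p\<close> this gives the factor
      \<open>3 + (2 * K + 1) = 16 * ln P + 4\<close>.\<close>
    define K where "K = 8 * ln P"
    have K: "K \<ge> 0" using P(2) by (simp add: K_def)
    have "{r. vacant m w p r q} \<subseteq> {r \<in> config m w. near p r} \<union> {r \<in> config m w. area2 p r q \<le> m * K}"
    proof
      fix r assume "r \<in> {r. vacant m w p r q}"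
      then have r: "vacant m w p r q" "r \<in> config m w" by (auto simp: vacant_def)
      show "r \<in> {r \<in> config m w. near p r} \<union> {r \<in> config m w. area2 p r q \<le> m * K}"
        using spread_vacant_area[OF _ r(1) P(1) m] P(2) r(2) by (auto simp: K_def)
    qed
    then have "card {r. vacant m w p r q} \<le> card ({r \<in> config m w. near p r} \<union> {r \<in> config m w. area2 p r q \<le> m * K})"
      by (intro card_mono) (auto simp: finite_config)
    also have "\<dots> \<le> card {r \<in> config m w. near p r} + card {r \<in> config m w. area2 p r q \<le> m * K}"
      by (rule card_Un_le)
    also have "\<dots> \<le> 3 * m + card {r \<in> config m w. area2 p r q \<le> m * K}"
      using card_near[OF m] by simp
    finally have "real (card {r. vacant m w p r q}) \<le> 3 * m + real (card {r \<in> config m w. area2 p r q \<le> m * K})"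
      by linarith
    also have "\<dots> \<le> 3 * m + m * (2 * K + 1)" using card_strip[OF m pqc pq K] by simp
    also have "\<dots> = m * (16 * ln P + 4)" by (simp add: K_def algebra_simps)
    finally show ?thesis .
  qed
qed

section \<open>Assembly of the bound\<close>

lemma empty_triangle_distinct: "empty_triangle S a c b \<Longrightarrow> a \<noteq> c \<and> c \<noteq> b"
  by (auto simp: empty_triangle_def)

text \<open>Every hole is the image of a triangulated vertex list. A hole has several such lists,
  its rotations among them, which is harmless for an upper bound.\<close>

lemma card_k_holes:
  assumes gp: "general_position S" and k: "k = j + 3"
    and D: "\<And>a b. a \<noteq> b \<Longrightarrow> finite {c. empty_triangle S a c b} \<and> card {c. empty_triangle S a c b} \<le> D"
    and T: "finite {(a, c, b). empty_triangle S a c b}" "card {(a, c, b). empty_triangle S a c b} \<le> T"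
  shows "card (k_holes k S) \<le> fact (Suc j) * T * D ^ j"
proof -
  define V where "V = {vs. length vs = j + 3 \<and> triangulated (empty_triangle S) vs}"
  have V: "finite V" "card V \<le> fact (Suc j) * T * D ^ j"
    unfolding V_def by (rule card_triangulated[OF empty_triangle_distinct D T]; assumption)+
  have "k_holes k S \<subseteq> (\<lambda>vs. path_image (closed_polyline vs)) ` V"
  proof
    fix P assume "P \<in> k_holes k S"
    then obtain vs where vs: "P = path_image (closed_polyline vs)" "distinct vs" "length vs = k"
      "set vs \<subseteq> S" "simple_path (closed_polyline vs)" "inside P \<inter> S = {}"
      by (auto simp: k_holes_def k_gons_def)
    have "triangulated (empty_triangle S) vs"
      by (rule empty_polygon_triangulated) (use vs gp k in auto)
    then show "P \<in> (\<lambda>vs. path_image (closed_polyline vs)) ` V" using vs k by (auto simp: V_def)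
  qed
  then have "card (k_holes k S) \<le> card V" by (rule surj_card_le[OF V(1)])
  then show ?thesis using V(2) by linarith
qed

lemma point_set_exists:
  assumes m: "m > 0"
  defines "P \<equiv> 28 * exp 2 * real m ^ 4"
  obtains S where "finite S" "card S = m * m" "general_position S"
    "finite {(a, c, b). empty_triangle S a c b}"
    "real (card {(a, c, b). empty_triangle S a c b}) \<le> 6 * P + 9 * real m ^ 4"
    "\<And>a b. a \<noteq> b \<Longrightarrow> finite {c. empty_triangle S a c b} \<and>
      real (card {c. empty_triangle S a c b}) \<le> m * (16 * ln P + 4)"
proof -
  obtain w where w: "w \<in> shifts m" "potential m w \<le> P"
    using good_shift[OF m] by (auto simp: P_def)
  have P1: "P \<ge> 1"
  proof -
    have "1 * 1 * 1 \<le> 28 * exp 2 * real m ^ 4"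
      using m by (intro mult_mono) (auto simp: one_le_power)
    then show ?thesis by (simp add: P_def)
  qed
  have injpt: "inj pt" by (auto simp: inj_def pt_def prod_eq_iff)
  obtain p where p: "inj_on p (pt ` config m w)" "general_position (p ` pt ` config m w)"
    "\<And>a b c d. {a, b, c, d} \<subseteq> pt ` config m w \<Longrightarrow> in_triangle a b c d \<Longrightarrow> in_triangle (p a) (p b) (p c) (p d)"
    using perturbation[of "pt ` config m w"] finite_config by blast
  define f where "f = p \<circ> pt"
  have inj: "inj_on f (config m w)"
    unfolding f_def using p(1) injpt by (intro comp_inj_on) (auto intro: inj_on_subset)
  define S where "S = f ` config m w"
  \<comment> \<open>A configuration point strictly inside the original triangle would stay inside
    after the perturbation, so empty triangles of \<open>S\<close> come from vacant triples
    only.\<close>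
  have pre: "\<exists>x y z. a = f x \<and> b = f y \<and> c = f z \<and> vacant m w x y z"
    if "empty_triangle S a b c" for a b c
  proof -
    obtain x y z where xyz: "a = f x" "b = f y" "c = f z" "{x, y, z} \<subseteq> config m w"
      using \<open>empty_triangle S a b c\<close> by (auto simp: empty_triangle_def S_def)
    have "\<not> in_triangle (pt x) (pt y) (pt z) (pt d)" if d: "d \<in> config m w" for d
    proof
      assume "in_triangle (pt x) (pt y) (pt z) (pt d)"
      then have "in_triangle (f x) (f y) (f z) (f d)" using p(3) xyz(4) d by (simp add: f_def)
      then have "f d \<in> interior (convex hull {a, b, c})" using in_triangle_interior xyz by simp
      then show False using \<open>empty_triangle S a b c\<close> d by (auto simp: empty_triangle_def S_def)
    qed
    then have "vacant m w x y z" using xyz(4) by (simp add: vacant_def)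
    then show ?thesis using xyz by blast
  qed
  show ?thesis
  proof (rule that)
    show "finite S" by (simp add: S_def finite_config)
    show "card S = m * m" unfolding S_def using card_image[OF inj] card_config[OF m w(1)] by simp
    show "general_position S" using p(2) by (simp add: S_def f_def image_comp)
    have sub: "{(a, c, b). empty_triangle S a c b} \<subseteq> (\<lambda>(a, c, b). (f a, f c, f b)) ` {(a, c, b). vacant m w a c b}"
    proof clarify
      fix a c b assume "empty_triangle S a c b"
      then obtain x z y where "a = f x" "c = f z" "b = f y" "vacant m w x z y" using pre by blast
      then show "(a, c, b) \<in> (\<lambda>(a, c, b). (f a, f c, f b)) ` {(a, c, b). vacant m w a c b}"
        by (intro image_eqI[of _ _ "(x, z, y)"]) auto
    qed
    show "finite {(a, c, b). empty_triangle S a c b}"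
      by (rule finite_subset[OF sub]) (rule finite_imageI[OF card_vacant(1)[OF m w(1)]])
    have "card {(a, c, b). empty_triangle S a c b} \<le> card {(a, c, b). vacant m w a c b}"
      by (rule surj_card_le[OF card_vacant(1)[OF m w(1)] sub])
    then show "real (card {(a, c, b). empty_triangle S a c b}) \<le> 6 * P + 9 * real m ^ 4"
      using card_vacant(2)[OF m w(1)] w(2) by linarith
    show "finite {c. empty_triangle S a c b} \<and>
      real (card {c. empty_triangle S a c b}) \<le> m * (16 * ln P + 4)" if ab: "a \<noteq> b" for a b
    proof (cases "{c. empty_triangle S a c b} = {}")
      case True
      show ?thesis unfolding True using P1 by simp
    next
      case False
      then obtain x y where xy: "a = f x" "b = f y" "x \<in> config m w" "y \<in> config m w"
        by (auto simp: empty_triangle_def S_def)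
      have "{c. empty_triangle S a c b} \<subseteq> f ` {z. vacant m w x z y}"
      proof
        fix c assume "c \<in> {c. empty_triangle S a c b}"
        then obtain x' z y' where *: "a = f x'" "c = f z" "b = f y'" "vacant m w x' z y'"
          using pre by blast
        then have "x' \<in> config m w" "y' \<in> config m w" by (auto simp: vacant_def)
        then have "x' = x" "y' = y" using inj xy * by (auto simp: inj_on_def)
        then show "c \<in> f ` {z. vacant m w x z y}" using * by blast
      qed
      moreover note edge = card_vacant_edge[OF m _ w(2) P1, of x y]
      moreover have "x \<noteq> y" using ab xy by auto
      ultimately have "finite {c. empty_triangle S a c b}"
        "card {c. empty_triangle S a c b} \<le> card {z. vacant m w x z y}"
        by (auto intro: finite_subset surj_card_le)
      then show ?thesis using edge(2)[OF \<open>x \<noteq> y\<close>] by linarith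
    qed
  qed
qed

theorem theorem4:
  "\<forall>k::nat. k \<ge> 4 \<longrightarrow>
     (\<exists>C::real. \<forall>n::nat. n \<ge> k \<and> sqrt (real n) \<in> \<nat> \<longrightarrow>
        (\<exists>S. finite S \<and> card S = n \<and> general_position S \<and>
           real (card (k_holes k S))
             \<le> C * (real n powr ((real k + 1) / 2) * ln (real n) ^ (k - 3))))"
proof (intro allI impI)
  fix k :: nat assume k4: "k \<ge> 4"
  define j where "j = k - 3"
  define c where "c = 28 * exp (2 :: real)"
  \<comment> \<open>As \<open>P = c * n^2\<close>, the edge bound is
    \<open>16 * ln c + 4 + 32 * ln n\<close>; with \<open>ln n \<ge> 1\<close> the constants are
    absorbed, and \<open>4 + 32 = 36\<close>.\<close>
  define B where "B = 16 * ln c + 36"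
  define A where "A = fact (Suc j) * (6 * c + 9)"
  have k: "k = j + 3" using k4 by (simp add: j_def)
  have c1: "c \<ge> 1" unfolding c_def using exp_ge_add_one_self[of "2 :: real"] by linarith
  have lnc: "ln c \<ge> 0" using c1 by simp
  show "\<exists>C::real. \<forall>n::nat. n \<ge> k \<and> sqrt (real n) \<in> \<nat> \<longrightarrow>
        (\<exists>S. finite S \<and> card S = n \<and> general_position S \<and>
           real (card (k_holes k S))
             \<le> C * (real n powr ((real k + 1) / 2) * ln (real n) ^ (k - 3)))"
  proof (intro exI[of _ "A * B ^ j"] allI impI)
    fix n :: nat assume n: "n \<ge> k \<and> sqrt (real n) \<in> \<nat>"
    then obtain m where "sqrt (real n) = real m" by (auto elim: Nats_cases)
    then have "real n = real m ^ 2" by (metis of_nat_0_le_iff real_sqrt_pow2)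
    then have nm: "n = m * m" "real n = real m ^ 2"
      by (metis of_nat_eq_iff of_nat_power power2_eq_square, simp)
    have m: "m > 0" using n k4 nm(1) by (cases m) auto
    define P where "P = 28 * exp 2 * real m ^ 4"
    obtain S where S: "finite S" "card S = m * m" "general_position S"
      "finite {(a, c, b). empty_triangle S a c b}"
      "real (card {(a, c, b). empty_triangle S a c b}) \<le> 6 * P + 9 * real m ^ 4"
      "\<And>a b. a \<noteq> b \<Longrightarrow> finite {c. empty_triangle S a c b} \<and>
        real (card {c. empty_triangle S a c b}) \<le> m * (16 * ln P + 4)"
      using point_set_exists[OF m] unfolding P_def by metis
    \<comment> \<open>The hypothesis \<open>k \<ge> 4\<close> gives
      \<open>n \<ge> 4 \<ge> exp 1\<close>; the additive constants can be absorbed because the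
      logarithm is at least 1.\<close>
    have ln1: "ln (real n) \<ge> 1"
    proof -
      have "exp 1 \<le> (4 :: real)" using exp_le by linarith
      also have "\<dots> \<le> real n" using n k4 by simp
      finally show ?thesis using n k4 by (subst ln_ge_iff) auto
    qed
    have "P = c * real n ^ 2" unfolding P_def c_def nm(2) by simp
    then have "ln P = ln c + 2 * ln (real n)"
      using c1 n k4 by (simp add: ln_mult ln_realpow)
    then have "16 * ln P + 4 = 16 * ln c + 4 + 32 * ln (real n)" by simp
    also have "\<dots> \<le> (16 * ln c + 4) * ln (real n) + 32 * ln (real n)"
      using ln1 lnc mult_left_mono[of 1 "ln (real n)" "16 * ln c + 4"] by simp
    also have "\<dots> = B * ln (real n)" by (simp add: B_def algebra_simps)
    finally have lnP: "16 * ln P + 4 \<le> B * ln (real n)" .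
    define D where "D = nat \<lfloor>real m * (16 * ln P + 4)\<rfloor>"
    define T where "T = card {(a, c, b). empty_triangle S a c b}"
    have D: "finite {c. empty_triangle S a c b} \<and> card {c. empty_triangle S a c b} \<le> D"
      if "a \<noteq> b" for a b
      using S(6)[OF that] unfolding D_def by (simp add: le_nat_floor)
    have B0: "B \<ge> 0" using lnc by (simp add: B_def)
    have Dle: "real D \<le> real m * (B * ln (real n))"
    proof -
      have "real m * (16 * ln P + 4) \<le> real m * (B * ln (real n))"
        using lnP by (intro mult_left_mono) auto
      moreover have "0 \<le> real m * (B * ln (real n))" using B0 ln1 by simp
      ultimately show ?thesis unfolding D_def by linarith
    qed
    have Tle: "real T \<le> (6 * c + 9) * real m ^ 4"
      using S(5) by (simp add: T_def P_def c_def algebra_simps)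
    have "card (k_holes k S) \<le> fact (Suc j) * T * D ^ j"
      using card_k_holes[OF S(3) k D S(4)] by (simp add: T_def)
    then have "real (card (k_holes k S)) \<le> real (fact (Suc j) * T * D ^ j)" by (simp only: of_nat_le_iff)
    also have "\<dots> = fact (Suc j) * real T * real D ^ j" by (simp only: of_nat_mult of_nat_fact of_nat_power)
    also have "\<dots> \<le> fact (Suc j) * ((6 * c + 9) * real m ^ 4) * (real m * (B * ln (real n))) ^ j"
      using Tle Dle c1 by (intro mult_mono power_mono mult_left_mono) auto
    \<comment> \<open>The root triangle contributes \<open>m^4\<close> and the attached triangles
      \<open>m^j\<close>, where \<open>4 + j = k + 1\<close>.\<close>
    also have "\<dots> = A * B ^ j * (real m ^ (k + 1) * ln (real n) ^ (k - 3))"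
      by (simp add: A_def k power_add power_mult_distrib power4_eq_xxxx algebra_simps)
    also have "real m ^ (k + 1) = real n powr ((real k + 1) / 2)"
    proof -
      have "real n powr ((real k + 1) / 2) = (real m powr 2) powr ((real k + 1) / 2)"
        using m by (simp add: nm(2) powr_numeral)
      also have "\<dots> = real m powr (2 * ((real k + 1) / 2))" by (rule powr_powr)
      also have "2 * ((real k + 1) / 2) = real (k + 1)" by simp
      also have "real m powr real (k + 1) = real m ^ (k + 1)" using m by (subst powr_realpow) auto
      finally show ?thesis ..
    qed
    finally show "\<exists>S. finite S \<and> card S = n \<and> general_position S \<and>
           real (card (k_holes k S))
             \<le> A * B ^ j * (real n powr ((real k + 1) / 2) * ln (real n) ^ (k - 3))"
      using S(1-3) nm(1) by blast
  qed
qed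

end
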